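(* For every $n\in\mathbb N$, there is an equivalence of categories $$\mathcal S_{[n]}\simeq\mathrm{Fam}\Big(\prod_{M\in\mathcal M_n}\mathcal S_{\mathrm{cod}(M)}\Big).$$
   Context: Base category. Let $\mathcal C$ be the category generated by the following graph modulo relations. Objects: $\star$; $[n]$ ($n\in\mathbb N$); for each $n$: $\mathrm{tick}_n,\mathrm{paral}_n,\mathrm{parar}_n,\nu_n,\mathrm{para}_n$; for each $n$, $1\le i\le n$: $\iota^+_{n,i},\iota^-_{n,i}$; for $n,m$, $1\le i\le n$, $1\le j\le m$: $\tau_{n,i,m,j}$. Arrows: $d_1,\dots,d_n\colon\star\to[n]$; $s,t\colon[n]\to c$ for $c\in\{\mathrm{tick}_n,\mathrm{paral}_n,\mathrm{parar}_n,\iota^\pm_{n,i}\}$; $s\colon[n]\to\nu_n$, $t\colon[n+1]\to\nu_n$; $l\colon\mathrm{paral}_n\to\mathrm{para}_n$, $r\colon\mathrm{parar}_n\to\mathrm{para}_n$; $\epsilon\colon\iota^+_{n,i}\to\tau_{n,i,m,j}$, $\rho\colon\iota^-_{m,j}\to\tau_{n,i,m,j}$. Relations: $s\circ d_i=t\circ d_i$ ($1\le i\le n$) for each pair $s,t$ into a common object; $l\circ s=r\circ s$; $\epsilon\circ s\circ d_i=\rho\circ s\circ d_j$. $\widehat{\mathcal C}=[\mathcal C^{op},\mathbf{Set}]$, objects identified with representables. A position is a finite presheaf empty outside $\star$ and the $[n]$ (channels over $\star$, players knowing $n$ channels over $[n]$). Basic moves: for $c\in\{\mathrm{tick}_n,\mathrm{paral}_n,\mathrm{parar}_n,\nu_n,\iota^\pm_{n,i}\}$,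 the cospan $[n]\xrightarrow{s}c\xleftarrow{t}[n']$ in $\widehat{\mathcal C}$ ($n'=n+1$ for $\nu_n$, else $n'=n$), with interface $n\cdot\star$ mapped into $[n]$, $[n']$ by $[d_1,\dots,d_n]$; any isomorphic cospan is also a basic move. Extended moves: push a move with interface $I$ out along a morphism $I\to Z$ to a position $Z$. Plays: monos $X_0\hookrightarrow U$ with $U$ the colimit of a finite or countable chain of extended moves starting at $X_0$. Views: plays $[n]\hookrightarrow V$ from finite (possibly empty) chains of extended basic moves. $\mathcal E_X$: plays $Y\hookrightarrow U$ with a morphism $Y\to X$; morphisms pairs $(h,k)$ commuting with inclusions and maps to $X$. $\mathcal V_X$: full subcategory of views; $\mathcal S_X=[\mathcal V_X^{op},\mathbf{Set}]$ (innocent strategies). $[n]$ also denotes the position given by the representable on $[n]$. $\mathcal M_n$ is the set of isomorphism classes (as cospans in $\widehat{\mathcal C}$) of basic moves with initial position $[n]$; for $M\colon [n]\to M\leftarrow[n']$ in $\mathcal M_n$, $\mathrm{cod}(M)=[n']$. For a locally small category $\mathcal D$, $\mathrm{Fam}(\mathcal D)$ has as objects pairs $(Y,p)$ of a set $Y$ and a function $p\colon Y\to\mathrm{ob}(\mathcal D)$, and as morphisms $(Y,p)\to(Z,q)$ pairs $(u\colon Y\to Z,\ v\colon Y\to\mathrm{mor}(\mathcal D))$ with $\mathrm{dom}\circ v=p$ and $\mathrm{cod}\circ v=q\circ u$. *)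

theory Defs
  imports
    "HOL-Library.FuncSet"
    "HOL-Library.Countable_Set"
    "HOL-Library.Extended_Nat"
    "HOL-Library.Infinite_Typeclass"
begin

section \<open>Categories\<close>

record ('o, 'a) cat =
  Ob :: "'o set"
  Arr :: "'a set"
  Dom :: "'a \<Rightarrow> 'o"
  Cod :: "'a \<Rightarrow> 'o"
  Ide :: "'o \<Rightarrow> 'a"
  Cmp :: "'a \<Rightarrow> 'a \<Rightarrow> 'a"  \<comment> \<open>\<open>Cmp C g f\<close> is \<open>g\<close> after \<open>f\<close>\<close>

definition hom :: "('o, 'a) cat \<Rightarrow> 'o \<Rightarrow> 'o \<Rightarrow> 'a set" where
  "hom C a b = {f \<in> Arr C. Dom C f = a \<and> Cod C f = b}"

locale category =
  fixes C :: "('o, 'a) cat"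
  assumes dom_cod: "f \<in> Arr C \<Longrightarrow> Dom C f \<in> Ob C \<and> Cod C f \<in> Ob C"
    and ide: "a \<in> Ob C \<Longrightarrow> Ide C a \<in> hom C a a"
    and cmp: "f \<in> hom C a b \<Longrightarrow> g \<in> hom C b c \<Longrightarrow> Cmp C g f \<in> hom C a c"
    and ide_right: "f \<in> hom C a b \<Longrightarrow> Cmp C f (Ide C a) = f"
    and ide_left: "f \<in> hom C a b \<Longrightarrow> Cmp C (Ide C b) f = f"
    and assoc: "f \<in> hom C a b \<Longrightarrow> g \<in> hom C b c \<Longrightarrow> h \<in> hom C c d \<Longrightarrow>
      Cmp C h (Cmp C g f) = Cmp C (Cmp C h g) f"

definition is_iso :: "('o, 'a) cat \<Rightarrow> 'a \<Rightarrow> bool" where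
  "is_iso C f \<longleftrightarrow> f \<in> Arr C \<and>
    (\<exists>g \<in> hom C (Cod C f) (Dom C f). Cmp C g f = Ide C (Dom C f) \<and> Cmp C f g = Ide C (Cod C f))"

definition is_mono :: "('o, 'a) cat \<Rightarrow> 'a \<Rightarrow> bool" where
  "is_mono C m \<longleftrightarrow> m \<in> Arr C \<and>
    (\<forall>a. \<forall>f \<in> hom C a (Dom C m). \<forall>g \<in> hom C a (Dom C m). Cmp C m f = Cmp C m g \<longrightarrow> f = g)"

definition op_cat :: "('o, 'a) cat \<Rightarrow> ('o, 'a) cat" where
  "op_cat C = C\<lparr>Dom := Cod C, Cod := Dom C, Cmp := (\<lambda>g f. Cmp C f g)\<rparr>"

definition full_subcat :: "('o, 'a) cat \<Rightarrow> ('o \<Rightarrow> bool) \<Rightarrow> ('o, 'a) cat" where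
  "full_subcat C P = C\<lparr>Ob := {a \<in> Ob C. P a}, Arr := {f \<in> Arr C. P (Dom C f) \<and> P (Cod C f)}\<rparr>"

subsection \<open>Functors and equivalences\<close>

record ('o1, 'a1, 'o2, 'a2) ftor =
  FO :: "'o1 \<Rightarrow> 'o2"
  FA :: "'a1 \<Rightarrow> 'a2"

definition is_functor :: "('o1, 'a1) cat \<Rightarrow> ('o2, 'a2) cat \<Rightarrow> ('o1, 'a1, 'o2, 'a2) ftor \<Rightarrow> bool" where
  "is_functor A B F \<longleftrightarrow>
    (\<forall>a \<in> Ob A. FO F a \<in> Ob B) \<and>
    (\<forall>f \<in> Arr A. FA F f \<in> hom B (FO F (Dom A f)) (FO F (Cod A f))) \<and>
    (\<forall>a \<in> Ob A. FA F (Ide A a) = Ide B (FO F a)) \<and>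
    (\<forall>f \<in> Arr A. \<forall>g \<in> Arr A. Cod A f = Dom A g \<longrightarrow> FA F (Cmp A g f) = Cmp B (FA F g) (FA F f))"

definition id_ftor :: "('o, 'a, 'o, 'a) ftor" where
  "id_ftor = \<lparr>FO = (\<lambda>a. a), FA = (\<lambda>f. f)\<rparr>"

definition comp_ftor ::
  "('o2, 'a2, 'o3, 'a3) ftor \<Rightarrow> ('o1, 'a1, 'o2, 'a2) ftor \<Rightarrow> ('o1, 'a1, 'o3, 'a3) ftor" where
  "comp_ftor G F = \<lparr>FO = FO G \<circ> FO F, FA = FA G \<circ> FA F\<rparr>"

definition is_nat_trans :: "('o1, 'a1) cat \<Rightarrow> ('o2, 'a2) cat \<Rightarrow>
    ('o1, 'a1, 'o2, 'a2) ftor \<Rightarrow> ('o1, 'a1, 'o2, 'a2) ftor \<Rightarrow> ('o1 \<Rightarrow> 'a2) \<Rightarrow> bool" where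
  "is_nat_trans A B F G \<alpha> \<longleftrightarrow>
    (\<forall>a \<in> Ob A. \<alpha> a \<in> hom B (FO F a) (FO G a)) \<and>
    (\<forall>f \<in> Arr A. Cmp B (\<alpha> (Cod A f)) (FA F f) = Cmp B (FA G f) (\<alpha> (Dom A f)))"

definition naturally_isomorphic :: "('o1, 'a1) cat \<Rightarrow> ('o2, 'a2) cat \<Rightarrow>
    ('o1, 'a1, 'o2, 'a2) ftor \<Rightarrow> ('o1, 'a1, 'o2, 'a2) ftor \<Rightarrow> bool" where
  "naturally_isomorphic A B F G \<longleftrightarrow> (\<exists>\<alpha>. is_nat_trans A B F G \<alpha> \<and> (\<forall>a \<in> Ob A. is_iso B (\<alpha> a)))"

definition equivalent_categories :: "('o1, 'a1) cat \<Rightarrow> ('o2, 'a2) cat \<Rightarrow> bool" where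
  "equivalent_categories A B \<longleftrightarrow> category A \<and> category B \<and>
    (\<exists>F G. is_functor A B F \<and> is_functor B A G \<and>
      naturally_isomorphic A A (comp_ftor G F) id_ftor \<and>
      naturally_isomorphic B B (comp_ftor F G) id_ftor)"

subsection \<open>Colimits\<close>

text \<open>A diagram has nodes \<open>J\<close>, an object \<open>D j\<close> at each node \<open>j\<close>, and a set \<open>E\<close> of
  labelled edges: \<open>(j, k, f) \<in> E\<close> stands for \<open>f : D j \<rightarrow> D k\<close>.\<close>

definition is_cocone :: "('o, 'a) cat \<Rightarrow> 'j set \<Rightarrow> ('j \<Rightarrow> 'o) \<Rightarrow> ('j \<times> 'j \<times> 'a) set \<Rightarrow>
    'o \<Rightarrow> ('j \<Rightarrow> 'a) \<Rightarrow> bool" where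
  "is_cocone C J D E P q \<longleftrightarrow> P \<in> Ob C \<and> (\<forall>j \<in> J. q j \<in> hom C (D j) P) \<and>
    (\<forall>(j, k, f) \<in> E. Cmp C (q k) f = q j)"

definition is_colimit :: "('o, 'a) cat \<Rightarrow> 'j set \<Rightarrow> ('j \<Rightarrow> 'o) \<Rightarrow> ('j \<times> 'j \<times> 'a) set \<Rightarrow>
    'o \<Rightarrow> ('j \<Rightarrow> 'a) \<Rightarrow> bool" where
  "is_colimit C J D E P q \<longleftrightarrow>
    (\<forall>j \<in> J. D j \<in> Ob C) \<and> (\<forall>(j, k, f) \<in> E. j \<in> J \<and> k \<in> J \<and> f \<in> hom C (D j) (D k)) \<and>
    is_cocone C J D E P q \<and>
    (\<forall>Q r. is_cocone C J D E Q r \<longrightarrow> (\<exists>!m. m \<in> hom C P Q \<and> (\<forall>j \<in> J. Cmp C m (q j) = r j)))"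

definition comm_square :: "('o, 'a) cat \<Rightarrow> 'a \<Rightarrow> 'a \<Rightarrow> 'a \<Rightarrow> 'a \<Rightarrow> bool" where
  "comm_square C f g p q \<longleftrightarrow> {f, g, p, q} \<subseteq> Arr C \<and>
    Dom C f = Dom C g \<and> Dom C p = Cod C f \<and> Dom C q = Cod C g \<and> Cod C p = Cod C q \<and>
    Cmp C p f = Cmp C q g"

definition is_pushout :: "('o, 'a) cat \<Rightarrow> 'a \<Rightarrow> 'a \<Rightarrow> 'a \<Rightarrow> 'a \<Rightarrow> bool" where
  "is_pushout C f g p q \<longleftrightarrow> comm_square C f g p q \<and>
    (\<forall>p' q'. comm_square C f g p' q' \<longrightarrow>
      (\<exists>!m. m \<in> hom C (Cod C p) (Cod C p') \<and> Cmp C m p = p' \<and> Cmp C m q = q'))"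

subsection \<open>Sets, functor categories, products, families\<close>

datatype ('o, 'x) arrow = Arrow (src: 'o) (val: 'x) (tgt: 'o)

text \<open>The universe of small sets consists of the subsets of a type \<open>'u\<close>; it is only ever used
  for infinite \<open>'u\<close>.\<close>

type_synonym 'u sarr = "('u set, 'u \<Rightarrow> 'u) arrow"

definition Sets :: "('u set, 'u sarr) cat" where
  "Sets = \<lparr>Ob = UNIV, Arr = {Arrow A f B | A f B. f \<in> A \<rightarrow>\<^sub>E B}, Dom = src, Cod = tgt,
    Ide = (\<lambda>A. Arrow A (\<lambda>x\<in>A. x) A),
    Cmp = (\<lambda>g f. Arrow (src f) (compose (src f) (val g) (val f)) (tgt g))\<rparr>"

definition functor_cat :: "('o1, 'a1) cat \<Rightarrow> ('o2, 'a2) cat \<Rightarrow>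
    (('o1, 'a1, 'o2, 'a2) ftor, (('o1, 'a1, 'o2, 'a2) ftor, 'o1 \<Rightarrow> 'a2) arrow) cat" where
  "functor_cat A B =
    (let Fs = {F. is_functor A B F \<and> FO F \<in> extensional (Ob A) \<and> FA F \<in> extensional (Arr A)} in
    \<lparr>Ob = Fs,
     Arr = {Arrow F \<alpha> G | F \<alpha> G. F \<in> Fs \<and> G \<in> Fs \<and> is_nat_trans A B F G \<alpha> \<and> \<alpha> \<in> extensional (Ob A)},
     Dom = src, Cod = tgt,
     Ide = (\<lambda>F. Arrow F (\<lambda>a\<in>Ob A. Ide B (FO F a)) F),
     Cmp = (\<lambda>\<beta> \<alpha>. Arrow (src \<alpha>) (\<lambda>a\<in>Ob A. Cmp B (val \<beta> a) (val \<alpha> a)) (tgt \<beta>))\<rparr>)"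

definition product_cat :: "'i set \<Rightarrow> ('i \<Rightarrow> ('o, 'a) cat) \<Rightarrow> ('i \<Rightarrow> 'o, 'i \<Rightarrow> 'a) cat" where
  "product_cat I C =
    \<lparr>Ob = (\<Pi>\<^sub>E i\<in>I. Ob (C i)), Arr = (\<Pi>\<^sub>E i\<in>I. Arr (C i)),
     Dom = (\<lambda>f. \<lambda>i\<in>I. Dom (C i) (f i)), Cod = (\<lambda>f. \<lambda>i\<in>I. Cod (C i) (f i)),
     Ide = (\<lambda>a. \<lambda>i\<in>I. Ide (C i) (a i)),
     Cmp = (\<lambda>g f. \<lambda>i\<in>I. Cmp (C i) (g i) (f i))\<rparr>"

type_synonym ('u, 'o) fam = "'u set \<times> ('u \<Rightarrow> 'o)"
type_synonym ('u, 'o, 'a) fam_arr = "(('u, 'o) fam, ('u \<Rightarrow> 'u) \<times> ('u \<Rightarrow> 'a)) arrow"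

definition Fam :: "('o, 'a) cat \<Rightarrow> (('u, 'o) fam, ('u, 'o, 'a) fam_arr) cat" where
  "Fam D =
    (let Fs = {(Y, p). p \<in> Y \<rightarrow>\<^sub>E Ob D} in
    \<lparr>Ob = Fs,
     Arr = {Arrow (Y, p) (u, v) (Z, q) | Y p u v Z q.
       (Y, p) \<in> Fs \<and> (Z, q) \<in> Fs \<and> u \<in> Y \<rightarrow>\<^sub>E Z \<and> v \<in> Y \<rightarrow>\<^sub>E Arr D \<and>
       (\<forall>y\<in>Y. Dom D (v y) = p y \<and> Cod D (v y) = q (u y))},
     Dom = src, Cod = tgt,
     Ide = (\<lambda>(Y, p). Arrow (Y, p) (\<lambda>y\<in>Y. y, \<lambda>y\<in>Y. Ide D (p y)) (Y, p)),
     Cmp = (\<lambda>g f. case (src f, val f, val g) of ((Y, p), (u, v), (u', v')) \<Rightarrow>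
       Arrow (Y, p) (compose Y u' u, \<lambda>y\<in>Y. Cmp D (v' (u y)) (v y)) (tgt g))\<rparr>)"

section \<open>The base category\<close>

datatype bobj = Star | Pl nat
  | Tick nat | ParaL nat | ParaR nat | Nu nat | IotaP nat nat | IotaM nat nat
  | Para nat | Tau nat nat nat nat

instance bobj :: countable by countable_datatype

definition bobjs :: "bobj set" where
  "bobjs = {Star} \<union> (\<Union>n. {Pl n, Tick n, ParaL n, ParaR n, Nu n, Para n}) \<union>
    {c. \<exists>n. \<exists>i\<in>{1..n}. c = IotaP n i \<or> c = IotaM n i} \<union>
    {Tau n i m j | n i m j. i \<in> {1..n} \<and> j \<in> {1..m}}"

text \<open>\<open>st_obj c n n'\<close>: the object \<open>c\<close> carries arrows \<open>s : [n] \<rightarrow> c\<close> and \<open>t : [n'] \<rightarrow> c\<close>.\<close>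

inductive st_obj :: "bobj \<Rightarrow> nat \<Rightarrow> nat \<Rightarrow> bool" where
  "st_obj (Tick n) n n"
| "st_obj (ParaL n) n n"
| "st_obj (ParaR n) n n"
| "st_obj (Nu n) n (Suc n)"
| "i \<in> {1..n} \<Longrightarrow> st_obj (IotaP n i) n n"
| "i \<in> {1..n} \<Longrightarrow> st_obj (IotaM n i) n n"

datatype gen = Gd nat nat | Gs bobj | Gt bobj | Gl nat | Gr nat
  | Geps nat nat nat nat | Grho nat nat nat nat

instance gen :: countable by countable_datatype

inductive edge :: "bobj \<Rightarrow> gen \<Rightarrow> bobj \<Rightarrow> bool" where
  "i \<in> {1..n} \<Longrightarrow> edge Star (Gd n i) (Pl n)"
| "st_obj c n n' \<Longrightarrow> edge (Pl n) (Gs c) c"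
| "st_obj c n n' \<Longrightarrow> edge (Pl n') (Gt c) c"
| "edge (ParaL n) (Gl n) (Para n)"
| "edge (ParaR n) (Gr n) (Para n)"
| "i \<in> {1..n} \<Longrightarrow> j \<in> {1..m} \<Longrightarrow> edge (IotaP n i) (Geps n i m j) (Tau n i m j)"
| "i \<in> {1..n} \<Longrightarrow> j \<in> {1..m} \<Longrightarrow> edge (IotaM m j) (Grho n i m j) (Tau n i m j)"

text \<open>Paths list the generators in diagrammatic order: \<open>[f, g]\<close> is \<open>g\<close> after \<open>f\<close>.\<close>

inductive bpath :: "bobj \<Rightarrow> gen list \<Rightarrow> bobj \<Rightarrow> bool" where
  "a \<in> bobjs \<Longrightarrow> bpath a [] a"
| "edge a g b \<Longrightarrow> bpath b p c \<Longrightarrow> bpath a (g # p) c"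

inductive brel :: "gen list \<Rightarrow> gen list \<Rightarrow> bool" where
  "st_obj c n n' \<Longrightarrow> i \<in> {1..n} \<Longrightarrow> brel [Gd n i, Gs c] [Gd n' i, Gt c]"
| "brel [Gs (ParaL n), Gl n] [Gs (ParaR n), Gr n]"
| "i \<in> {1..n} \<Longrightarrow> j \<in> {1..m} \<Longrightarrow>
    brel [Gd n i, Gs (IotaP n i), Geps n i m j] [Gd m j, Gs (IotaM m j), Grho n i m j]"

inductive bcong :: "gen list \<Rightarrow> gen list \<Rightarrow> bool" where
  bcong_rel: "brel u v \<Longrightarrow> bcong (p @ u @ q) (p @ v @ q)"
| bcong_refl: "bcong p p"
| bcong_sym: "bcong p q \<Longrightarrow> bcong q p"
| bcong_trans: "bcong p q \<Longrightarrow> bcong q r \<Longrightarrow> bcong p r"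

type_synonym barr = "(bobj, gen list set) arrow"

definition barrow :: "bobj \<Rightarrow> gen list \<Rightarrow> bobj \<Rightarrow> barr" where
  "barrow a p b = Arrow a {q. bcong p q} b"

definition Base :: "(bobj, barr) cat" where
  "Base = \<lparr>Ob = bobjs, Arr = {barrow a p b | a p b. bpath a p b}, Dom = src, Cod = tgt,
    Ide = (\<lambda>a. barrow a [] a),
    Cmp = (\<lambda>g f. Arrow (src f) {r. \<exists>p\<in>val f. \<exists>q\<in>val g. bcong (p @ q) r} (tgt g))\<rparr>"

section \<open>Presheaves on the base category\<close>

type_synonym 'u psh = "(bobj, barr, 'u set, 'u sarr) ftor"
type_synonym 'u parr = "('u psh, bobj \<Rightarrow> 'u sarr) arrow"

definition Chat :: "('u psh, 'u parr) cat" where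
  "Chat = functor_cat (op_cat Base) Sets"

abbreviation ccmp :: "'u parr \<Rightarrow> 'u parr \<Rightarrow> 'u parr" (infixl "\<odot>" 70) where
  "g \<odot> f \<equiv> Cmp Chat g f"

text \<open>The arrows of the base category form a countable set, so they can be named injectively by
  elements of any infinite type; this turns its hom-sets into small sets.\<close>

definition enc :: "barr \<Rightarrow> 'u::infinite" where
  "enc = (SOME f. inj_on f (Arr Base))"

lemma inj_on_enc: "inj_on (enc :: barr \<Rightarrow> 'u::infinite) (Arr Base)"
proof -
  have "Arr Base \<subseteq> (\<lambda>x. barrow (fst x) (fst (snd x)) (snd (snd x))) ` UNIV"
  proof
    fix f assume "f \<in> Arr Base"
    then obtain a p b where "f = barrow a p b" by (auto simp: Base_def)
    then show "f \<in> (\<lambda>x. barrow (fst x) (fst (snd x)) (snd (snd x))) ` UNIV"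
      by (intro image_eqI[where x = "(a, p, b)"]) auto
  qed
  then have "countable (Arr Base)"
    by (rule countable_subset) auto
  then obtain h :: "barr \<Rightarrow> nat" where h: "inj_on h (Arr Base)"
    by (auto simp: countable_def)
  obtain k :: "nat \<Rightarrow> 'u" where "inj k"
    using infinite_countable_subset[OF infinite_UNIV] by blast
  then have "inj_on (k \<circ> h) (Arr Base)"
    using h by (auto intro: comp_inj_on inj_on_subset)
  then show ?thesis unfolding enc_def by (rule someI[where P = "\<lambda>f. inj_on f (Arr Base)"])
qed

definition dec :: "'u::infinite \<Rightarrow> barr" where
  "dec = inv_into (Arr Base) enc"

definition yo :: "bobj \<Rightarrow> 'u::infinite psh" where
  "yo c = \<lparr>FO = (\<lambda>d\<in>Ob Base. enc ` hom Base d c),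
    FA = (\<lambda>f\<in>Arr Base. Arrow (enc ` hom Base (tgt f) c)
      (\<lambda>x\<in>enc ` hom Base (tgt f) c. enc (Cmp Base (dec x) f)) (enc ` hom Base (src f) c))\<rparr>"

definition yo_arr :: "barr \<Rightarrow> 'u::infinite parr" where
  "yo_arr f = Arrow (yo (src f))
    (\<lambda>d\<in>Ob Base. Arrow (enc ` hom Base d (src f))
      (\<lambda>x\<in>enc ` hom Base d (src f). enc (Cmp Base f (dec x))) (enc ` hom Base d (tgt f)))
    (yo (tgt f))"

text \<open>The image under the Yoneda embedding of the arrow denoted by a path.\<close>

abbreviation yo_path :: "bobj \<Rightarrow> gen list \<Rightarrow> bobj \<Rightarrow> 'u::infinite parr" where
  "yo_path a p b \<equiv> yo_arr (barrow a p b)"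

abbreviation yd :: "nat \<Rightarrow> nat \<Rightarrow> 'u::infinite parr" where
  "yd n i \<equiv> yo_path Star [Gd n i] (Pl n)"

definition is_position :: "'u psh \<Rightarrow> bool" where
  "is_position X \<longleftrightarrow> X \<in> Ob Chat \<and> (\<forall>c \<in> Ob Base - ({Star} \<union> range Pl). FO X c = {}) \<and>
    finite (SIGMA c : Ob Base. FO X c)"

section \<open>Moves\<close>

text \<open>A cospan is a pair \<open>(s, t)\<close> of arrows of presheaves with common target; its initial position
  is the source of \<open>s\<close> and its final position the source of \<open>t\<close>.\<close>

type_synonym 'u cospan = "'u parr \<times> 'u parr"

definition is_cospan :: "'u cospan \<Rightarrow> bool" where
  "is_cospan M \<longleftrightarrow> fst M \<in> Arr Chat \<and> snd M \<in> Arr Chat \<and> tgt (fst M) = tgt (snd M)"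

definition cospan_iso_by :: "'u parr \<Rightarrow> 'u parr \<Rightarrow> 'u parr \<Rightarrow> 'u cospan \<Rightarrow> 'u cospan \<Rightarrow> bool" where
  "cospan_iso_by x u y M N \<longleftrightarrow> is_cospan M \<and> is_cospan N \<and>
    is_iso Chat x \<and> src x = src (fst M) \<and> tgt x = src (fst N) \<and>
    is_iso Chat u \<and> src u = tgt (fst M) \<and> tgt u = tgt (fst N) \<and>
    is_iso Chat y \<and> src y = src (snd M) \<and> tgt y = src (snd N) \<and>
    fst N \<odot> x = u \<odot> fst M \<and> snd N \<odot> y = u \<odot> snd M"

definition basic_cospan :: "bobj \<Rightarrow> nat \<Rightarrow> nat \<Rightarrow> 'u::infinite cospan" where
  "basic_cospan c n n' = (yo_path (Pl n) [Gs c] c, yo_path (Pl n') [Gt c] c)"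

text \<open>\<open>I\<close> is \<open>n \<cdot> \<star>\<close> with injections \<open>\<iota>\<close>.\<close>

definition is_copower_star :: "nat \<Rightarrow> 'u::infinite psh \<Rightarrow> (nat \<Rightarrow> 'u parr) \<Rightarrow> bool" where
  "is_copower_star n I \<iota> \<longleftrightarrow> is_colimit Chat {1..n} (\<lambda>_. yo Star) {} I \<iota>"

text \<open>\<open>basic_move M a b\<close>: the cospan \<open>M\<close> is a basic move, with interface included by
  \<open>a\<close> into the initial and by \<open>b\<close> into the final position.\<close>

definition basic_move :: "'u::infinite cospan \<Rightarrow> 'u parr \<Rightarrow> 'u parr \<Rightarrow> bool" where
  "basic_move M a b \<longleftrightarrow>
    (\<exists>c n n' x u y I \<iota>. st_obj c n n' \<and> cospan_iso_by x u y (basic_cospan c n n') M \<and>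
      is_copower_star n I \<iota> \<and> a \<in> hom Chat I (src (fst M)) \<and> b \<in> hom Chat I (src (snd M)) \<and>
      (\<forall>i\<in>{1..n}. a \<odot> \<iota> i = x \<odot> yd n i \<and> b \<odot> \<iota> i = y \<odot> yd n' i))"

text \<open>Forking, \<open>[n] \<rightarrow> para_n \<leftarrow> [n] | [n]\<close>, and synchronisation,
  \<open>[n] _i|_j [m] \<rightarrow> \<tau> \<leftarrow> [n] _i|_j [m]\<close>, where \<open>|\<close> glues two players along all
  their channels, and \<open>_i|_j\<close> along the \<open>i\<close>-th channel of the first and the \<open>j\<close>-th channel of the
  second. They occur in plays but not in views.\<close>

definition fork_move :: "'u::infinite cospan \<Rightarrow> 'u parr \<Rightarrow> 'u parr \<Rightarrow> bool" where
  "fork_move M a b \<longleftrightarrow> is_cospan M \<and>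
    (\<exists>n x u I \<iota> e y1 y2.
      is_iso Chat x \<and> src x = yo (Pl n) \<and> tgt x = src (fst M) \<and>
      is_iso Chat u \<and> src u = yo (Para n) \<and> tgt u = tgt (fst M) \<and>
      is_copower_star n I \<iota> \<and> e \<in> hom Chat I (yo (Pl n)) \<and> (\<forall>i\<in>{1..n}. e \<odot> \<iota> i = yd n i) \<and>
      is_pushout Chat e e y1 y2 \<and> tgt y1 = src (snd M) \<and>
      fst M \<odot> x = u \<odot> yo_path (Pl n) [Gs (ParaL n), Gl n] (Para n) \<and>
      snd M \<odot> y1 = u \<odot> yo_path (Pl n) [Gt (ParaL n), Gl n] (Para n) \<and>
      snd M \<odot> y2 = u \<odot> yo_path (Pl n) [Gt (ParaR n), Gr n] (Para n) \<and>
      a = x \<odot> e \<and> b = y1 \<odot> e)"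

definition sync_move :: "'u::infinite cospan \<Rightarrow> 'u parr \<Rightarrow> 'u parr \<Rightarrow> bool" where
  "sync_move M a b \<longleftrightarrow> is_cospan M \<and>
    (\<exists>n i m j u x1 x2 y1 y2 I1 \<iota>1 e1 I2 \<iota>2 e2 k1 k2.
      i \<in> {1..n} \<and> j \<in> {1..m} \<and>
      is_iso Chat u \<and> src u = yo (Tau n i m j) \<and> tgt u = tgt (fst M) \<and>
      is_pushout Chat (yd n i) (yd m j) x1 x2 \<and> tgt x1 = src (fst M) \<and>
      is_pushout Chat (yd n i) (yd m j) y1 y2 \<and> tgt y1 = src (snd M) \<and>
      fst M \<odot> x1 = u \<odot> yo_path (Pl n) [Gs (IotaP n i), Geps n i m j] (Tau n i m j) \<and>
      fst M \<odot> x2 = u \<odot> yo_path (Pl m) [Gs (IotaM m j), Grho n i m j] (Tau n i m j) \<and>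
      snd M \<odot> y1 = u \<odot> yo_path (Pl n) [Gt (IotaP n i), Geps n i m j] (Tau n i m j) \<and>
      snd M \<odot> y2 = u \<odot> yo_path (Pl m) [Gt (IotaM m j), Grho n i m j] (Tau n i m j) \<and>
      is_copower_star n I1 \<iota>1 \<and> e1 \<in> hom Chat I1 (yo (Pl n)) \<and> (\<forall>k\<in>{1..n}. e1 \<odot> \<iota>1 k = yd n k) \<and>
      is_copower_star m I2 \<iota>2 \<and> e2 \<in> hom Chat I2 (yo (Pl m)) \<and> (\<forall>k\<in>{1..m}. e2 \<odot> \<iota>2 k = yd m k) \<and>
      is_pushout Chat (\<iota>1 i) (\<iota>2 j) k1 k2 \<and>
      a \<in> hom Chat (tgt k1) (src (fst M)) \<and> a \<odot> k1 = x1 \<odot> e1 \<and> a \<odot> k2 = x2 \<odot> e2 \<and>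
      b \<in> hom Chat (tgt k1) (src (snd M)) \<and> b \<odot> k1 = y1 \<odot> e1 \<and> b \<odot> k2 = y2 \<odot> e2)"

definition move :: "'u::infinite cospan \<Rightarrow> 'u parr \<Rightarrow> 'u parr \<Rightarrow> bool" where
  "move M a b \<longleftrightarrow> basic_move M a b \<or> fork_move M a b \<or> sync_move M a b"

text \<open>\<open>N\<close> is obtained from a move \<open>M\<close> of kind \<open>K\<close> by pushing it out along \<open>z : I \<rightarrow> Z\<close>.\<close>

definition extended :: "('u cospan \<Rightarrow> 'u parr \<Rightarrow> 'u parr \<Rightarrow> bool) \<Rightarrow> 'u cospan \<Rightarrow> bool" where
  "extended K N \<longleftrightarrow> is_cospan N \<and>
    (\<exists>M a b z x zx u zu y zy. K M a b \<and> z \<in> hom Chat (src a) (tgt z) \<and> is_position (tgt z) \<and>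
      is_pushout Chat a z x zx \<and> tgt x = src (fst N) \<and>
      is_pushout Chat (fst M \<odot> a) z u zu \<and> tgt u = tgt (fst N) \<and>
      is_pushout Chat b z y zy \<and> tgt y = src (snd N) \<and>
      fst N \<odot> x = u \<odot> fst M \<and> fst N \<odot> zx = zu \<and>
      snd N \<odot> y = u \<odot> snd M \<and> snd N \<odot> zy = zu)"

section \<open>Plays, views and innocent strategies\<close>

text \<open>\<open>i : X 0 \<rightarrow> U\<close> is the inclusion into the colimit of the zigzag
  \<open>X 0 \<rightarrow> U 0 \<leftarrow> X 1 \<rightarrow> U 1 \<leftarrow> X 2 \<rightarrow> \<dots>\<close> formed by \<open>N\<close> successive cospans \<open>M 0, M 1, \<dots>\<close>
  satisfying \<open>K\<close>; the node \<open>Inl k\<close> carries \<open>X k\<close> and \<open>Inr k\<close> carries \<open>U k\<close>.\<close>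

definition chain_play :: "('u cospan \<Rightarrow> bool) \<Rightarrow> enat \<Rightarrow> 'u parr \<Rightarrow> bool" where
  "chain_play K N i \<longleftrightarrow> is_mono Chat i \<and> is_position (src i) \<and>
    (\<exists>(X :: nat \<Rightarrow> 'u psh) (M :: nat \<Rightarrow> 'u cospan) (q :: nat + nat \<Rightarrow> 'u parr).
      X 0 = src i \<and> q (Inl 0) = i \<and>
      (\<forall>k. enat k < N \<longrightarrow> K (M k) \<and> src (fst (M k)) = X k \<and> src (snd (M k)) = X (Suc k)) \<and>
      is_colimit Chat (Inl ` {k. enat k \<le> N} \<union> Inr ` {k. enat k < N})
        (case_sum X (\<lambda>k. tgt (fst (M k))))
        ((\<lambda>k. (Inl k, Inr k, fst (M k))) ` {k. enat k < N} \<union>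
         (\<lambda>k. (Inl (Suc k), Inr k, snd (M k))) ` {k. enat k < N})
        (tgt i) q)"

definition is_play :: "'u::infinite parr \<Rightarrow> bool" where
  "is_play i \<longleftrightarrow> (\<exists>N. chain_play (extended move) N i)"

definition is_view :: "'u::infinite parr \<Rightarrow> bool" where
  "is_view i \<longleftrightarrow> (\<exists>n. src i = yo (Pl n)) \<and> (\<exists>N. chain_play (extended basic_move) (enat N) i)"

type_synonym 'u play_over = "'u parr \<times> 'u parr"
type_synonym 'u play_arr = "('u play_over, 'u parr \<times> 'u parr) arrow"

definition Plays :: "'u::infinite psh \<Rightarrow> ('u play_over, 'u play_arr) cat" where
  "Plays X =
    (let Ps = {(i, p). is_play i \<and> p \<in> hom Chat (src i) X} in
    \<lparr>Ob = Ps,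
     Arr = {Arrow (i, p) (h, k) (i', p') | i p h k i' p'. (i, p) \<in> Ps \<and> (i', p') \<in> Ps \<and>
       h \<in> hom Chat (src i) (src i') \<and> k \<in> hom Chat (tgt i) (tgt i') \<and>
       k \<odot> i = i' \<odot> h \<and> p' \<odot> h = p},
     Dom = src, Cod = tgt,
     Ide = (\<lambda>(i, p). Arrow (i, p) (Ide Chat (src i), Ide Chat (tgt i)) (i, p)),
     Cmp = (\<lambda>g f. Arrow (src f) (fst (val g) \<odot> fst (val f), snd (val g) \<odot> snd (val f)) (tgt g))\<rparr>)"

definition Views :: "'u::infinite psh \<Rightarrow> ('u play_over, 'u play_arr) cat" where
  "Views X = full_subcat (Plays X) (\<lambda>(i, p). is_view i)"

type_synonym 'u strategy = "('u play_over, 'u play_arr, 'u set, 'u sarr) ftor"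
type_synonym 'u strategy_arr = "('u strategy, 'u play_over \<Rightarrow> 'u sarr) arrow"

definition Strat :: "'u::infinite psh \<Rightarrow> ('u strategy, 'u strategy_arr) cat" where
  "Strat X = functor_cat (op_cat (Views X)) Sets"

definition basic_moves_from :: "nat \<Rightarrow> 'u::infinite cospan set" where
  "basic_moves_from n = {M. src (fst M) = yo (Pl n) \<and> (\<exists>a b. basic_move M a b)}"

definition move_classes :: "nat \<Rightarrow> 'u::infinite cospan set set" where
  "move_classes n =
    basic_moves_from n // {(M, N) \<in> basic_moves_from n \<times> basic_moves_from n. \<exists>x u y. cospan_iso_by x u y M N}"

definition cod_pos :: "'u::infinite cospan set \<Rightarrow> 'u psh" where
  "cod_pos \<M> = yo (Pl (THE n'. \<exists>M\<in>\<M>. src (snd M) = yo (Pl n')))"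

end

theory Submission
  imports Defs "HOL-Library.Sublist"
begin

text \<open>
  Extending a basic move along a position yields a single player only if nothing is added, so a
  view from \<open>[n]\<close> is, up to isomorphism, a composable word of objects \<open>c\<close> with arrows \<open>s\<close>, \<open>t\<close>,
  starting at \<open>[n]\<close>. A map of views preserving the initial player sends the \<open>k\<close>-th move to the
  \<open>k\<close>-th move; hence it is unique, and it exists iff one word is a prefix of the other. So the
  category of views over \<open>[n]\<close> is equivalent to the poset of words, whose part above the empty word
  is the disjoint union, over the first letters, of the posets of words for the codomains of these
  letters. A presheaf \<open>P\<close> on such a tree is the set \<open>P(root)\<close> together with, for each of its
  elements, the fibres of \<open>P\<close> over it in each branch.
\<close>

section \<open>Categories and functors\<close>

lemma homI: "f \<in> Arr C \<Longrightarrow> Dom C f = a \<Longrightarrow> Cod C f = b \<Longrightarrow> f \<in> hom C a b"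
  by (simp add: hom_def)

lemma homD:
  assumes "f \<in> hom C a b"
  shows "f \<in> Arr C" "Dom C f = a" "Cod C f = b"
  using assms by (simp_all add: hom_def)

lemma Arr_hom: "f \<in> Arr C \<Longrightarrow> f \<in> hom C (Dom C f) (Cod C f)"
  by (simp add: hom_def)

context category
begin

lemma hom_Ob:
  assumes "f \<in> hom C a b"
  shows "a \<in> Ob C" "b \<in> Ob C"
  using assms dom_cod by (auto simp: hom_def)

lemma is_isoI:
  "f \<in> hom C a b \<Longrightarrow> g \<in> hom C b a \<Longrightarrow> Cmp C g f = Ide C a \<Longrightarrow> Cmp C f g = Ide C b \<Longrightarrow> is_iso C f"
  by (auto simp: is_iso_def hom_def)

lemma is_isoE:
  assumes "is_iso C f" "f \<in> hom C a b"
  obtains g where "g \<in> hom C b a" "Cmp C g f = Ide C a" "Cmp C f g = Ide C b" "is_iso C g"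
  using assms by (fastforce simp: is_iso_def hom_def)

lemma is_iso_Ide: "a \<in> Ob C \<Longrightarrow> is_iso C (Ide C a)"
  using ide ide_left by (auto intro!: is_isoI)

lemma cancel_inverse_left:
  assumes "f \<in> hom C a b" "e \<in> hom C b c" "e' \<in> hom C c b" "Cmp C e' e = Ide C b"
  shows "Cmp C e' (Cmp C e f) = f"
  using assms assoc[OF assms(1-3)] ide_left[OF assms(1)] by simp

lemma cancel_inverse_right:
  assumes "f \<in> hom C b c" "e \<in> hom C a b" "e' \<in> hom C b a" "Cmp C e e' = Ide C b"
  shows "Cmp C (Cmp C f e) e' = f"
  using assms assoc[OF assms(3,2,1)] ide_right[OF assms(1)] by simp

lemma iso_cancel_left:
  assumes "is_iso C e" "e \<in> hom C b c" "f \<in> hom C a b" "g \<in> hom C a b" "Cmp C e f = Cmp C e g"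
  shows "f = g"
proof -
  obtain e' where e': "e' \<in> hom C c b" "Cmp C e' e = Ide C b"
    by (rule is_isoE[OF assms(1,2)]) blast
  show ?thesis
    using cancel_inverse_left[OF assms(3,2) e'] cancel_inverse_left[OF assms(4,2) e'] assms(5)
    by metis
qed

lemma iso_cancel_right:
  assumes "is_iso C e" "e \<in> hom C a b" "f \<in> hom C b c" "g \<in> hom C b c" "Cmp C f e = Cmp C g e"
  shows "f = g"
proof -
  obtain e' where e': "e' \<in> hom C b a" "Cmp C e e' = Ide C b"
    by (rule is_isoE[OF assms(1,2)]) blast
  show ?thesis
    using cancel_inverse_right[OF assms(3,2) e'] cancel_inverse_right[OF assms(4,2) e'] assms(5)
    by metis
qed

lemma is_iso_Cmp:
  assumes "is_iso C f" "is_iso C g" "f \<in> hom C a b" "g \<in> hom C b c"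
  shows "is_iso C (Cmp C g f)"
proof -
  obtain f' where f': "f' \<in> hom C b a" "Cmp C f' f = Ide C a" "Cmp C f f' = Ide C b"
    using is_isoE[OF assms(1,3)] by metis
  obtain g' where g': "g' \<in> hom C c b" "Cmp C g' g = Ide C b" "Cmp C g g' = Ide C c"
    using is_isoE[OF assms(2,4)] by metis
  note gf = cmp[OF assms(3,4)] and f'g' = cmp[OF g'(1) f'(1)]
  show ?thesis
  proof (rule is_isoI[OF gf f'g'])
    show "Cmp C (Cmp C f' g') (Cmp C g f) = Ide C a"
      using assoc[OF gf g'(1) f'(1)] cancel_inverse_left[OF assms(3,4) g'(1,2)] f'(2) by simp
    show "Cmp C (Cmp C g f) (Cmp C f' g') = Ide C c"
      using assoc[OF f'g' assms(3,4)] cancel_inverse_left[OF g'(1) f'(1) assms(3) f'(3)] g'(3)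
      by simp
  qed
qed

end

subsection \<open>Functors and natural transformations\<close>

lemma is_functorI:
  assumes "\<And>a. a \<in> Ob A \<Longrightarrow> FO F a \<in> Ob B"
    and "\<And>f a b. f \<in> hom A a b \<Longrightarrow> FA F f \<in> hom B (FO F a) (FO F b)"
    and "\<And>a. a \<in> Ob A \<Longrightarrow> FA F (Ide A a) = Ide B (FO F a)"
    and "\<And>f g a b c. f \<in> hom A a b \<Longrightarrow> g \<in> hom A b c \<Longrightarrow> FA F (Cmp A g f) = Cmp B (FA F g) (FA F f)"
  shows "is_functor A B F"
  using assms(1,3) assms(2)[OF Arr_hom] assms(4)[OF Arr_hom homI] by (auto simp: is_functor_def)

lemma functor_Ob: "is_functor A B F \<Longrightarrow> a \<in> Ob A \<Longrightarrow> FO F a \<in> Ob B"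
  by (simp add: is_functor_def)

lemma functor_hom: "is_functor A B F \<Longrightarrow> f \<in> hom A a b \<Longrightarrow> FA F f \<in> hom B (FO F a) (FO F b)"
  by (auto simp: is_functor_def hom_def)

lemma functor_Ide: "is_functor A B F \<Longrightarrow> a \<in> Ob A \<Longrightarrow> FA F (Ide A a) = Ide B (FO F a)"
  by (simp add: is_functor_def)

lemma functor_Cmp:
  "is_functor A B F \<Longrightarrow> f \<in> hom A a b \<Longrightarrow> g \<in> hom A b c \<Longrightarrow>
    FA F (Cmp A g f) = Cmp B (FA F g) (FA F f)"
  by (auto simp: is_functor_def hom_def)

lemma comp_ftor_simps [simp]:
  "FO (comp_ftor G F) a = FO G (FO F a)" "FA (comp_ftor G F) f = FA G (FA F f)"
  by (simp_all add: comp_ftor_def)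

lemma id_ftor_simps [simp]: "FO id_ftor a = a" "FA id_ftor f = f"
  by (simp_all add: id_ftor_def)

lemma is_functor_id_ftor:
  assumes "category A"
  shows "is_functor A A id_ftor"
  using category.dom_cod[OF assms] by (simp add: is_functor_def Arr_hom)

lemma is_functor_comp:
  assumes F: "is_functor A B F" and G: "is_functor B C G"
  shows "is_functor A C (comp_ftor G F)"
proof (rule is_functorI)
  fix f g a b c assume fg: "f \<in> hom A a b" "g \<in> hom A b c"
  show "FA (comp_ftor G F) (Cmp A g f) = Cmp C (FA (comp_ftor G F) g) (FA (comp_ftor G F) f)"
    using functor_Cmp[OF F fg] functor_Cmp[OF G functor_hom[OF F fg(1)] functor_hom[OF F fg(2)]]
    by simp
qed (auto intro: functor_Ob[OF F] functor_Ob[OF G] functor_hom[OF F] functor_hom[OF G]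
    simp: functor_Ide[OF F] functor_Ide[OF G functor_Ob[OF F]])

lemma functor_is_iso:
  assumes "category A" "category B" and F: "is_functor A B F" and "is_iso A f" and f: "f \<in> hom A a b"
  shows "is_iso B (FA F f)"
proof -
  interpret A: category A by fact
  interpret B: category B by fact
  obtain g where g: "g \<in> hom A b a" "Cmp A g f = Ide A a" "Cmp A f g = Ide A b"
    using A.is_isoE[OF \<open>is_iso A f\<close> f] by metis
  show ?thesis
    by (rule B.is_isoI[OF functor_hom[OF F f] functor_hom[OF F g(1)]])
      (use functor_Cmp[OF F f g(1)] functor_Cmp[OF F g(1) f] g(2,3) A.hom_Ob[OF f]
        in \<open>simp_all add: functor_Ide[OF F]\<close>)
qed

lemma is_nat_transI:
  assumes "\<And>a. a \<in> Ob A \<Longrightarrow> \<alpha> a \<in> hom B (FO F a) (FO G a)"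
    and "\<And>f a b. f \<in> hom A a b \<Longrightarrow> Cmp B (\<alpha> b) (FA F f) = Cmp B (FA G f) (\<alpha> a)"
  shows "is_nat_trans A B F G \<alpha>"
  using assms(1) assms(2)[OF Arr_hom] by (auto simp: is_nat_trans_def)

lemma nat_trans_hom: "is_nat_trans A B F G \<alpha> \<Longrightarrow> a \<in> Ob A \<Longrightarrow> \<alpha> a \<in> hom B (FO F a) (FO G a)"
  by (simp add: is_nat_trans_def)

lemma nat_trans_commute:
  "is_nat_trans A B F G \<alpha> \<Longrightarrow> f \<in> hom A a b \<Longrightarrow> Cmp B (\<alpha> b) (FA F f) = Cmp B (FA G f) (\<alpha> a)"
  by (auto simp: is_nat_trans_def hom_def)

lemma naturally_isomorphicI:
  "is_nat_trans A B F G \<alpha> \<Longrightarrow> (\<And>a. a \<in> Ob A \<Longrightarrow> is_iso B (\<alpha> a)) \<Longrightarrow> naturally_isomorphic A B F G"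
  by (auto simp: naturally_isomorphic_def)

lemma naturally_isomorphicE:
  assumes "naturally_isomorphic A B F G"
  obtains \<alpha> where "is_nat_trans A B F G \<alpha>" "\<And>a. a \<in> Ob A \<Longrightarrow> is_iso B (\<alpha> a)"
  using assms unfolding naturally_isomorphic_def by blast

lemma naturally_isomorphic_sym:
  assumes "category A" "category B" and F: "is_functor A B F" and G: "is_functor A B G"
    and "naturally_isomorphic A B F G"
  shows "naturally_isomorphic A B G F"
proof -
  interpret A: category A by fact
  interpret B: category B by fact
  obtain \<alpha> where \<alpha>: "is_nat_trans A B F G \<alpha>" and iso: "\<And>a. a \<in> Ob A \<Longrightarrow> is_iso B (\<alpha> a)"
    using assms(5) by (rule naturally_isomorphicE) blast
  have "\<exists>\<beta>. \<beta> \<in> hom B (FO G a) (FO F a) \<and> Cmp B \<beta> (\<alpha> a) = Ide B (FO F a) \<and>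
      Cmp B (\<alpha> a) \<beta> = Ide B (FO G a) \<and> is_iso B \<beta>" if "a \<in> Ob A" for a
    using B.is_isoE[OF iso[OF that] nat_trans_hom[OF \<alpha> that]] by metis
  then obtain \<beta> where \<beta>: "\<beta> a \<in> hom B (FO G a) (FO F a)" "Cmp B (\<beta> a) (\<alpha> a) = Ide B (FO F a)"
    "Cmp B (\<alpha> a) (\<beta> a) = Ide B (FO G a)" "is_iso B (\<beta> a)" if "a \<in> Ob A" for a
    by metis
  have "is_nat_trans A B G F \<beta>"
  proof (rule is_nat_transI[OF \<beta>(1)])
    fix f a b assume f: "f \<in> hom A a b"
    note a = A.hom_Ob(1)[OF f] and b = A.hom_Ob(2)[OF f]
    note \<alpha>a = nat_trans_hom[OF \<alpha> a] and \<alpha>b = nat_trans_hom[OF \<alpha> b]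
    have "Cmp B (Cmp B (\<beta> b) (FA G f)) (\<alpha> a) = Cmp B (\<beta> b) (Cmp B (\<alpha> b) (FA F f))"
      using B.assoc[OF \<alpha>a functor_hom[OF G f] \<beta>(1)[OF b]] nat_trans_commute[OF \<alpha> f] by simp
    also have "\<dots> = FA F f"
      by (rule B.cancel_inverse_left[OF functor_hom[OF F f] \<alpha>b \<beta>(1,2)[OF b]])
    also have "\<dots> = Cmp B (Cmp B (FA F f) (\<beta> a)) (\<alpha> a)"
      by (rule B.cancel_inverse_right[OF functor_hom[OF F f] \<beta>(1)[OF a] \<alpha>a \<beta>(2)[OF a], symmetric])
    finally show "Cmp B (\<beta> b) (FA G f) = Cmp B (FA F f) (\<beta> a)"
      by (rule B.iso_cancel_right[OF iso[OF a] \<alpha>a B.cmp[OF functor_hom[OF G f] \<beta>(1)[OF b]]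
            B.cmp[OF \<beta>(1)[OF a] functor_hom[OF F f]]])
  qed
  then show ?thesis by (rule naturally_isomorphicI) (rule \<beta>(4))
qed

section \<open>Equivalences of categories\<close>

definition fully_faithful ::
  "('o1, 'a1) cat \<Rightarrow> ('o2, 'a2) cat \<Rightarrow> ('o1, 'a1, 'o2, 'a2) ftor \<Rightarrow> bool" where
  "fully_faithful A B F \<longleftrightarrow>
    (\<forall>a\<in>Ob A. \<forall>a'\<in>Ob A. bij_betw (FA F) (hom A a a') (hom B (FO F a) (FO F a')))"

definition essentially_surjective ::
  "('o1, 'a1) cat \<Rightarrow> ('o2, 'a2) cat \<Rightarrow> ('o1, 'a1, 'o2, 'a2) ftor \<Rightarrow> bool" where
  "essentially_surjective A B F \<longleftrightarrow> (\<forall>b\<in>Ob B. \<exists>a\<in>Ob A. \<exists>e\<in>hom B (FO F a) b. is_iso B e)"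

definition is_equivalence ::
  "('o1, 'a1) cat \<Rightarrow> ('o2, 'a2) cat \<Rightarrow> ('o1, 'a1, 'o2, 'a2) ftor \<Rightarrow> bool" where
  "is_equivalence A B F \<longleftrightarrow>
    is_functor A B F \<and> fully_faithful A B F \<and> essentially_surjective A B F"

lemma fully_faithfulI:
  assumes F: "is_functor A B F"
    and faithful: "\<And>f f' a a'. f \<in> hom A a a' \<Longrightarrow> f' \<in> hom A a a' \<Longrightarrow> FA F f = FA F f' \<Longrightarrow> f = f'"
    and full: "\<And>g a a'. a \<in> Ob A \<Longrightarrow> a' \<in> Ob A \<Longrightarrow> g \<in> hom B (FO F a) (FO F a') \<Longrightarrow>
      \<exists>f\<in>hom A a a'. FA F f = g"
  shows "fully_faithful A B F"
proof -
  have "bij_betw (FA F) (hom A a a') (hom B (FO F a) (FO F a'))" if "a \<in> Ob A" "a' \<in> Ob A" for a a'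
  proof (rule bij_betw_imageI)
    show "inj_on (FA F) (hom A a a')" using faithful by (meson inj_onI)
    show "FA F ` hom A a a' = hom B (FO F a) (FO F a')"
      using full[OF that] functor_hom[OF F] by blast
  qed
  then show ?thesis by (simp add: fully_faithful_def)
qed

lemma (in category) fully_faithful_inj:
  assumes "fully_faithful C B F" "f \<in> hom C a a'" "f' \<in> hom C a a'" "FA F f = FA F f'"
  shows "f = f'"
  using assms hom_Ob[OF assms(2)] unfolding fully_faithful_def by (metis bij_betw_imp_inj_on inj_onD)

lemma fully_faithful_full:
  assumes "fully_faithful A B F" "a \<in> Ob A" "a' \<in> Ob A" "g \<in> hom B (FO F a) (FO F a')"
  shows "\<exists>f\<in>hom A a a'. FA F f = g"
proof -
  have "g \<in> FA F ` hom A a a'" using assms by (simp add: fully_faithful_def bij_betw_def)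
  then show ?thesis by blast
qed

lemma essentially_surjectiveD:
  assumes "essentially_surjective A B F" "b \<in> Ob B"
  shows "\<exists>a e. a \<in> Ob A \<and> e \<in> hom B (FO F a) b \<and> is_iso B e"
  using assms unfolding essentially_surjective_def by blast

lemma is_equivalence_comp:
  assumes "category A" "category B" "category C"
    and F: "is_equivalence A B F" and G: "is_equivalence B C G"
  shows "is_equivalence A C (comp_ftor G F)"
proof -
  interpret B: category B by fact
  interpret C: category C by fact
  have functors: "is_functor A B F" "is_functor B C G"
    and ff: "fully_faithful A B F" "fully_faithful B C G"
    and es: "essentially_surjective A B F" "essentially_surjective B C G"
    using F G by (auto simp: is_equivalence_def)
  have "fully_faithful A C (comp_ftor G F)"
    using ff functor_Ob[OF functors(1)] bij_betw_trans[of "FA F" _ _ "FA G"]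
    by (simp add: fully_faithful_def comp_ftor_def) blast
  moreover have "essentially_surjective A C (comp_ftor G F)"
    unfolding essentially_surjective_def
  proof
    fix c assume c: "c \<in> Ob C"
    obtain b e where b: "b \<in> Ob B" and e: "e \<in> hom C (FO G b) c" "is_iso C e"
      using essentially_surjectiveD[OF es(2) c] by blast
    obtain a d where a: "a \<in> Ob A" and d: "d \<in> hom B (FO F a) b" "is_iso B d"
      using essentially_surjectiveD[OF es(1) b] by blast
    have Gd: "FA G d \<in> hom C (FO G (FO F a)) (FO G b)" "is_iso C (FA G d)"
      using functor_hom[OF functors(2) d(1)] functor_is_iso[OF assms(2,3) functors(2) d(2,1)] .
    show "\<exists>a\<in>Ob A. \<exists>e\<in>hom C (FO (comp_ftor G F) a) c. is_iso C e"
      using a C.cmp[OF Gd(1) e(1)] C.is_iso_Cmp[OF Gd(2) e(2) Gd(1) e(1)] by auto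
  qed
  ultimately show ?thesis using is_functor_comp[OF functors] by (simp add: is_equivalence_def)
qed

subsection \<open>The quasi-inverse of a fully faithful and essentially surjective functor\<close>

locale equivalence = A: category A + B: category B
  for A :: "('o1, 'a1) cat" and B :: "('o2, 'a2) cat" +
  fixes F :: "('o1, 'a1, 'o2, 'a2) ftor"
  assumes is_equivalence: "is_equivalence A B F"
begin

lemma is_functor: "is_functor A B F" and fully_faithful: "fully_faithful A B F"
  and essentially_surjective: "essentially_surjective A B F"
  using is_equivalence by (simp_all add: is_equivalence_def)

definition inverse_Ob :: "'o2 \<Rightarrow> 'o1" where
  "inverse_Ob b = (SOME a. a \<in> Ob A \<and> (\<exists>e\<in>hom B (FO F a) b. is_iso B e))"

definition counit :: "'o2 \<Rightarrow> 'a2" where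
  "counit b = (SOME e. e \<in> hom B (FO F (inverse_Ob b)) b \<and> is_iso B e)"

definition inverse_Arr :: "'a2 \<Rightarrow> 'a1" where
  "inverse_Arr g = (THE f. f \<in> hom A (inverse_Ob (Dom B g)) (inverse_Ob (Cod B g)) \<and>
    Cmp B (counit (Cod B g)) (FA F f) = Cmp B g (counit (Dom B g)))"

definition quasi_inverse :: "('o2, 'a2, 'o1, 'a1) ftor" where
  "quasi_inverse = \<lparr>FO = inverse_Ob, FA = inverse_Arr\<rparr>"

lemma inverse_Ob_in: "b \<in> Ob B \<Longrightarrow> inverse_Ob b \<in> Ob A"
  and counit_hom: "b \<in> Ob B \<Longrightarrow> counit b \<in> hom B (FO F (inverse_Ob b)) b"
  and counit_iso: "b \<in> Ob B \<Longrightarrow> is_iso B (counit b)"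
proof -
  assume "b \<in> Ob B"
  then have "\<exists>a. a \<in> Ob A \<and> (\<exists>e\<in>hom B (FO F a) b. is_iso B e)"
    using essentially_surjective unfolding essentially_surjective_def by blast
  then have "inverse_Ob b \<in> Ob A \<and> (\<exists>e\<in>hom B (FO F (inverse_Ob b)) b. is_iso B e)"
    unfolding inverse_Ob_def by (rule someI_ex)
  moreover from this have "\<exists>e. e \<in> hom B (FO F (inverse_Ob b)) b \<and> is_iso B e" by blast
  then have "counit b \<in> hom B (FO F (inverse_Ob b)) b \<and> is_iso B (counit b)"
    unfolding counit_def by (rule someI_ex)
  ultimately show "inverse_Ob b \<in> Ob A" "counit b \<in> hom B (FO F (inverse_Ob b)) b"
    "is_iso B (counit b)"
    by auto
qed

lemma counit_cancel:
  assumes "f \<in> hom A a (inverse_Ob b)" "f' \<in> hom A a (inverse_Ob b)" "b \<in> Ob B"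
    and "Cmp B (counit b) (FA F f) = Cmp B (counit b) (FA F f')"
  shows "f = f'"
proof (rule A.fully_faithful_inj[OF fully_faithful assms(1,2)])
  show "FA F f = FA F f'"
    by (rule B.iso_cancel_left[OF counit_iso counit_hom functor_hom[OF is_functor]
          functor_hom[OF is_functor]]) (rule assms)+
qed

lemma counit_lift:
  assumes g: "g \<in> hom B (FO F a) b" and a: "a \<in> Ob A"
  obtains f where "f \<in> hom A a (inverse_Ob b)" "Cmp B (counit b) (FA F f) = g"
proof -
  note b = B.hom_Ob(2)[OF g]
  obtain e' where e': "e' \<in> hom B b (FO F (inverse_Ob b))" "Cmp B (counit b) e' = Ide B b"
    using B.is_isoE[OF counit_iso[OF b] counit_hom[OF b]] by metis
  obtain f where "f \<in> hom A a (inverse_Ob b)" "FA F f = Cmp B e' g"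
    using fully_faithful_full[OF fully_faithful a inverse_Ob_in[OF b] B.cmp[OF g e'(1)]] by blast
  then show ?thesis using that B.cancel_inverse_left[OF g e'(1) counit_hom[OF b] e'(2)] by simp
qed

lemma inverse_Arr_ex1:
  assumes g: "g \<in> hom B b b'"
  shows "\<exists>!f. f \<in> hom A (inverse_Ob b) (inverse_Ob b') \<and>
    Cmp B (counit b') (FA F f) = Cmp B g (counit b)"
proof -
  note b = B.hom_Ob(1)[OF g] and b' = B.hom_Ob(2)[OF g]
  obtain f where "f \<in> hom A (inverse_Ob b) (inverse_Ob b')"
    "Cmp B (counit b') (FA F f) = Cmp B g (counit b)"
    using counit_lift[OF B.cmp[OF counit_hom[OF b] g] inverse_Ob_in[OF b]] .
  then show ?thesis using counit_cancel[OF _ _ b'] by (intro ex1I[of _ f]) auto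
qed

lemma
  assumes g: "g \<in> hom B b b'"
  shows inverse_Arr_hom: "inverse_Arr g \<in> hom A (inverse_Ob b) (inverse_Ob b')"
    and counit_natural: "Cmp B (counit b') (FA F (inverse_Arr g)) = Cmp B g (counit b)"
  using theI'[OF inverse_Arr_ex1[OF g]] by (auto simp: inverse_Arr_def homD[OF g])

lemma inverse_Arr_eqI:
  assumes "g \<in> hom B b b'" "f \<in> hom A (inverse_Ob b) (inverse_Ob b')"
    and "Cmp B (counit b') (FA F f) = Cmp B g (counit b)"
  shows "inverse_Arr g = f"
  using inverse_Arr_ex1[OF assms(1)] inverse_Arr_hom[OF assms(1)] counit_natural[OF assms(1)] assms(2,3)
  by blast

lemma is_functor_quasi_inverse: "is_functor B A quasi_inverse"
proof (rule is_functorI; simp add: quasi_inverse_def)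
  fix b assume b: "b \<in> Ob B"
  show "inverse_Arr (Ide B b) = Ide A (inverse_Ob b)"
    using B.ide[OF b] A.ide[OF inverse_Ob_in[OF b]]
    by (rule inverse_Arr_eqI) (simp add: functor_Ide[OF is_functor inverse_Ob_in[OF b]]
        B.ide_left[OF counit_hom[OF b]] B.ide_right[OF counit_hom[OF b]])
next
  fix g h b c d assume g: "g \<in> hom B b c" and h: "h \<in> hom B c d"
  note b = B.hom_Ob(1)[OF g] and c = B.hom_Ob(1)[OF h] and d = B.hom_Ob(2)[OF h]
  let ?Fg = "FA F (inverse_Arr g)" and ?Fh = "FA F (inverse_Arr h)"
  note Fg = functor_hom[OF is_functor inverse_Arr_hom[OF g]]
    and Fh = functor_hom[OF is_functor inverse_Arr_hom[OF h]]
  show "inverse_Arr (Cmp B h g) = Cmp A (inverse_Arr h) (inverse_Arr g)"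
  proof (rule inverse_Arr_eqI[OF B.cmp[OF g h] A.cmp[OF inverse_Arr_hom[OF g] inverse_Arr_hom[OF h]]])
    have "Cmp B (counit d) (Cmp B ?Fh ?Fg) = Cmp B (Cmp B h (counit c)) ?Fg"
      using B.assoc[OF Fg Fh counit_hom[OF d]] counit_natural[OF h] by simp
    also have "\<dots> = Cmp B h (Cmp B g (counit b))"
      using B.assoc[OF Fg counit_hom[OF c] h] counit_natural[OF g] by simp
    also have "\<dots> = Cmp B (Cmp B h g) (counit b)" by (rule B.assoc[OF counit_hom[OF b] g h])
    finally show "Cmp B (counit d) (FA F (Cmp A (inverse_Arr h) (inverse_Arr g))) =
        Cmp B (Cmp B h g) (counit b)"
      by (simp add: functor_Cmp[OF is_functor inverse_Arr_hom[OF g] inverse_Arr_hom[OF h]])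
  qed
qed (auto intro: inverse_Ob_in inverse_Arr_hom)

lemma counit_iso_natural: "naturally_isomorphic B B (comp_ftor F quasi_inverse) id_ftor"
proof (rule naturally_isomorphicI)
  show "is_nat_trans B B (comp_ftor F quasi_inverse) id_ftor counit"
    by (rule is_nat_transI) (simp_all add: quasi_inverse_def counit_hom counit_natural)
qed (rule counit_iso)

lemma reflects_iso:
  assumes f: "f \<in> hom A a a'" and iso: "is_iso B (FA F f)"
  shows "is_iso A f"
proof -
  note a = A.hom_Ob(1)[OF f] and a' = A.hom_Ob(2)[OF f] and Ff = functor_hom[OF is_functor f]
  obtain g' where g': "g' \<in> hom B (FO F a') (FO F a)" "Cmp B g' (FA F f) = Ide B (FO F a)"
    "Cmp B (FA F f) g' = Ide B (FO F a')"
    using B.is_isoE[OF iso Ff] by metis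
  obtain g where g: "g \<in> hom A a' a" "FA F g = g'"
    using fully_faithful_full[OF fully_faithful a' a g'(1)] by blast
  show ?thesis
  proof (rule A.is_isoI[OF f g(1)])
    show "Cmp A g f = Ide A a"
      by (rule A.fully_faithful_inj[OF fully_faithful A.cmp[OF f g(1)] A.ide[OF a]])
        (simp add: functor_Cmp[OF is_functor f g(1)] functor_Ide[OF is_functor a] g g')
    show "Cmp A f g = Ide A a'"
      by (rule A.fully_faithful_inj[OF fully_faithful A.cmp[OF g(1) f] A.ide[OF a']])
        (simp add: functor_Cmp[OF is_functor g(1) f] functor_Ide[OF is_functor a'] g g')
  qed
qed

lemma unit_iso_natural: "naturally_isomorphic A A (comp_ftor quasi_inverse F) id_ftor"
proof -
  note FO = functor_Ob[OF is_functor] and FA = functor_hom[OF is_functor]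
  have "\<exists>h. h \<in> hom A (inverse_Ob (FO F a)) a \<and> FA F h = counit (FO F a)" if a: "a \<in> Ob A" for a
    using fully_faithful_full[OF fully_faithful inverse_Ob_in[OF FO[OF a]] a counit_hom[OF FO[OF a]]]
    by metis
  then obtain h where h: "h a \<in> hom A (inverse_Ob (FO F a)) a" "FA F (h a) = counit (FO F a)"
    if "a \<in> Ob A" for a
    by metis
  have "is_nat_trans A A (comp_ftor quasi_inverse F) id_ftor h"
  proof (rule is_nat_transI)
    fix f a b assume f: "f \<in> hom A a b"
    note ha = h[OF A.hom_Ob(1)[OF f]] and hb = h[OF A.hom_Ob(2)[OF f]]
    note GFf = inverse_Arr_hom[OF FA[OF f]]
    have "Cmp A (h b) (inverse_Arr (FA F f)) = Cmp A f (h a)"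
      by (rule A.fully_faithful_inj[OF fully_faithful A.cmp[OF GFf hb(1)] A.cmp[OF ha(1) f]])
        (simp add: functor_Cmp[OF is_functor GFf hb(1)] functor_Cmp[OF is_functor ha(1) f] ha(2) hb(2)
          counit_natural[OF FA[OF f]])
    then show "Cmp A (h b) (FA (comp_ftor quasi_inverse F) f) = Cmp A (FA id_ftor f) (h a)"
      by (simp add: quasi_inverse_def)
  qed (simp add: quasi_inverse_def h(1))
  then show ?thesis
    by (rule naturally_isomorphicI) (metis reflects_iso h counit_iso FO)
qed

end

lemma is_equivalence_imp_equivalent:
  assumes "category A" "category B" "is_equivalence A B F"
  shows "equivalent_categories A B"
proof -
  interpret equivalence A B F by (intro equivalence.intro equivalence_axioms.intro) fact+
  show ?thesis
    unfolding equivalent_categories_def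
    using A.category_axioms B.category_axioms is_functor is_functor_quasi_inverse unit_iso_natural
      counit_iso_natural by blast
qed

lemma faithful_if_left_inverse:
  assumes "category A" and F: "is_functor A B F" and G: "is_functor B A G"
    and iso: "naturally_isomorphic A A (comp_ftor G F) id_ftor"
    and f: "f \<in> hom A a a'" and f': "f' \<in> hom A a a'" and eq: "FA F f = FA F f'"
  shows "f = f'"
proof -
  interpret A: category A by fact
  obtain \<alpha> where \<alpha>: "is_nat_trans A A (comp_ftor G F) id_ftor \<alpha>" "\<And>a. a \<in> Ob A \<Longrightarrow> is_iso A (\<alpha> a)"
    using iso by (rule naturally_isomorphicE) blast
  note a = A.hom_Ob(1)[OF f]
  show ?thesis
  proof (rule A.iso_cancel_right[OF \<alpha>(2)[OF a] _ f f'])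
    show "\<alpha> a \<in> hom A (FO G (FO F a)) a" using nat_trans_hom[OF \<alpha>(1) a] by simp
    show "Cmp A f (\<alpha> a) = Cmp A f' (\<alpha> a)"
      using nat_trans_commute[OF \<alpha>(1) f] nat_trans_commute[OF \<alpha>(1) f'] eq by simp
  qed
qed

lemma equivalent_imp_is_equivalence:
  assumes "equivalent_categories A B"
  obtains F where "is_equivalence A B F"
proof -
  obtain F G where cat: "category A" "category B" and F: "is_functor A B F" and G: "is_functor B A G"
    and unit: "naturally_isomorphic A A (comp_ftor G F) id_ftor"
    and counit: "naturally_isomorphic B B (comp_ftor F G) id_ftor"
    using assms by (auto simp: equivalent_categories_def)
  interpret A: category A by fact
  obtain \<alpha> where \<alpha>: "is_nat_trans A A (comp_ftor G F) id_ftor \<alpha>" "\<And>a. a \<in> Ob A \<Longrightarrow> is_iso A (\<alpha> a)"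
    using unit by (rule naturally_isomorphicE) blast
  have \<alpha>_hom: "\<alpha> a \<in> hom A (FO G (FO F a)) a" if "a \<in> Ob A" for a
    using nat_trans_hom[OF \<alpha>(1) that] by simp
  obtain \<beta> where \<beta>: "is_nat_trans B B (comp_ftor F G) id_ftor \<beta>" "\<And>b. b \<in> Ob B \<Longrightarrow> is_iso B (\<beta> b)"
    using counit by (rule naturally_isomorphicE) blast
  have "fully_faithful A B F"
  proof (rule fully_faithfulI[OF F faithful_if_left_inverse[OF cat(1) F G unit]])
    fix g a a' assume a: "a \<in> Ob A" and a': "a' \<in> Ob A" and g: "g \<in> hom B (FO F a) (FO F a')"
    note Gg = functor_hom[OF G g] and \<alpha>a = \<alpha>_hom[OF a] and \<alpha>a' = \<alpha>_hom[OF a']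
    obtain \<alpha>' where \<alpha>': "\<alpha>' \<in> hom A a (FO G (FO F a))" "Cmp A \<alpha>' (\<alpha> a) = Ide A (FO G (FO F a))"
      using A.is_isoE[OF \<alpha>(2)[OF a] \<alpha>a] by metis
    let ?f = "Cmp A (Cmp A (\<alpha> a') (FA G g)) \<alpha>'"
    note \<alpha>g = A.cmp[OF Gg \<alpha>a']
    have f: "?f \<in> hom A a a'" by (rule A.cmp[OF \<alpha>'(1) \<alpha>g])
    have "Cmp A (\<alpha> a') (FA G (FA F ?f)) = Cmp A ?f (\<alpha> a)"
      using nat_trans_commute[OF \<alpha>(1) f] by simp
    also have "\<dots> = Cmp A (\<alpha> a') (FA G g)" by (rule A.cancel_inverse_right[OF \<alpha>g \<alpha>' (1) \<alpha>a \<alpha>'(2)])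
    finally have "FA G (FA F ?f) = FA G g"
      by (rule A.iso_cancel_left[OF \<alpha>(2)[OF a'] \<alpha>a' functor_hom[OF G functor_hom[OF F f]] Gg])
    then have "FA F ?f = g"
      by (rule faithful_if_left_inverse[OF cat(2) G F counit functor_hom[OF F f] g])
    then show "\<exists>f\<in>hom A a a'. FA F f = g" using f by blast
  qed
  moreover have "essentially_surjective A B F"
    unfolding essentially_surjective_def
    using functor_Ob[OF G] nat_trans_hom[OF \<beta>(1)] \<beta>(2) by fastforce
  ultimately show ?thesis using that F by (simp add: is_equivalence_def)
qed

lemma equivalent_categories_sym: "equivalent_categories A B \<Longrightarrow> equivalent_categories B A"
  by (auto simp: equivalent_categories_def)

lemma equivalent_categories_trans [trans]:
  assumes AB: "equivalent_categories A B" and BC: "equivalent_categories B C"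
  shows "equivalent_categories A C"
proof -
  have cat: "category A" "category B" "category C"
    using AB BC by (auto simp: equivalent_categories_def)
  obtain F where F: "is_equivalence A B F" using AB by (rule equivalent_imp_is_equivalence)
  obtain G where G: "is_equivalence B C G" using BC by (rule equivalent_imp_is_equivalence)
  show ?thesis
    by (rule is_equivalence_imp_equivalent[OF cat(1,3) is_equivalence_comp[OF cat F G]])
qed

section \<open>Categories of functors, products and families\<close>

lemma op_cat_simps [simp]:
  "Ob (op_cat C) = Ob C" "Arr (op_cat C) = Arr C" "Dom (op_cat C) = Cod C" "Cod (op_cat C) = Dom C"
  "Ide (op_cat C) = Ide C" "Cmp (op_cat C) g f = Cmp C f g" "hom (op_cat C) a b = hom C b a"
  by (auto simp: op_cat_def hom_def)

lemma category_op:
  assumes "category C"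
  shows "category (op_cat C)"
proof -
  interpret category C by fact
  show ?thesis
    by (unfold_locales; simp) (use dom_cod ide cmp ide_left ide_right assoc[symmetric] in blast)+
qed

lemma category_full_subcat:
  assumes "category C"
  shows "category (full_subcat C P)"
proof -
  interpret category C by fact
  have hom: "hom (full_subcat C P) a b = (if P a \<and> P b then hom C a b else {})" for a b
    by (auto simp: hom_def full_subcat_def)
  have simps: "Ide (full_subcat C P) = Ide C" "Cmp (full_subcat C P) = Cmp C"
    "Ob (full_subcat C P) = {a \<in> Ob C. P a}"
    by (simp_all add: full_subcat_def)
  show ?thesis
  proof
    fix f assume "f \<in> Arr (full_subcat C P)"
    then show "Dom (full_subcat C P) f \<in> Ob (full_subcat C P) \<and>
        Cod (full_subcat C P) f \<in> Ob (full_subcat C P)"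
      using dom_cod by (auto simp: full_subcat_def)
  qed (use ide cmp ide_left ide_right assoc in \<open>auto simp: hom simps split: if_splits\<close>)
qed

lemma Sets_hom_iff: "f \<in> hom Sets A B \<longleftrightarrow> src f = A \<and> tgt f = B \<and> val f \<in> A \<rightarrow>\<^sub>E B"
  by (cases f) (auto simp: Sets_def hom_def)

lemma Sets_simps:
  "Ob Sets = UNIV" "Dom Sets = src" "Cod Sets = tgt" "Ide Sets A = Arrow A (\<lambda>x\<in>A. x) A"
  "Cmp Sets g f = Arrow (src f) (compose (src f) (val g) (val f)) (tgt g)"
  by (simp_all add: Sets_def)

lemma category_Sets: "category Sets"
proof
  show "Dom Sets f \<in> Ob Sets \<and> Cod Sets f \<in> Ob Sets" for f :: "'a sarr"
    by (simp add: Sets_simps)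
next
  show "Ide Sets A \<in> hom Sets A A" for A :: "'a set"
    by (simp add: Sets_simps Sets_hom_iff)
next
  fix f g :: "'a sarr" and A B C assume "f \<in> hom Sets A B" "g \<in> hom Sets B C"
  then show "Cmp Sets g f \<in> hom Sets A C"
    by (auto simp: Sets_simps Sets_hom_iff compose_def)
next
  fix f :: "'a sarr" and A B assume "f \<in> hom Sets A B"
  then show "Cmp Sets f (Ide Sets A) = f" "Cmp Sets (Ide Sets B) f = f"
    by (cases f; auto simp: Sets_simps Sets_hom_iff compose_Id Id_compose PiE_iff Pi_iff)+
next
  fix f g h :: "'a sarr" and A B C D
  assume "f \<in> hom Sets A B" "g \<in> hom Sets B C" "h \<in> hom Sets C D"
  then show "Cmp Sets h (Cmp Sets g f) = Cmp Sets (Cmp Sets h g) f"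
    by (auto simp: Sets_simps Sets_hom_iff intro!: compose_assoc)
qed

subsection \<open>Functor categories\<close>

lemma functor_cat_Ob_iff:
  "F \<in> Ob (functor_cat A B) \<longleftrightarrow>
    is_functor A B F \<and> FO F \<in> extensional (Ob A) \<and> FA F \<in> extensional (Arr A)"
  by (simp add: functor_cat_def)

lemma functor_cat_hom_iff:
  "\<alpha> \<in> hom (functor_cat A B) F G \<longleftrightarrow> F \<in> Ob (functor_cat A B) \<and> G \<in> Ob (functor_cat A B) \<and>
    src \<alpha> = F \<and> tgt \<alpha> = G \<and> is_nat_trans A B F G (val \<alpha>) \<and> val \<alpha> \<in> extensional (Ob A)"
  by (cases \<alpha>) (auto simp: functor_cat_def hom_def)

lemma functor_cat_simps:
  "Dom (functor_cat A B) = src" "Cod (functor_cat A B) = tgt"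
  "Ide (functor_cat A B) F = Arrow F (\<lambda>a\<in>Ob A. Ide B (FO F a)) F"
  "Cmp (functor_cat A B) \<beta> \<alpha> =
    Arrow (src \<alpha>) (\<lambda>a\<in>Ob A. Cmp B (val \<beta> a) (val \<alpha> a)) (tgt \<beta>)"
  by (simp_all add: functor_cat_def)

lemma functor_cat_component:
  "\<alpha> \<in> hom (functor_cat A B) F G \<Longrightarrow> a \<in> Ob A \<Longrightarrow> val \<alpha> a \<in> hom B (FO F a) (FO G a)"
  by (auto simp: functor_cat_hom_iff intro: nat_trans_hom)

lemma nat_trans_Ide:
  assumes "category A" "category B" and F: "is_functor A B F"
  shows "is_nat_trans A B F F (\<lambda>a\<in>Ob A. Ide B (FO F a))"
proof -
  interpret A: category A by fact
  interpret B: category B by fact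
  show ?thesis
  proof (rule is_nat_transI)
    show "(\<lambda>a\<in>Ob A. Ide B (FO F a)) a \<in> hom B (FO F a) (FO F a)" if "a \<in> Ob A" for a
      using that B.ide[OF functor_Ob[OF F that]] by simp
    fix f a b assume f: "f \<in> hom A a b"
    note Ff = functor_hom[OF F f]
    show "Cmp B ((\<lambda>a\<in>Ob A. Ide B (FO F a)) b) (FA F f) =
        Cmp B (FA F f) ((\<lambda>a\<in>Ob A. Ide B (FO F a)) a)"
      using A.hom_Ob[OF f] by (simp add: B.ide_left[OF Ff] B.ide_right[OF Ff])
  qed
qed

lemma nat_trans_Cmp:
  assumes "category A" "category B"
    and F: "is_functor A B F" and G: "is_functor A B G" and H: "is_functor A B H"
    and \<alpha>: "is_nat_trans A B F G \<alpha>" and \<beta>: "is_nat_trans A B G H \<beta>"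
  shows "is_nat_trans A B F H (\<lambda>a\<in>Ob A. Cmp B (\<beta> a) (\<alpha> a))"
proof -
  interpret A: category A by fact
  interpret B: category B by fact
  show ?thesis
  proof (rule is_nat_transI)
    show "(\<lambda>a\<in>Ob A. Cmp B (\<beta> a) (\<alpha> a)) a \<in> hom B (FO F a) (FO H a)" if a: "a \<in> Ob A" for a
      using a B.cmp[OF nat_trans_hom[OF \<alpha> a] nat_trans_hom[OF \<beta> a]] by simp
    fix f a b assume f: "f \<in> hom A a b"
    note a = A.hom_Ob(1)[OF f] and b = A.hom_Ob(2)[OF f]
    note \<alpha>a = nat_trans_hom[OF \<alpha> a] and \<alpha>b = nat_trans_hom[OF \<alpha> b]
      and \<beta>a = nat_trans_hom[OF \<beta> a] and \<beta>b = nat_trans_hom[OF \<beta> b]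
    have "Cmp B (Cmp B (\<beta> b) (\<alpha> b)) (FA F f) = Cmp B (\<beta> b) (Cmp B (FA G f) (\<alpha> a))"
      using B.assoc[OF functor_hom[OF F f] \<alpha>b \<beta>b] nat_trans_commute[OF \<alpha> f] by simp
    also have "\<dots> = Cmp B (Cmp B (FA H f) (\<beta> a)) (\<alpha> a)"
      using B.assoc[OF \<alpha>a functor_hom[OF G f] \<beta>b] nat_trans_commute[OF \<beta> f] by simp
    also have "\<dots> = Cmp B (FA H f) (Cmp B (\<beta> a) (\<alpha> a))"
      using B.assoc[OF \<alpha>a \<beta>a functor_hom[OF H f]] by simp
    finally show "Cmp B ((\<lambda>a\<in>Ob A. Cmp B (\<beta> a) (\<alpha> a)) b) (FA F f) =
        Cmp B (FA H f) ((\<lambda>a\<in>Ob A. Cmp B (\<beta> a) (\<alpha> a)) a)"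
      using a b by simp
  qed
qed

lemma category_functor_cat:
  assumes "category A" "category B"
  shows "category (functor_cat A B)"
proof -
  interpret B: category B by fact
  let ?C = "functor_cat A B"
  show ?thesis
  proof
    show "Dom ?C f \<in> Ob ?C \<and> Cod ?C f \<in> Ob ?C" if "f \<in> Arr ?C" for f
      using that by (auto simp: functor_cat_def)
    show "Ide ?C F \<in> hom ?C F F" if "F \<in> Ob ?C" for F
      using that nat_trans_Ide[OF assms]
      by (auto simp: functor_cat_hom_iff functor_cat_simps functor_cat_Ob_iff)
    show "Cmp ?C \<beta> \<alpha> \<in> hom ?C F H" if "\<alpha> \<in> hom ?C F G" "\<beta> \<in> hom ?C G H" for \<alpha> \<beta> F G H
      using that nat_trans_Cmp[OF assms, of F G H]
      by (auto simp: functor_cat_hom_iff functor_cat_simps functor_cat_Ob_iff)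
  next
    fix \<alpha> F G assume \<alpha>: "\<alpha> \<in> hom ?C F G"
    show "Cmp ?C \<alpha> (Ide ?C F) = \<alpha>"
      using \<alpha> B.ide_right[OF functor_cat_component[OF \<alpha>]]
      by (cases \<alpha>) (auto simp: functor_cat_hom_iff functor_cat_simps fun_eq_iff restrict_def
          extensional_def)
    show "Cmp ?C (Ide ?C G) \<alpha> = \<alpha>"
      using \<alpha> B.ide_left[OF functor_cat_component[OF \<alpha>]]
      by (cases \<alpha>) (auto simp: functor_cat_hom_iff functor_cat_simps fun_eq_iff restrict_def
          extensional_def)
  next
    fix \<alpha> \<beta> \<gamma> F G H K assume \<alpha>: "\<alpha> \<in> hom ?C F G" and \<beta>: "\<beta> \<in> hom ?C G H" and \<gamma>: "\<gamma> \<in> hom ?C H K"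
    show "Cmp ?C \<gamma> (Cmp ?C \<beta> \<alpha>) = Cmp ?C (Cmp ?C \<gamma> \<beta>) \<alpha>"
      using B.assoc[OF functor_cat_component[OF \<alpha>] functor_cat_component[OF \<beta>]
          functor_cat_component[OF \<gamma>]]
      by (simp add: functor_cat_simps fun_eq_iff restrict_def)
  qed
qed

subsection \<open>Products\<close>

lemma product_cat_simps:
  "Ob (product_cat I C) = (\<Pi>\<^sub>E i\<in>I. Ob (C i))" "Ide (product_cat I C) a = (\<lambda>i\<in>I. Ide (C i) (a i))"
  "Cmp (product_cat I C) g f = (\<lambda>i\<in>I. Cmp (C i) (g i) (f i))"
  by (simp_all add: product_cat_def)

lemma product_cat_hom_iff:
  "f \<in> hom (product_cat I C) a b \<longleftrightarrow>
    f \<in> extensional I \<and> a \<in> extensional I \<and> b \<in> extensional I \<and> (\<forall>i\<in>I. f i \<in> hom (C i) (a i) (b i))"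
proof
  assume components: "f \<in> extensional I \<and> a \<in> extensional I \<and> b \<in> extensional I \<and>
      (\<forall>i\<in>I. f i \<in> hom (C i) (a i) (b i))"
  then have "(\<lambda>i\<in>I. Dom (C i) (f i)) = a" "(\<lambda>i\<in>I. Cod (C i) (f i)) = b"
    by (auto simp: fun_eq_iff restrict_def hom_def extensional_def)
  with components show "f \<in> hom (product_cat I C) a b"
    by (auto simp: hom_def product_cat_def PiE_def)
qed (auto simp: hom_def product_cat_def PiE_def)

lemma category_product_cat:
  assumes "\<And>i. i \<in> I \<Longrightarrow> category (C i)"
  shows "category (product_cat I C)"
proof
  fix f assume "f \<in> Arr (product_cat I C)"
  then show "Dom (product_cat I C) f \<in> Ob (product_cat I C) \<and>
      Cod (product_cat I C) f \<in> Ob (product_cat I C)"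
    using category.dom_cod[OF assms] by (auto simp: product_cat_def)
next
  fix a assume "a \<in> Ob (product_cat I C)"
  then show "Ide (product_cat I C) a \<in> hom (product_cat I C) a a"
    unfolding product_cat_hom_iff using category.ide[OF assms]
    by (auto simp: product_cat_simps PiE_iff)
next
  fix f a b g c assume "f \<in> hom (product_cat I C) a b" "g \<in> hom (product_cat I C) b c"
  then show "Cmp (product_cat I C) g f \<in> hom (product_cat I C) a c"
    unfolding product_cat_hom_iff using category.cmp[OF assms] by (auto simp: product_cat_simps)
next
  fix f a b assume "f \<in> hom (product_cat I C) a b"
  then show "Cmp (product_cat I C) f (Ide (product_cat I C) a) = f"
    "Cmp (product_cat I C) (Ide (product_cat I C) b) f = f"
    unfolding product_cat_hom_iff using category.ide_right[OF assms] category.ide_left[OF assms]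
    by (auto simp: product_cat_simps fun_eq_iff restrict_def extensional_def)
next
  fix f a b g c h d
  assume "f \<in> hom (product_cat I C) a b" "g \<in> hom (product_cat I C) b c"
    "h \<in> hom (product_cat I C) c d"
  then show "Cmp (product_cat I C) h (Cmp (product_cat I C) g f) =
      Cmp (product_cat I C) (Cmp (product_cat I C) h g) f"
    unfolding product_cat_hom_iff using category.assoc[OF assms]
    by (fastforce simp: product_cat_simps fun_eq_iff restrict_def)
qed

lemma product_cat_is_iso:
  assumes cat: "\<And>i. i \<in> I \<Longrightarrow> category (C i)" and f: "f \<in> hom (product_cat I C) a b"
    and iso: "\<And>i. i \<in> I \<Longrightarrow> is_iso (C i) (f i)"
  shows "is_iso (product_cat I C) f"
proof -
  have "\<exists>g. g \<in> hom (C i) (b i) (a i) \<and> Cmp (C i) g (f i) = Ide (C i) (a i) \<and>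
      Cmp (C i) (f i) g = Ide (C i) (b i)" if i: "i \<in> I" for i
    using category.is_isoE[OF cat[OF i] iso[OF i], of "a i" "b i"] f i
    unfolding product_cat_hom_iff by metis
  then obtain g where g: "\<And>i. i \<in> I \<Longrightarrow> g i \<in> hom (C i) (b i) (a i) \<and>
      Cmp (C i) (g i) (f i) = Ide (C i) (a i) \<and> Cmp (C i) (f i) (g i) = Ide (C i) (b i)"
    by metis
  have inverse: "restrict g I \<in> hom (product_cat I C) b a"
    using f g by (auto simp: product_cat_hom_iff)
  show ?thesis
    by (rule category.is_isoI[OF category_product_cat[OF cat] f inverse])
      (use g in \<open>auto simp: product_cat_simps fun_eq_iff\<close>)
qed

definition product_functor ::
  "'i set \<Rightarrow> ('i \<Rightarrow> ('o1, 'a1, 'o2, 'a2) ftor) \<Rightarrow> ('i \<Rightarrow> 'o1, 'i \<Rightarrow> 'a1, 'i \<Rightarrow> 'o2, 'i \<Rightarrow> 'a2) ftor" where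
  "product_functor I F = \<lparr>FO = (\<lambda>a. \<lambda>i\<in>I. FO (F i) (a i)), FA = (\<lambda>f. \<lambda>i\<in>I. FA (F i) (f i))\<rparr>"

lemma is_functor_product_functor:
  assumes "\<And>i. i \<in> I \<Longrightarrow> is_functor (C i) (D i) (F i)"
  shows "is_functor (product_cat I C) (product_cat I D) (product_functor I F)"
  by (rule is_functorI)
    (auto simp: product_functor_def product_cat_simps product_cat_hom_iff PiE_iff fun_eq_iff
      intro: functor_Ob functor_hom functor_Ide functor_Cmp assms)

lemma fully_faithful_product_functor:
  assumes cat: "\<And>i. i \<in> I \<Longrightarrow> category (C i)"
    and functors: "\<And>i. i \<in> I \<Longrightarrow> is_functor (C i) (D i) (F i)"
    and ff: "\<And>i. i \<in> I \<Longrightarrow> fully_faithful (C i) (D i) (F i)"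
  shows "fully_faithful (product_cat I C) (product_cat I D) (product_functor I F)"
proof (rule fully_faithfulI[OF is_functor_product_functor[OF functors]])
  fix f f' a a' assume f: "f \<in> hom (product_cat I C) a a'" and f': "f' \<in> hom (product_cat I C) a a'"
    and eq: "FA (product_functor I F) f = FA (product_functor I F) f'"
  show "f = f'"
  proof (rule extensionalityI)
    show "f i = f' i" if i: "i \<in> I" for i
      using f f' fun_cong[OF eq, of i] category.fully_faithful_inj[OF cat[OF i] ff[OF i]] i
      by (auto simp: product_cat_hom_iff product_functor_def)
  qed (use f f' in \<open>auto simp: product_cat_hom_iff\<close>)
next
  fix g a a' assume a: "a \<in> Ob (product_cat I C)" "a' \<in> Ob (product_cat I C)"
    and g: "g \<in> hom (product_cat I D) (FO (product_functor I F) a) (FO (product_functor I F) a')"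
  have "\<exists>f\<in>hom (C i) (a i) (a' i). FA (F i) f = g i" if i: "i \<in> I" for i
    using fully_faithful_full[OF ff[OF i], of "a i" "a' i" "g i"] a g i
    by (auto simp: product_cat_simps product_cat_hom_iff product_functor_def PiE_iff)
  then obtain f where "\<forall>i\<in>I. f i \<in> hom (C i) (a i) (a' i) \<and> FA (F i) (f i) = g i" by metis
  then show "\<exists>f\<in>hom (product_cat I C) a a'. FA (product_functor I F) f = g"
    using a g by (intro bexI[of _ "restrict f I"])
      (auto simp: product_functor_def product_cat_simps product_cat_hom_iff PiE_iff fun_eq_iff
        extensional_def)
qed

lemma essentially_surjective_product_functor:
  assumes cat: "\<And>i. i \<in> I \<Longrightarrow> category (D i)"
    and es: "\<And>i. i \<in> I \<Longrightarrow> essentially_surjective (C i) (D i) (F i)"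
  shows "essentially_surjective (product_cat I C) (product_cat I D) (product_functor I F)"
  unfolding essentially_surjective_def
proof
  fix b assume b: "b \<in> Ob (product_cat I D)"
  have "\<exists>a e. a \<in> Ob (C i) \<and> e \<in> hom (D i) (FO (F i) a) (b i) \<and> is_iso (D i) e" if i: "i \<in> I" for i
    using essentially_surjectiveD[OF es[OF i], of "b i"] b i by (auto simp: product_cat_simps)
  then obtain a e where ae: "\<forall>i\<in>I. a i \<in> Ob (C i) \<and> e i \<in> hom (D i) (FO (F i) (a i)) (b i) \<and>
      is_iso (D i) (e i)"
    by metis
  then have "restrict a I \<in> Ob (product_cat I C)"
    and e: "restrict e I \<in> hom (product_cat I D) (FO (product_functor I F) (restrict a I)) b"
    using b by (auto simp: product_functor_def product_cat_simps product_cat_hom_iff PiE_iff)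
  moreover have "is_iso (product_cat I D) (restrict e I)"
    using ae by (intro product_cat_is_iso[OF cat e]) auto
  ultimately show "\<exists>a\<in>Ob (product_cat I C). \<exists>e\<in>hom (product_cat I D) (FO (product_functor I F) a) b.
      is_iso (product_cat I D) e"
    by blast
qed

lemma equivalent_product_cat:
  assumes eqv: "\<And>i. i \<in> I \<Longrightarrow> equivalent_categories (C i) (D i)"
  shows "equivalent_categories (product_cat I C) (product_cat I D)"
proof -
  have cat: "category (C i)" "category (D i)" if "i \<in> I" for i
    using eqv[OF that] by (auto simp: equivalent_categories_def)
  have "\<exists>F. is_equivalence (C i) (D i) F" if "i \<in> I" for i
    using equivalent_imp_is_equivalence[OF eqv[OF that]] by blast
  then obtain F where F: "is_equivalence (C i) (D i) (F i)" if "i \<in> I" for i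
    by metis
  have "is_equivalence (product_cat I C) (product_cat I D) (product_functor I F)"
    using F by (auto simp: is_equivalence_def intro!: is_functor_product_functor
        fully_faithful_product_functor essentially_surjective_product_functor cat)
  then show ?thesis
    by (rule is_equivalence_imp_equivalent[rotated 2]) (intro category_product_cat cat; assumption)+
qed

definition reindex_functor :: "'j set \<Rightarrow> ('j \<Rightarrow> 'i) \<Rightarrow> ('i \<Rightarrow> 'o, 'i \<Rightarrow> 'a, 'j \<Rightarrow> 'o, 'j \<Rightarrow> 'a) ftor" where
  "reindex_functor J h = \<lparr>FO = (\<lambda>a. \<lambda>j\<in>J. a (h j)), FA = (\<lambda>f. \<lambda>j\<in>J. f (h j))\<rparr>"

lemma reindex_functor_simps [simp]:
  "FO (reindex_functor J h) a = (\<lambda>j\<in>J. a (h j))" "FA (reindex_functor J h) f = (\<lambda>j\<in>J. f (h j))"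
  by (simp_all add: reindex_functor_def)

lemma is_functor_reindex_functor:
  assumes "h ` J \<subseteq> I"
  shows "is_functor (product_cat I C) (product_cat J (\<lambda>j. C (h j))) (reindex_functor J h)"
  by (rule is_functorI)
    (use assms in \<open>auto simp: product_cat_simps product_cat_hom_iff fun_eq_iff\<close>)

lemma fully_faithful_reindex_functor:
  assumes h: "bij_betw h J I"
  shows "fully_faithful (product_cat I C) (product_cat J (\<lambda>j. C (h j))) (reindex_functor J h)"
proof (rule fully_faithfulI[OF is_functor_reindex_functor])
  have onto: "\<exists>j\<in>J. i = h j" if "i \<in> I" for i using h that by (auto simp: bij_betw_def)
  show "h ` J \<subseteq> I" using h by (simp add: bij_betw_def)
  fix f f' a a' assume f: "f \<in> hom (product_cat I C) a a'" and f': "f' \<in> hom (product_cat I C) a a'"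
    and eq: "FA (reindex_functor J h) f = FA (reindex_functor J h) f'"
  show "f = f'"
  proof (rule extensionalityI)
    fix i assume "i \<in> I"
    then obtain j where "j \<in> J" "i = h j" using onto by blast
    then show "f i = f' i" using fun_cong[OF eq, of j] by simp
  qed (use f f' in \<open>auto simp: product_cat_hom_iff\<close>)
next
  fix g a a' assume "a \<in> Ob (product_cat I C)" "a' \<in> Ob (product_cat I C)"
    and g: "g \<in> hom (product_cat J (\<lambda>j. C (h j))) (FO (reindex_functor J h) a)
      (FO (reindex_functor J h) a')"
  let ?f = "\<lambda>i\<in>I. g (inv_into J h i)"
  have "?f (h j) = g j" if "j \<in> J" for j using h that by (auto simp: bij_betw_def)
  moreover have "\<exists>j\<in>J. i = h j" if "i \<in> I" for i using h that by (auto simp: bij_betw_def)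
  ultimately have "?f \<in> hom (product_cat I C) a a'" "FA (reindex_functor J h) ?f = g"
    using g \<open>a \<in> _\<close> \<open>a' \<in> _\<close>
    by (fastforce simp: product_cat_simps product_cat_hom_iff PiE_iff fun_eq_iff extensional_def)+
  then show "\<exists>f\<in>hom (product_cat I C) a a'. FA (reindex_functor J h) f = g" by blast
qed

lemma essentially_surjective_reindex_functor:
  assumes h: "bij_betw h J I" and cat: "\<And>i. i \<in> I \<Longrightarrow> category (C i)"
  shows "essentially_surjective (product_cat I C) (product_cat J (\<lambda>j. C (h j))) (reindex_functor J h)"
  unfolding essentially_surjective_def
proof
  have "h j \<in> I" if "j \<in> J" for j using h that by (auto simp: bij_betw_def)
  then interpret D: category "product_cat J (\<lambda>j. C (h j))" by (intro category_product_cat cat)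
  fix b assume b: "b \<in> Ob (product_cat J (\<lambda>j. C (h j)))"
  let ?a = "\<lambda>i\<in>I. b (inv_into J h i)"
  have "?a (h j) = b j" if "j \<in> J" for j using h that by (auto simp: bij_betw_def)
  moreover have "\<exists>j\<in>J. i = h j" if "i \<in> I" for i using h that by (auto simp: bij_betw_def)
  ultimately have "?a \<in> Ob (product_cat I C)" "FO (reindex_functor J h) ?a = b"
    using b by (fastforce simp: product_cat_simps PiE_iff fun_eq_iff extensional_def)+
  then show "\<exists>a\<in>Ob (product_cat I C).
      \<exists>e\<in>hom (product_cat J (\<lambda>j. C (h j))) (FO (reindex_functor J h) a) b.
        is_iso (product_cat J (\<lambda>j. C (h j))) e"
    using D.ide[OF b] D.is_iso_Ide[OF b] by metis
qed

lemma equivalent_product_cat_reindex: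
  assumes h: "bij_betw h J I" and cat: "\<And>i. i \<in> I \<Longrightarrow> category (C i)"
  shows "equivalent_categories (product_cat I C) (product_cat J (\<lambda>j. C (h j)))"
proof (rule is_equivalence_imp_equivalent)
  have hJ: "h ` J \<subseteq> I" using h by (simp add: bij_betw_def)
  then show "category (product_cat I C)" "category (product_cat J (\<lambda>j. C (h j)))"
    by (auto intro!: category_product_cat cat)
  show "is_equivalence (product_cat I C) (product_cat J (\<lambda>j. C (h j))) (reindex_functor J h)"
    unfolding is_equivalence_def
    by (intro conjI is_functor_reindex_functor[OF hJ] fully_faithful_reindex_functor[OF h]
        essentially_surjective_reindex_functor[OF h] cat)
qed

subsection \<open>Families\<close>

lemma Fam_hom_iff:
  "f \<in> hom (Fam D) (Y, p) (Z, q) \<longleftrightarrow> p \<in> Y \<rightarrow>\<^sub>E Ob D \<and> q \<in> Z \<rightarrow>\<^sub>E Ob D \<and>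
    (\<exists>u v. f = Arrow (Y, p) (u, v) (Z, q) \<and> u \<in> Y \<rightarrow>\<^sub>E Z \<and> v \<in> extensional Y \<and>
      (\<forall>y\<in>Y. v y \<in> hom D (p y) (q (u y))))"
  by (cases f) (auto simp: Fam_def hom_def PiE_iff)

lemma Fam_simps:
  "Ob (Fam D) = {(Y, p). p \<in> Y \<rightarrow>\<^sub>E Ob D}" "Dom (Fam D) = src" "Cod (Fam D) = tgt"
  "Ide (Fam D) (Y, p) = Arrow (Y, p) (\<lambda>y\<in>Y. y, \<lambda>y\<in>Y. Ide D (p y)) (Y, p)"
  "Cmp (Fam D) (Arrow Q (u', v') R) (Arrow (Y, p) (u, v) S) =
    Arrow (Y, p) (compose Y u' u, \<lambda>y\<in>Y. Cmp D (v' (u y)) (v y)) R"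
  by (auto simp: Fam_def)

lemma category_Fam:
  assumes "category D"
  shows "category (Fam D)"
proof -
  interpret D: category D by fact
  show ?thesis
  proof
    fix f assume "f \<in> Arr (Fam D)"
    then show "Dom (Fam D) f \<in> Ob (Fam D) \<and> Cod (Fam D) f \<in> Ob (Fam D)"
      by (auto simp: Fam_def)
  next
    fix a assume "a \<in> Ob (Fam D)"
    then show "Ide (Fam D) a \<in> hom (Fam D) a a"
      by (cases a) (auto simp: Fam_hom_iff Fam_simps D.ide PiE_def Pi_def)
  next
    fix f a b g c assume "f \<in> hom (Fam D) a b" "g \<in> hom (Fam D) b c"
    then show "Cmp (Fam D) g f \<in> hom (Fam D) a c"
      by (cases a; cases b; cases c)
        (fastforce simp: Fam_hom_iff Fam_simps compose_def PiE_def Pi_def intro: D.cmp)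
  next
    fix f a b assume "f \<in> hom (Fam D) a b"
    then show "Cmp (Fam D) f (Ide (Fam D) a) = f" "Cmp (Fam D) (Ide (Fam D) b) f = f"
      by (cases a; cases b; auto simp: Fam_hom_iff Fam_simps compose_def PiE_def Pi_def fun_eq_iff
          extensional_def intro: D.ide_right D.ide_left)+
  next
    fix f a b g c h d
    assume "f \<in> hom (Fam D) a b" "g \<in> hom (Fam D) b c" "h \<in> hom (Fam D) c d"
    then show "Cmp (Fam D) h (Cmp (Fam D) g f) = Cmp (Fam D) (Cmp (Fam D) h g) f"
      by (cases a; cases b; cases c; cases d)
        (fastforce simp: Fam_hom_iff Fam_simps compose_def PiE_def Pi_def fun_eq_iff intro: D.assoc)
  qed
qed

lemma Fam_is_iso:
  assumes "category D" and f: "Arrow (Y, p) (\<lambda>y\<in>Y. y, v) (Y, q) \<in> hom (Fam D) (Y, p) (Y, q)"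
    and iso: "\<And>y. y \<in> Y \<Longrightarrow> is_iso D (v y)"
  shows "is_iso (Fam D) (Arrow (Y, p) (\<lambda>y\<in>Y. y, v) (Y, q))"
proof -
  interpret D: category D by fact
  have v: "v y \<in> hom D (p y) (q y)" if "y \<in> Y" for y
    using f that by (auto simp: Fam_hom_iff)
  have "\<exists>g. g \<in> hom D (q y) (p y) \<and> Cmp D g (v y) = Ide D (p y) \<and> Cmp D (v y) g = Ide D (q y)"
    if y: "y \<in> Y" for y
    using D.is_isoE[OF iso[OF y] v[OF y]] by metis
  then obtain g where g: "\<And>y. y \<in> Y \<Longrightarrow> g y \<in> hom D (q y) (p y) \<and>
      Cmp D (g y) (v y) = Ide D (p y) \<and> Cmp D (v y) (g y) = Ide D (q y)"
    by metis
  have inverse: "Arrow (Y, q) (\<lambda>y\<in>Y. y, restrict g Y) (Y, p) \<in> hom (Fam D) (Y, q) (Y, p)"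
    using f g by (auto simp: Fam_hom_iff)
  show ?thesis
    by (rule category.is_isoI[OF category_Fam[OF assms(1)] f inverse])
      (use g in \<open>auto simp: Fam_simps compose_def fun_eq_iff\<close>)
qed

definition Fam_functor ::
  "('o1, 'a1, 'o2, 'a2) ftor \<Rightarrow>
    (('u, 'o1) fam, ('u, 'o1, 'a1) fam_arr, ('u, 'o2) fam, ('u, 'o2, 'a2) fam_arr) ftor" where
  "Fam_functor F =
    (let FOb = (\<lambda>P. (fst P, \<lambda>y\<in>fst P. FO F (snd P y))) in
    \<lparr>FO = FOb, FA = (\<lambda>f. Arrow (FOb (src f))
      (fst (val f), \<lambda>y\<in>fst (src f). FA F (snd (val f) y)) (FOb (tgt f)))\<rparr>)"

lemma Fam_functor_simps [simp]:
  "FO (Fam_functor F) (Y, p) = (Y, \<lambda>y\<in>Y. FO F (p y))"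
  "FA (Fam_functor F) (Arrow (Y, p) (u, v) (Z, q)) =
    Arrow (Y, \<lambda>y\<in>Y. FO F (p y)) (u, \<lambda>y\<in>Y. FA F (v y)) (Z, \<lambda>z\<in>Z. FO F (q z))"
  by (simp_all add: Fam_functor_def Let_def)

lemma is_functor_Fam_functor:
  assumes F: "is_functor D E F"
  shows "is_functor (Fam D) (Fam E) (Fam_functor F)"
proof (rule is_functorI)
  fix a assume "a \<in> Ob (Fam D)"
  then show "FO (Fam_functor F) a \<in> Ob (Fam E)"
    "FA (Fam_functor F) (Ide (Fam D) a) = Ide (Fam E) (FO (Fam_functor F) a)"
    using functor_Ob[OF F] functor_Ide[OF F] by (cases a; auto simp: Fam_simps PiE_iff fun_eq_iff)+
next
  fix f a b assume "f \<in> hom (Fam D) a b"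
  then show "FA (Fam_functor F) f \<in> hom (Fam E) (FO (Fam_functor F) a) (FO (Fam_functor F) b)"
    using functor_Ob[OF F] functor_hom[OF F]
    by (cases a; cases b) (fastforce simp: Fam_hom_iff PiE_iff)
next
  fix f g a b c assume "f \<in> hom (Fam D) a b" "g \<in> hom (Fam D) b c"
  then show "FA (Fam_functor F) (Cmp (Fam D) g f) =
      Cmp (Fam E) (FA (Fam_functor F) g) (FA (Fam_functor F) f)"
    using functor_Cmp[OF F] by (cases a; cases b; cases c)
      (fastforce simp: Fam_hom_iff Fam_simps PiE_iff fun_eq_iff)
qed

lemma fully_faithful_Fam_functor:
  assumes "category D" and F: "is_functor D E F" and ff: "fully_faithful D E F"
  shows "fully_faithful (Fam D) (Fam E) (Fam_functor F)"
proof (rule fully_faithfulI[OF is_functor_Fam_functor[OF F]])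
  fix f f' a a' assume f: "f \<in> hom (Fam D) a a'" and f': "f' \<in> hom (Fam D) a a'"
    and eq: "FA (Fam_functor F) f = FA (Fam_functor F) f'"
  obtain Y p Z q where a: "a = (Y, p)" "a' = (Z, q)" by (cases a; cases a')
  obtain u v v' where fs: "f = Arrow a (u, v) a'" "f' = Arrow a (u, v') a'"
    "v \<in> extensional Y" "v' \<in> extensional Y" "\<forall>y\<in>Y. v y \<in> hom D (p y) (q (u y))"
    "\<forall>y\<in>Y. v' y \<in> hom D (p y) (q (u y))" "(\<lambda>y\<in>Y. FA F (v y)) = (\<lambda>y\<in>Y. FA F (v' y))"
    using f f' eq by (auto simp: a Fam_hom_iff)
  have "v y = v' y" if "y \<in> Y" for y
    using category.fully_faithful_inj[OF assms(1) ff, of "v y" "p y" "q (u y)" "v' y"] fs(5,6)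
      fun_cong[OF fs(7), of y] that by simp
  then show "f = f'" using extensionalityI[OF fs(3,4)] fs(1,2) by blast
next
  fix g a a' assume a: "a \<in> Ob (Fam D)" "a' \<in> Ob (Fam D)"
    and g: "g \<in> hom (Fam E) (FO (Fam_functor F) a) (FO (Fam_functor F) a')"
  obtain Y p Z q where a_eq: "a = (Y, p)" "a' = (Z, q)" by (cases a; cases a')
  obtain u v where g_eq: "g = Arrow (FO (Fam_functor F) a) (u, v) (FO (Fam_functor F) a')"
    and u: "u \<in> Y \<rightarrow>\<^sub>E Z" and v: "v \<in> extensional Y" "\<forall>y\<in>Y. v y \<in> hom E (FO F (p y)) (FO F (q (u y)))"
    using g by (fastforce simp: a_eq Fam_hom_iff PiE_iff)
  have "\<exists>f\<in>hom D (p y) (q (u y)). FA F f = v y" if "y \<in> Y" for y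
    using fully_faithful_full[OF ff, of "p y" "q (u y)" "v y"] a u v(2) that
    by (auto simp: a_eq Fam_simps PiE_iff)
  then obtain w where w: "\<forall>y\<in>Y. w y \<in> hom D (p y) (q (u y)) \<and> FA F (w y) = v y" by metis
  show "\<exists>f\<in>hom (Fam D) a a'. FA (Fam_functor F) f = g"
  proof
    show "Arrow a (u, restrict w Y) a' \<in> hom (Fam D) a a'"
      using a u w by (auto simp: a_eq Fam_hom_iff Fam_simps)
    have "(\<lambda>y\<in>Y. FA F (restrict w Y y)) = v"
      using w v(1) by (auto simp: fun_eq_iff extensional_def)
    then show "FA (Fam_functor F) (Arrow a (u, restrict w Y) a') = g" by (simp add: g_eq a_eq)
  qed
qed

lemma essentially_surjective_Fam_functor:
  assumes "category E" and F: "is_functor D E F" and es: "essentially_surjective D E F"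
  shows "essentially_surjective (Fam D) (Fam E) (Fam_functor F)"
  unfolding essentially_surjective_def
proof
  fix b assume b: "b \<in> Ob (Fam E)"
  obtain Z q where b_eq: "b = (Z, q)" by (cases b)
  have "\<exists>a e. a \<in> Ob D \<and> e \<in> hom E (FO F a) (q z) \<and> is_iso E e" if "z \<in> Z" for z
    using essentially_surjectiveD[OF es, of "q z"] b that by (auto simp: b_eq Fam_simps)
  then obtain p e where pe: "\<forall>z\<in>Z. p z \<in> Ob D \<and> e z \<in> hom E (FO F (p z)) (q z) \<and> is_iso E (e z)"
    by metis
  let ?a = "(Z, restrict p Z)"
  let ?f = "Arrow (FO (Fam_functor F) ?a) (\<lambda>z\<in>Z. z, restrict e Z) b"
  have f: "?f \<in> hom (Fam E) (FO (Fam_functor F) ?a) b"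
    using b pe functor_Ob[OF F] by (auto simp: b_eq Fam_hom_iff Fam_simps)
  moreover have "is_iso (Fam E) ?f"
    using pe f by (simp add: b_eq) (rule Fam_is_iso[OF assms(1)], auto)
  moreover have "?a \<in> Ob (Fam D)" using pe by (auto simp: Fam_simps)
  ultimately show "\<exists>a\<in>Ob (Fam D). \<exists>e\<in>hom (Fam E) (FO (Fam_functor F) a) b. is_iso (Fam E) e"
    by blast
qed

lemma equivalent_Fam:
  assumes "equivalent_categories D E"
  shows "equivalent_categories (Fam D :: (('u, 'o1) fam, _) cat) (Fam E :: (('u, 'o2) fam, _) cat)"
proof -
  have cat: "category D" "category E" using assms by (auto simp: equivalent_categories_def)
  obtain F where "is_equivalence D E F" using assms by (rule equivalent_imp_is_equivalence)
  then have "is_equivalence (Fam D :: (('u, 'o1) fam, _) cat) (Fam E) (Fam_functor F)"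
    by (auto simp: is_equivalence_def intro!: is_functor_Fam_functor
        fully_faithful_Fam_functor essentially_surjective_Fam_functor cat)
  then show ?thesis
    by (rule is_equivalence_imp_equivalent[OF category_Fam[OF cat(1)] category_Fam[OF cat(2)]])
qed

section \<open>Presheaves\<close>

type_synonym ('o, 'a, 'u) presheaf = "('o, 'a, 'u set, 'u sarr) ftor"
type_synonym ('o, 'a, 'u) presheaf_arr = "(('o, 'a, 'u) presheaf, 'o \<Rightarrow> 'u sarr) arrow"

abbreviation PSh :: "('o, 'a) cat \<Rightarrow> _" where
  "PSh C \<equiv> functor_cat (op_cat C) Sets"

definition act :: "('o, 'a, 'u) presheaf \<Rightarrow> 'a \<Rightarrow> 'u \<Rightarrow> 'u" where
  "act P f = val (FA P f)"

definition app :: "('f, 'o \<Rightarrow> 'u sarr) arrow \<Rightarrow> 'o \<Rightarrow> 'u \<Rightarrow> 'u" where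
  "app \<alpha> a = val (val \<alpha> a)"

definition mk_psh :: "('o, 'a) cat \<Rightarrow> ('o \<Rightarrow> 'u set) \<Rightarrow> ('a \<Rightarrow> 'u \<Rightarrow> 'u) \<Rightarrow>
    ('o, 'a, 'u) presheaf" where
  "mk_psh C S A = \<lparr>FO = restrict S (Ob C),
    FA = (\<lambda>f\<in>Arr C. Arrow (S (Cod C f)) (restrict (A f) (S (Cod C f))) (S (Dom C f)))\<rparr>"

definition mk_psh_arr :: "('o, 'a) cat \<Rightarrow> ('o, 'a, 'u) presheaf \<Rightarrow> ('o \<Rightarrow> 'u \<Rightarrow> 'u) \<Rightarrow>
    ('o, 'a, 'u) presheaf \<Rightarrow> ('o, 'a, 'u) presheaf_arr" where
  "mk_psh_arr C P h Q =
    Arrow P (\<lambda>a\<in>Ob C. Arrow (FO P a) (restrict (h a) (FO P a)) (FO Q a)) Q"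

context category
begin

lemma category_PSh: "category (PSh C)"
  by (intro category_functor_cat category_op category_Sets category_axioms)

lemma FA_hom_Sets: "P \<in> Ob (PSh C) \<Longrightarrow> f \<in> hom C a b \<Longrightarrow> FA P f \<in> hom Sets (FO P b) (FO P a)"
  by (rule functor_hom[of "op_cat C"]) (auto simp: functor_cat_Ob_iff)

lemma act_in: "P \<in> Ob (PSh C) \<Longrightarrow> f \<in> hom C a b \<Longrightarrow> x \<in> FO P b \<Longrightarrow> act P f x \<in> FO P a"
  using FA_hom_Sets by (fastforce simp: Sets_hom_iff act_def)

lemma act_Ide: "P \<in> Ob (PSh C) \<Longrightarrow> a \<in> Ob C \<Longrightarrow> x \<in> FO P a \<Longrightarrow> act P (Ide C a) x = x"
  by (auto simp: functor_cat_Ob_iff is_functor_def act_def Sets_simps)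

lemma act_Cmp:
  assumes P: "P \<in> Ob (PSh C)" and f: "f \<in> hom C a b" and g: "g \<in> hom C b c" and "x \<in> FO P c"
  shows "act P (Cmp C g f) x = act P f (act P g x)"
proof -
  have "is_functor (op_cat C) Sets P" using P by (simp add: functor_cat_Ob_iff)
  then have "FA P (Cmp C g f) = Cmp Sets (FA P f) (FA P g)"
    using functor_Cmp[of "op_cat C" Sets P g c b f a] f g by simp
  then show ?thesis
    using FA_hom_Sets[OF P g] \<open>x \<in> FO P c\<close>
    by (auto simp: Sets_hom_iff act_def Sets_simps compose_def)
qed

lemma FO_mk_psh [simp]: "a \<in> Ob C \<Longrightarrow> FO (mk_psh C S A) a = S a"
  by (simp add: mk_psh_def)

lemma FA_mk_psh:
  "f \<in> hom C a b \<Longrightarrow> FA (mk_psh C S A) f = Arrow (S b) (restrict (A f) (S b)) (S a)"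
  by (auto simp: mk_psh_def hom_def)

lemma act_mk_psh: "f \<in> hom C a b \<Longrightarrow> x \<in> S b \<Longrightarrow> act (mk_psh C S A) f x = A f x"
  by (simp add: FA_mk_psh act_def)

lemma mk_psh_in:
  assumes "\<And>f a b x. f \<in> hom C a b \<Longrightarrow> x \<in> S b \<Longrightarrow> A f x \<in> S a"
    and "\<And>a x. a \<in> Ob C \<Longrightarrow> x \<in> S a \<Longrightarrow> A (Ide C a) x = x"
    and "\<And>f g a b c x. f \<in> hom C a b \<Longrightarrow> g \<in> hom C b c \<Longrightarrow> x \<in> S c \<Longrightarrow>
      A (Cmp C g f) x = A f (A g x)"
  shows "mk_psh C S A \<in> Ob (PSh C)"
proof -
  have "is_functor (op_cat C) Sets (mk_psh C S A)"
  proof (rule is_functorI)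
    fix f a b assume "f \<in> hom (op_cat C) a b"
    then show "FA (mk_psh C S A) f \<in> hom Sets (FO (mk_psh C S A) a) (FO (mk_psh C S A) b)"
      using assms(1) hom_Ob[of f b a] by (auto simp: FA_mk_psh Sets_hom_iff)
  next
    fix a assume "a \<in> Ob (op_cat C)"
    then show "FA (mk_psh C S A) (Ide (op_cat C) a) = Ide Sets (FO (mk_psh C S A) a)"
      using assms(2) by (auto simp: FA_mk_psh[OF ide] Sets_simps fun_eq_iff)
  next
    fix f g a b c assume "f \<in> hom (op_cat C) a b" "g \<in> hom (op_cat C) b c"
    then have f: "f \<in> hom C b a" and g: "g \<in> hom C c b" by simp_all
    show "FA (mk_psh C S A) (Cmp (op_cat C) g f) =
        Cmp Sets (FA (mk_psh C S A) g) (FA (mk_psh C S A) f)"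
      using assms(1)[OF f] assms(3)[OF g f]
      by (auto simp: FA_mk_psh[OF f] FA_mk_psh[OF g] FA_mk_psh[OF cmp[OF g f]] Sets_simps fun_eq_iff
          compose_def)
  qed (simp add: Sets_simps)
  then show ?thesis by (simp add: functor_cat_Ob_iff mk_psh_def)
qed

lemma PSh_homD:
  assumes "\<alpha> \<in> hom (PSh C) P Q"
  shows "P \<in> Ob (PSh C)" "Q \<in> Ob (PSh C)" "src \<alpha> = P" "tgt \<alpha> = Q"
  using assms by (simp_all add: functor_cat_hom_iff)

lemma component_hom_Sets:
  "\<alpha> \<in> hom (PSh C) P Q \<Longrightarrow> a \<in> Ob C \<Longrightarrow> val \<alpha> a \<in> hom Sets (FO P a) (FO Q a)"
  by (rule functor_cat_component[where A = "op_cat C"]) simp_all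

lemma app_in: "\<alpha> \<in> hom (PSh C) P Q \<Longrightarrow> a \<in> Ob C \<Longrightarrow> x \<in> FO P a \<Longrightarrow> app \<alpha> a x \<in> FO Q a"
  using component_hom_Sets by (fastforce simp: Sets_hom_iff app_def)

lemma app_act:
  assumes \<alpha>: "\<alpha> \<in> hom (PSh C) P Q" and f: "f \<in> hom C a b" and "x \<in> FO P b"
  shows "app \<alpha> a (act P f x) = act Q f (app \<alpha> b x)"
proof -
  have "is_nat_trans (op_cat C) Sets P Q (val \<alpha>)" using \<alpha> by (simp add: functor_cat_hom_iff)
  then have "Cmp Sets (val \<alpha> a) (FA P f) = Cmp Sets (FA Q f) (val \<alpha> b)"
    using nat_trans_commute[of "op_cat C" Sets P Q "val \<alpha>" f b a] f by simp
  from arg_cong[OF this, of "\<lambda>k. val k x"] show ?thesis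
    using FA_hom_Sets[OF PSh_homD(1)[OF \<alpha>] f] component_hom_Sets[OF \<alpha> hom_Ob(2)[OF f]] \<open>x \<in> FO P b\<close>
    by (auto simp: Sets_hom_iff Sets_simps compose_def app_def act_def)
qed

lemma app_mk_psh_arr [simp]: "a \<in> Ob C \<Longrightarrow> x \<in> FO P a \<Longrightarrow> app (mk_psh_arr C P h Q) a x = h a x"
  by (simp add: mk_psh_arr_def app_def)

lemma mk_psh_arr_in:
  assumes P: "P \<in> Ob (PSh C)" and Q: "Q \<in> Ob (PSh C)"
    and "\<And>a x. a \<in> Ob C \<Longrightarrow> x \<in> FO P a \<Longrightarrow> h a x \<in> FO Q a"
    and "\<And>f a b x. f \<in> hom C a b \<Longrightarrow> x \<in> FO P b \<Longrightarrow> h a (act P f x) = act Q f (h b x)"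
  shows "mk_psh_arr C P h Q \<in> hom (PSh C) P Q"
proof -
  have "is_nat_trans (op_cat C) Sets P Q (val (mk_psh_arr C P h Q))"
  proof (rule is_nat_transI)
    fix a assume "a \<in> Ob (op_cat C)"
    then show "val (mk_psh_arr C P h Q) a \<in> hom Sets (FO P a) (FO Q a)"
      using assms(3) by (auto simp: mk_psh_arr_def Sets_hom_iff)
  next
    fix f a b assume "f \<in> hom (op_cat C) a b"
    then have f: "f \<in> hom C b a" by simp
    show "Cmp Sets (val (mk_psh_arr C P h Q) b) (FA P f) =
        Cmp Sets (FA Q f) (val (mk_psh_arr C P h Q) a)"
      using assms(3) assms(4)[OF f] FA_hom_Sets[OF P f] FA_hom_Sets[OF Q f] hom_Ob[OF f]
      by (auto simp: mk_psh_arr_def Sets_simps Sets_hom_iff compose_def fun_eq_iff restrict_def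
          PiE_iff act_def)
  qed
  then show ?thesis using P Q by (simp add: functor_cat_hom_iff) (simp add: mk_psh_arr_def)
qed

lemma PSh_hom_eqI:
  assumes \<alpha>: "\<alpha> \<in> hom (PSh C) P Q" and \<beta>: "\<beta> \<in> hom (PSh C) P Q"
    and eq: "\<And>a x. a \<in> Ob C \<Longrightarrow> x \<in> FO P a \<Longrightarrow> app \<alpha> a x = app \<beta> a x"
  shows "\<alpha> = \<beta>"
proof -
  have "val \<alpha> a = val \<beta> a" if a: "a \<in> Ob C" for a
  proof -
    have "val (val \<alpha> a) = val (val \<beta> a)"
      using component_hom_Sets[OF \<alpha> a] component_hom_Sets[OF \<beta> a] eq[OF a]
      by (intro PiE_ext[of _ "FO P a" "\<lambda>_. FO Q a"]) (auto simp: Sets_hom_iff app_def)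
    then show ?thesis
      using component_hom_Sets[OF \<alpha> a] component_hom_Sets[OF \<beta> a]
      by (auto simp: Sets_hom_iff intro: arrow.expand)
  qed
  then have "val \<alpha> = val \<beta>"
    using \<alpha> \<beta> by (auto simp: functor_cat_hom_iff intro!: extensionalityI)
  then show ?thesis using \<alpha> \<beta> by (auto simp: functor_cat_hom_iff intro: arrow.expand)
qed

lemma app_Ide [simp]: "a \<in> Ob C \<Longrightarrow> x \<in> FO P a \<Longrightarrow> app (Ide (PSh C) P) a x = x"
  by (simp add: app_def functor_cat_simps Sets_simps)

lemma app_Cmp [simp]:
  assumes "\<alpha> \<in> hom (PSh C) P Q" "a \<in> Ob C" "x \<in> FO P a"
  shows "app (Cmp (PSh C) \<beta> \<alpha>) a x = app \<beta> a (app \<alpha> a x)"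
  using component_hom_Sets[OF assms(1,2)] assms(2,3)
  by (auto simp: app_def functor_cat_simps Sets_simps Sets_hom_iff compose_def)

lemma PSh_is_isoI:
  assumes \<alpha>: "\<alpha> \<in> hom (PSh C) P Q"
    and bij: "\<And>a. a \<in> Ob C \<Longrightarrow> bij_betw (app \<alpha> a) (FO P a) (FO Q a)"
  shows "is_iso (PSh C) \<alpha>"
proof -
  interpret P: category "PSh C" by (rule category_PSh)
  let ?h = "\<lambda>a. inv_into (FO P a) (app \<alpha> a)"
  note P = PSh_homD(1)[OF \<alpha>] and Q = PSh_homD(2)[OF \<alpha>]
  have h: "?h a x \<in> FO P a" "app \<alpha> a (?h a x) = x" if "a \<in> Ob C" "x \<in> FO Q a" for a x
    using bij[OF that(1)] that(2) by (auto simp: bij_betw_def inv_into_into f_inv_into_f)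
  have h_app: "?h a (app \<alpha> a x) = x" if "a \<in> Ob C" "x \<in> FO P a" for a x
    using bij[OF that(1)] that(2) by (auto simp: bij_betw_def)
  have \<beta>: "mk_psh_arr C Q ?h P \<in> hom (PSh C) Q P"
  proof (rule mk_psh_arr_in[OF Q P h(1)])
    fix f a b x assume f: "f \<in> hom C a b" and x: "x \<in> FO Q b"
    note a = hom_Ob(1)[OF f] and hx = h[OF hom_Ob(2)[OF f] x]
    have "act Q f x = app \<alpha> a (act P f (?h b x))" using app_act[OF \<alpha> f hx(1)] hx(2) by simp
    then show "?h a (act Q f x) = act P f (?h b x)" using h_app[OF a act_in[OF P f hx(1)]] by simp
  qed
  show ?thesis
    by (rule P.is_isoI[OF \<alpha> \<beta>]; rule PSh_hom_eqI)
      (use \<alpha> \<beta> P Q in \<open>auto intro!: P.ide P.cmp[OF \<alpha> \<beta>] P.cmp[OF \<beta> \<alpha>] simp: h h_app app_in\<close>)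
qed

lemma bij_betw_act:
  assumes P: "P \<in> Ob (PSh C)" and "is_iso C f" and f: "f \<in> hom C a b"
  shows "bij_betw (act P f) (FO P b) (FO P a)"
proof -
  obtain g where g: "g \<in> hom C b a" "Cmp C g f = Ide C a" "Cmp C f g = Ide C b"
    using is_isoE[OF \<open>is_iso C f\<close> f] by metis
  note ob = hom_Ob[OF f]
  show ?thesis
    by (rule bij_betw_byWitness[where f' = "act P g"])
      (auto simp: act_Cmp[OF P f g(1), symmetric] act_Cmp[OF P g(1) f, symmetric] g(2,3)
        act_Ide[OF P ob(1)] act_Ide[OF P ob(2)] intro: act_in[OF P f] act_in[OF P g(1)])
qed

end

subsection \<open>Presheaves on equivalent categories\<close>

definition pullback_psh where
  "pullback_psh A F P = mk_psh A (\<lambda>a. FO P (FO F a)) (\<lambda>f. act P (FA F f))"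

definition pullback :: "('o1, 'a1) cat \<Rightarrow> ('o1, 'a1, 'o2, 'a2) ftor \<Rightarrow>
    (('o2, 'a2, 'u) presheaf, ('o2, 'a2, 'u) presheaf_arr,
     ('o1, 'a1, 'u) presheaf, ('o1, 'a1, 'u) presheaf_arr) ftor"
  where
  "pullback A F = \<lparr>FO = pullback_psh A F,
    FA = (\<lambda>\<alpha>. mk_psh_arr A (pullback_psh A F (src \<alpha>)) (\<lambda>a. app \<alpha> (FO F a))
      (pullback_psh A F (tgt \<alpha>)))\<rparr>"

locale presheaf_pullback = A: category A + B: category B
  for A :: "('o1, 'a1) cat" and B :: "('o2, 'a2) cat" +
  fixes F :: "('o1, 'a1, 'o2, 'a2) ftor"
  assumes is_functor: "is_functor A B F"
begin

lemma FO_pullback: "a \<in> Ob A \<Longrightarrow> FO (FO (pullback A F) P) a = FO P (FO F a)"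
  by (simp add: pullback_def pullback_psh_def)

lemma act_pullback:
  "f \<in> hom A a b \<Longrightarrow> x \<in> FO P (FO F b) \<Longrightarrow> act (FO (pullback A F) P) f x = act P (FA F f) x"
  by (simp add: pullback_def pullback_psh_def A.act_mk_psh)

lemma app_pullback:
  "\<alpha> \<in> hom (PSh B) P Q \<Longrightarrow> a \<in> Ob A \<Longrightarrow> x \<in> FO P (FO F a) \<Longrightarrow>
    app (FA (pullback A F) \<alpha>) a x = app \<alpha> (FO F a) x"
  by (simp add: pullback_def pullback_psh_def B.PSh_homD)

lemma pullback_in:
  assumes P: "P \<in> Ob (PSh B)"
  shows "FO (pullback A F) P \<in> Ob (PSh A)"
  unfolding pullback_def pullback_psh_def ftor.simps
proof (rule A.mk_psh_in)
  fix f a b x assume "f \<in> hom A a b" "x \<in> FO P (FO F b)"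
  then show "act P (FA F f) x \<in> FO P (FO F a)" by (rule B.act_in[OF P functor_hom[OF is_functor]])
next
  fix a x assume "a \<in> Ob A" "x \<in> FO P (FO F a)"
  then show "act P (FA F (Ide A a)) x = x"
    by (simp add: functor_Ide[OF is_functor] B.act_Ide[OF P functor_Ob[OF is_functor]])
next
  fix f g a b c x assume f: "f \<in> hom A a b" and g: "g \<in> hom A b c" and x: "x \<in> FO P (FO F c)"
  show "act P (FA F (Cmp A g f)) x = act P (FA F f) (act P (FA F g) x)"
    by (simp add: functor_Cmp[OF is_functor f g]
        B.act_Cmp[OF P functor_hom[OF is_functor f] functor_hom[OF is_functor g] x])
qed

lemma pullback_hom:
  assumes \<alpha>: "\<alpha> \<in> hom (PSh B) P Q"
  shows "FA (pullback A F) \<alpha> \<in> hom (PSh A) (FO (pullback A F) P) (FO (pullback A F) Q)"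
proof -
  note P = B.PSh_homD(1)[OF \<alpha>] and Q = B.PSh_homD(2)[OF \<alpha>]
  have "mk_psh_arr A (FO (pullback A F) P) (\<lambda>a. app \<alpha> (FO F a)) (FO (pullback A F) Q) \<in>
      hom (PSh A) (FO (pullback A F) P) (FO (pullback A F) Q)"
  proof (rule A.mk_psh_arr_in[OF pullback_in[OF P] pullback_in[OF Q]])
    fix a x assume "a \<in> Ob A" "x \<in> FO (FO (pullback A F) P) a"
    then show "app \<alpha> (FO F a) x \<in> FO (FO (pullback A F) Q) a"
      by (simp add: FO_pullback B.app_in[OF \<alpha> functor_Ob[OF is_functor]])
  next
    fix f a b x assume f: "f \<in> hom A a b" and x: "x \<in> FO (FO (pullback A F) P) b"
    note Ff = functor_hom[OF is_functor f] and b = A.hom_Ob(2)[OF f]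
    have x: "x \<in> FO P (FO F b)" using x by (simp add: FO_pullback[OF b])
    show "app \<alpha> (FO F a) (act (FO (pullback A F) P) f x) =
        act (FO (pullback A F) Q) f (app \<alpha> (FO F b) x)"
      by (simp add: act_pullback[OF f x] B.app_act[OF \<alpha> Ff x]
          act_pullback[OF f B.app_in[OF \<alpha> B.hom_Ob(2)[OF Ff] x]])
  qed
  then show ?thesis by (simp add: pullback_def B.PSh_homD[OF \<alpha>])
qed

lemma is_functor_pullback: "is_functor (PSh B) (PSh A) (pullback A F)"
proof (rule is_functorI)
  interpret PA: category "PSh A" by (rule A.category_PSh)
  interpret PB: category "PSh B" by (rule B.category_PSh)
  fix P :: "('o2, 'a2, 'u) presheaf" assume P: "P \<in> Ob (PSh B)"
  show "FA (pullback A F) (Ide (PSh B) P) = Ide (PSh A) (FO (pullback A F) P)"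
    by (rule A.PSh_hom_eqI[OF pullback_hom[OF PB.ide[OF P]] PA.ide[OF pullback_in[OF P]]])
      (use P in \<open>simp add: app_pullback[OF PB.ide] FO_pullback functor_Ob[OF is_functor]\<close>)
next
  interpret PA: category "PSh A" by (rule A.category_PSh)
  interpret PB: category "PSh B" by (rule B.category_PSh)
  fix \<alpha> \<beta> and P Q R :: "('o2, 'a2, 'u) presheaf"
  assume \<alpha>: "\<alpha> \<in> hom (PSh B) P Q" and \<beta>: "\<beta> \<in> hom (PSh B) Q R"
  show "FA (pullback A F) (Cmp (PSh B) \<beta> \<alpha>) =
      Cmp (PSh A) (FA (pullback A F) \<beta>) (FA (pullback A F) \<alpha>)"
  proof (rule A.PSh_hom_eqI[OF pullback_hom[OF PB.cmp[OF \<alpha> \<beta>]]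
        PA.cmp[OF pullback_hom[OF \<alpha>] pullback_hom[OF \<beta>]]])
    fix a x assume a: "a \<in> Ob A" and x: "x \<in> FO (FO (pullback A F) P) a"
    have Fa: "FO F a \<in> Ob B" and x': "x \<in> FO P (FO F a)"
      using a x functor_Ob[OF is_functor] by (auto simp: FO_pullback)
    show "app (FA (pullback A F) (Cmp (PSh B) \<beta> \<alpha>)) a x =
        app (Cmp (PSh A) (FA (pullback A F) \<beta>) (FA (pullback A F) \<alpha>)) a x"
      by (simp add: app_pullback[OF PB.cmp[OF \<alpha> \<beta>] a x'] A.app_Cmp[OF pullback_hom[OF \<alpha>] a x]
          B.app_Cmp[OF \<alpha> Fa x'] app_pullback[OF \<alpha> a x'] app_pullback[OF \<beta> a B.app_in[OF \<alpha> Fa x']])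
  qed
qed (auto intro: pullback_in pullback_hom)

end

definition act_arr :: "('o, 'a) cat \<Rightarrow> ('o, 'a, 'o, 'a) ftor \<Rightarrow> ('o \<Rightarrow> 'a) \<Rightarrow>
    ('o, 'a, 'u) presheaf \<Rightarrow> ('o, 'a, 'u) presheaf_arr" where
  "act_arr A H \<phi> P = mk_psh_arr A P (\<lambda>a. act P (\<phi> a)) (FO (pullback A H) P)"

locale endofunctor_to_id = A: category A + presheaf_pullback A A H
  for A :: "('o, 'a) cat" and H :: "('o, 'a, 'o, 'a) ftor" +
  fixes \<phi> :: "'o \<Rightarrow> 'a"
  assumes natural: "is_nat_trans A A H id_ftor \<phi>"
begin

lemma hom: "a \<in> Ob A \<Longrightarrow> \<phi> a \<in> hom A (FO H a) a"
  using nat_trans_hom[OF natural] by simp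

lemma app_act_arr: "a \<in> Ob A \<Longrightarrow> x \<in> FO P a \<Longrightarrow> app (act_arr A H \<phi> P) a x = act P (\<phi> a) x"
  by (simp add: act_arr_def)

lemma act_arr_hom:
  assumes P: "P \<in> Ob (PSh A)"
  shows "act_arr A H \<phi> P \<in> hom (PSh A) P (FO (pullback A H) P)"
  unfolding act_arr_def
proof (rule A.mk_psh_arr_in[OF P pullback_in[OF P]])
  show "act P (\<phi> a) x \<in> FO (FO (pullback A H) P) a" if "a \<in> Ob A" "x \<in> FO P a" for a x
    using A.act_in[OF P hom] that by (simp add: FO_pullback)
  fix f a b x assume f: "f \<in> hom A a b" and x: "x \<in> FO P b"
  note a = A.hom_Ob(1)[OF f] and b = A.hom_Ob(2)[OF f]
  have "act P (\<phi> a) (act P f x) = act P (Cmp A f (\<phi> a)) x"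
    using A.act_Cmp[OF P hom[OF a] f x] by simp
  also have "\<dots> = act P (Cmp A (\<phi> b) (FA H f)) x"
    using nat_trans_commute[OF natural f] by simp
  also have "\<dots> = act P (FA H f) (act P (\<phi> b) x)"
    by (rule A.act_Cmp[OF P functor_hom[OF is_functor f] hom[OF b] x])
  finally show "act P (\<phi> a) (act P f x) = act (FO (pullback A H) P) f (act P (\<phi> b) x)"
    using A.act_in[OF P hom[OF b] x] by (simp add: act_pullback[OF f])
qed

lemma act_arr_natural: "is_nat_trans (PSh A) (PSh A) id_ftor (pullback A H) (act_arr A H \<phi>)"
proof (rule is_nat_transI)
  fix \<alpha> P Q assume \<alpha>: "\<alpha> \<in> hom (PSh A) P Q"
  note P = A.PSh_homD(1)[OF \<alpha>] and Q = A.PSh_homD(2)[OF \<alpha>]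
  let ?\<theta> = "act_arr A H \<phi>"
  have "Cmp (PSh A) (?\<theta> Q) \<alpha> = Cmp (PSh A) (FA (pullback A H) \<alpha>) (?\<theta> P)"
  proof (rule A.PSh_hom_eqI[OF category.cmp[OF A.category_PSh \<alpha> act_arr_hom[OF Q]]
        category.cmp[OF A.category_PSh act_arr_hom[OF P] pullback_hom[OF \<alpha>]]])
    fix a x assume a: "a \<in> Ob A" and x: "x \<in> FO P a"
    show "app (Cmp (PSh A) (?\<theta> Q) \<alpha>) a x = app (Cmp (PSh A) (FA (pullback A H) \<alpha>) (?\<theta> P)) a x"
      by (simp add: A.app_Cmp[OF \<alpha> a x] A.app_Cmp[OF act_arr_hom[OF P] a x] app_act_arr a x
          A.app_in[OF \<alpha> a x] A.app_act[OF \<alpha> hom[OF a] x]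
          app_pullback[OF \<alpha> a A.act_in[OF P hom[OF a] x]])
  qed
  then show "Cmp (PSh A) (?\<theta> Q) (FA id_ftor \<alpha>) = Cmp (PSh A) (FA (pullback A H) \<alpha>) (?\<theta> P)" by simp
qed (simp add: act_arr_hom)

end

lemma pullback_iso_id:
  assumes "category A" and H: "is_functor A A H" and "naturally_isomorphic A A H id_ftor"
  shows "naturally_isomorphic (PSh A) (PSh A) (pullback A H)
    (id_ftor :: (('o1, 'a1, 'u) presheaf, _, _, _) ftor)"
proof -
  obtain \<phi> where \<phi>: "is_nat_trans A A H id_ftor \<phi>" and iso: "\<And>a. a \<in> Ob A \<Longrightarrow> is_iso A (\<phi> a)"
    using assms(3) by (rule naturally_isomorphicE) blast
  interpret endofunctor_to_id A H \<phi>
    by (intro endofunctor_to_id.intro presheaf_pullback.intro presheaf_pullback_axioms.intro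
        endofunctor_to_id_axioms.intro) fact+
  have "naturally_isomorphic (PSh A) (PSh A) id_ftor
      (pullback A H :: (('o1, 'a1, 'u) presheaf, _, _, _) ftor)"
  proof (rule naturally_isomorphicI[OF act_arr_natural])
    fix P :: "('o1, 'a1, 'u) presheaf" assume P: "P \<in> Ob (PSh A)"
    show "is_iso (PSh A) (act_arr A H \<phi> P)"
    proof (rule A.PSh_is_isoI[OF act_arr_hom[OF P]])
      fix a assume a: "a \<in> Ob A"
      then show "bij_betw (app (act_arr A H \<phi> P) a) (FO P a) (FO (FO (pullback A H) P) a)"
        using A.bij_betw_act[OF P iso[OF a] hom[OF a]]
          bij_betw_cong[of "FO P a" "app (act_arr A H \<phi> P) a" "act P (\<phi> a)"]
        by (simp add: FO_pullback app_act_arr)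
    qed
  qed
  then show ?thesis
    by (rule naturally_isomorphic_sym[OF A.category_PSh A.category_PSh
          is_functor_id_ftor[OF A.category_PSh] is_functor_pullback])
qed

lemma pullback_comp:
  assumes "category A" and F: "is_functor A B F"
  shows "pullback A (comp_ftor G F) = comp_ftor (pullback A F) (pullback B G)"
proof -
  interpret A: category A by fact
  have Arr: "FA F f \<in> hom B (FO F (Dom A f)) (FO F (Cod A f))" if "f \<in> Arr A" for f
    by (rule functor_hom[OF F Arr_hom[OF that]])
  note simps = pullback_psh_def mk_psh_def act_def fun_eq_iff restrict_def functor_Ob[OF F]
    A.dom_cod homD[OF Arr]
  have psh: "pullback_psh A (comp_ftor G F) P = pullback_psh A F (pullback_psh B G P)" for P
    by (rule ftor.equality) (auto simp: simps)
  show ?thesis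
  proof (rule ftor.equality)
    show "FO (pullback A (comp_ftor G F)) = FO (comp_ftor (pullback A F) (pullback B G))"
      by (rule ext) (simp add: pullback_def psh)
    show "FA (pullback A (comp_ftor G F)) = FA (comp_ftor (pullback A F) (pullback B G))"
      by (rule ext) (simp add: pullback_def psh mk_psh_arr_def app_def simps)
  qed simp
qed

lemma equivalent_PSh:
  assumes "equivalent_categories A B"
  shows "equivalent_categories (PSh A :: (('o1, 'a1, 'u) presheaf, _) cat)
    (PSh B :: (('o2, 'a2, 'u) presheaf, _) cat)"
proof -
  obtain F G where cat: "category A" "category B" and F: "is_functor A B F" and G: "is_functor B A G"
    and unit: "naturally_isomorphic A A (comp_ftor G F) id_ftor"
    and counit: "naturally_isomorphic B B (comp_ftor F G) id_ftor"
    using assms by (auto simp: equivalent_categories_def)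
  interpret F: presheaf_pullback A B F
    by (intro presheaf_pullback.intro presheaf_pullback_axioms.intro cat F)
  interpret G: presheaf_pullback B A G
    by (intro presheaf_pullback.intro presheaf_pullback_axioms.intro cat G)
  show ?thesis
    unfolding equivalent_categories_def
    using F.A.category_PSh F.B.category_PSh F.is_functor_pullback G.is_functor_pullback
      pullback_iso_id[OF cat(1) is_functor_comp[OF F G] unit]
      pullback_iso_id[OF cat(2) is_functor_comp[OF G F] counit]
    by (intro conjI exI[of _ "pullback B G"] exI[of _ "pullback A F"])
      (simp_all add: pullback_comp[OF cat(1) F] pullback_comp[OF cat(2) G])
qed

section \<open>Presheaves on trees of words\<close>

type_synonym ('l, 'u) word_psh = "('l list, 'l list \<times> 'l list, 'u) presheaf"

definition prefix_cat :: "'l list set \<Rightarrow> ('l list, 'l list \<times> 'l list) cat" where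
  "prefix_cat L = \<lparr>Ob = L, Arr = {(v, w). v \<in> L \<and> w \<in> L \<and> prefix v w}, Dom = fst, Cod = snd,
    Ide = (\<lambda>w. (w, w)), Cmp = (\<lambda>g f. (fst f, snd g))\<rparr>"

lemma prefix_cat_simps [simp]:
  "Ob (prefix_cat L) = L" "Ide (prefix_cat L) w = (w, w)" "Cmp (prefix_cat L) g f = (fst f, snd g)"
  by (simp_all add: prefix_cat_def)

lemma prefix_cat_hom_iff:
  "f \<in> hom (prefix_cat L) v w \<longleftrightarrow> f = (v, w) \<and> v \<in> L \<and> w \<in> L \<and> prefix v w"
  by (auto simp: hom_def prefix_cat_def)

interpretation prefix_cat: category "prefix_cat L" for L :: "'l list set"
proof
  show "Dom (prefix_cat L) f \<in> Ob (prefix_cat L) \<and> Cod (prefix_cat L) f \<in> Ob (prefix_cat L)"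
    if "f \<in> Arr (prefix_cat L)" for f
    using that by (auto simp: prefix_cat_def)
qed (auto simp: prefix_cat_hom_iff)

lemma is_equivalence_prefix_cat:
  assumes "category C"
    and thin: "\<And>f g a b. f \<in> hom C a b \<Longrightarrow> g \<in> hom C a b \<Longrightarrow> f = g"
    and hom_iff: "\<And>a b. a \<in> Ob C \<Longrightarrow> b \<in> Ob C \<Longrightarrow> hom C a b \<noteq> {} \<longleftrightarrow> prefix (word a) (word b)"
    and words: "word ` Ob C = L"
  shows "is_equivalence C (prefix_cat L) \<lparr>FO = word, FA = (\<lambda>f. (word (Dom C f), word (Cod C f)))\<rparr>"
proof -
  interpret category C by fact
  let ?F = "\<lparr>FO = word, FA = (\<lambda>f. (word (Dom C f), word (Cod C f)))\<rparr>"
  have word: "word a \<in> L" if "a \<in> Ob C" for a using that words by blast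
  have "is_functor C (prefix_cat L) ?F"
  proof (rule is_functorI)
    fix f a b assume f: "f \<in> hom C a b"
    then show "FA ?F f \<in> hom (prefix_cat L) (FO ?F a) (FO ?F b)"
      using hom_iff[of a b] hom_Ob[OF f] word homD[OF f] by (auto simp: prefix_cat_hom_iff)
  next
    fix f g a b c assume "f \<in> hom C a b" "g \<in> hom C b c"
    then show "FA ?F (Cmp C g f) = Cmp (prefix_cat L) (FA ?F g) (FA ?F f)"
      using homD[OF cmp[of f a b g c]] by (simp add: hom_def)
  qed (use word homD[OF ide] in auto)
  moreover have "fully_faithful C (prefix_cat L) ?F"
  proof (rule fully_faithfulI[OF calculation thin])
    fix g a b assume "a \<in> Ob C" "b \<in> Ob C" and g: "g \<in> hom (prefix_cat L) (FO ?F a) (FO ?F b)"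
    then obtain f where f: "f \<in> hom C a b" using hom_iff[of a b] by (auto simp: prefix_cat_hom_iff)
    then show "\<exists>f\<in>hom C a b. FA ?F f = g"
      using g homD[OF f] by (intro bexI[of _ f]) (auto simp: prefix_cat_hom_iff)
  qed
  moreover have "essentially_surjective C (prefix_cat L) ?F"
    unfolding essentially_surjective_def
    using words prefix_cat.ide[of _ L] prefix_cat.is_iso_Ide[of _ L] by fastforce
  ultimately show ?thesis by (simp add: is_equivalence_def)
qed

definition branch :: "'l list set \<Rightarrow> 'l \<Rightarrow> 'l list set" where
  "branch L c = {w. c # w \<in> L}"

lemma branch_iff [simp]: "w \<in> branch L c \<longleftrightarrow> c # w \<in> L"
  by (simp add: branch_def)

locale rooted_words =
  fixes L :: "'l list set" and I :: "'l set"
  assumes root: "[] \<in> L" and heads: "c # w \<in> L \<Longrightarrow> c \<in> I"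
begin

abbreviation Branches where
  "Branches \<equiv> product_cat I (\<lambda>c. PSh (prefix_cat (branch L c)))"

lemma category_Branches: "category Branches"
  by (intro category_product_cat prefix_cat.category_PSh)

lemma root_hom: "w \<in> L \<Longrightarrow> ([], w) \<in> hom (prefix_cat L) [] w"
  by (simp add: prefix_cat_hom_iff root)

lemma Cons_hom:
  "f \<in> hom (prefix_cat (branch L c)) v w \<Longrightarrow> (c # v, c # w) \<in> hom (prefix_cat L) (c # v) (c # w)"
  by (simp add: prefix_cat_hom_iff)

lemma act_root:
  "P \<in> Ob (PSh (prefix_cat L)) \<Longrightarrow> w \<in> L \<Longrightarrow> x \<in> FO P w \<Longrightarrow> act P ([], w) x \<in> FO P []"
  by (rule prefix_cat.act_in[OF _ root_hom])

lemma act_root_act: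
  assumes P: "P \<in> Ob (PSh (prefix_cat L))" and f: "f \<in> hom (prefix_cat L) v w" and x: "x \<in> FO P w"
  shows "act P ([], v) (act P f x) = act P ([], w) x"
  using prefix_cat.act_Cmp[OF P root_hom f x] f by (simp add: prefix_cat_hom_iff)

definition fibre :: "('l, 'u) word_psh \<Rightarrow> 'u \<Rightarrow> 'l \<Rightarrow> ('l, 'u) word_psh" where
  "fibre P y c = mk_psh (prefix_cat (branch L c)) (\<lambda>w. {x \<in> FO P (c # w). act P ([], c # w) x = y})
    (\<lambda>(v, w). act P (c # v, c # w))"

definition fibre_arr where
  "fibre_arr \<alpha> y c = mk_psh_arr (prefix_cat (branch L c)) (fibre (src \<alpha>) y c) (\<lambda>w. app \<alpha> (c # w))
    (fibre (tgt \<alpha>) (app \<alpha> [] y) c)"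

lemma FO_fibre:
  "c # w \<in> L \<Longrightarrow> FO (fibre P y c) w = {x \<in> FO P (c # w). act P ([], c # w) x = y}"
  by (simp add: fibre_def)

lemma fibreI:
  "c # w \<in> L \<Longrightarrow> x \<in> FO P (c # w) \<Longrightarrow> act P ([], c # w) x = y \<Longrightarrow> x \<in> FO (fibre P y c) w"
  and fibreD: "c # w \<in> L \<Longrightarrow> x \<in> FO (fibre P y c) w \<Longrightarrow> x \<in> FO P (c # w) \<and> act P ([], c # w) x = y"
  by (simp_all add: FO_fibre)

lemma act_fibre:
  assumes "f \<in> hom (prefix_cat (branch L c)) v w" "x \<in> FO (fibre P y c) w"
  shows "act (fibre P y c) f x = act P (c # v, c # w) x"
proof -
  have f: "f = (v, w)" "c # w \<in> L" using assms(1) by (auto simp: prefix_cat_hom_iff)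
  show ?thesis
    unfolding fibre_def
    by (subst prefix_cat.act_mk_psh[OF assms(1)]) (use f fibreD[OF f(2) assms(2)] in auto)
qed

lemma fibre_in:
  assumes P: "P \<in> Ob (PSh (prefix_cat L))"
  shows "fibre P y c \<in> Ob (PSh (prefix_cat (branch L c)))"
  unfolding fibre_def
proof (rule prefix_cat.mk_psh_in)
  fix f v w x assume f: "f \<in> hom (prefix_cat (branch L c)) v w"
    and x: "x \<in> {x \<in> FO P (c # w). act P ([], c # w) x = y}"
  then show "(\<lambda>(v, w). act P (c # v, c # w)) f x \<in> {x \<in> FO P (c # v). act P ([], c # v) x = y}"
    using prefix_cat.act_in[OF P Cons_hom[OF f]] act_root_act[OF P Cons_hom[OF f]]
    by (simp add: prefix_cat_hom_iff)
next
  fix w x assume "w \<in> Ob (prefix_cat (branch L c))"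
    and "x \<in> {x \<in> FO P (c # w). act P ([], c # w) x = y}"
  then show "(\<lambda>(v, w). act P (c # v, c # w)) (Ide (prefix_cat (branch L c)) w) x = x"
    using prefix_cat.act_Ide[OF P, of "c # w" x] by simp
next
  fix f g u v w x assume f: "f \<in> hom (prefix_cat (branch L c)) u v"
    and g: "g \<in> hom (prefix_cat (branch L c)) v w"
    and "x \<in> {x \<in> FO P (c # w). act P ([], c # w) x = y}"
  then show "(\<lambda>(v, w). act P (c # v, c # w)) (Cmp (prefix_cat (branch L c)) g f) x =
      (\<lambda>(v, w). act P (c # v, c # w)) f ((\<lambda>(v, w). act P (c # v, c # w)) g x)"
    using prefix_cat.act_Cmp[OF P Cons_hom[OF f] Cons_hom[OF g]] by (simp add: prefix_cat_hom_iff)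
qed

lemma app_fibre_arr:
  assumes "\<alpha> \<in> hom (PSh (prefix_cat L)) P Q" "c # w \<in> L" "x \<in> FO (fibre P y c) w"
  shows "app (fibre_arr \<alpha> y c) w x = app \<alpha> (c # w) x"
  using assms(2,3) prefix_cat.PSh_homD(3)[OF assms(1)] by (simp add: fibre_arr_def)

lemma app_in_fibre:
  assumes \<alpha>: "\<alpha> \<in> hom (PSh (prefix_cat L)) P Q" and w: "c # w \<in> L" and x: "x \<in> FO (fibre P y c) w"
  shows "app \<alpha> (c # w) x \<in> FO (fibre Q (app \<alpha> [] y) c) w"
  using fibreD[OF w x] prefix_cat.app_in[OF \<alpha>] prefix_cat.app_act[OF \<alpha> root_hom[OF w]] w
  by (auto intro: fibreI)

lemma fibre_arr_hom:
  assumes \<alpha>: "\<alpha> \<in> hom (PSh (prefix_cat L)) P Q"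
  shows "fibre_arr \<alpha> y c \<in> hom (PSh (prefix_cat (branch L c))) (fibre P y c) (fibre Q (app \<alpha> [] y) c)"
proof -
  note P = prefix_cat.PSh_homD(1)[OF \<alpha>] and Q = prefix_cat.PSh_homD(2)[OF \<alpha>]
  show ?thesis
    unfolding fibre_arr_def prefix_cat.PSh_homD(3,4)[OF \<alpha>]
  proof (rule prefix_cat.mk_psh_arr_in[OF fibre_in[OF P] fibre_in[OF Q]])
    show "app \<alpha> (c # w) x \<in> FO (fibre Q (app \<alpha> [] y) c) w"
      if "w \<in> Ob (prefix_cat (branch L c))" "x \<in> FO (fibre P y c) w" for w x
      using app_in_fibre[OF \<alpha>] that by simp
    fix f v w x assume f: "f \<in> hom (prefix_cat (branch L c)) v w" and x: "x \<in> FO (fibre P y c) w"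
    then have w: "c # w \<in> L" by (simp add: prefix_cat_hom_iff)
    show "app \<alpha> (c # v) (act (fibre P y c) f x) =
        act (fibre Q (app \<alpha> [] y) c) f (app \<alpha> (c # w) x)"
      using prefix_cat.app_act[OF \<alpha> Cons_hom[OF f]] fibreD[OF w x]
      by (simp add: act_fibre[OF f x] act_fibre[OF f app_in_fibre[OF \<alpha> w x]])
  qed
qed

definition fibre_functor where
  "fibre_functor =
    (let fibres = (\<lambda>P. (FO P [], \<lambda>y\<in>FO P []. \<lambda>c\<in>I. fibre P y c)) in
    \<lparr>FO = fibres, FA = (\<lambda>\<alpha>. Arrow (fibres (src \<alpha>))
      (\<lambda>y\<in>FO (src \<alpha>) []. app \<alpha> [] y, \<lambda>y\<in>FO (src \<alpha>) []. \<lambda>c\<in>I. fibre_arr \<alpha> y c) (fibres (tgt \<alpha>)))\<rparr>)"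

lemma FO_fibre_functor: "FO fibre_functor P = (FO P [], \<lambda>y\<in>FO P []. \<lambda>c\<in>I. fibre P y c)"
  by (simp add: fibre_functor_def Let_def)

lemma FA_fibre_functor:
  assumes "\<alpha> \<in> hom (PSh (prefix_cat L)) P Q"
  shows "FA fibre_functor \<alpha> = Arrow (FO fibre_functor P)
    (\<lambda>y\<in>FO P []. app \<alpha> [] y, \<lambda>y\<in>FO P []. \<lambda>c\<in>I. fibre_arr \<alpha> y c) (FO fibre_functor Q)"
  using prefix_cat.PSh_homD(3,4)[OF assms] by (simp add: fibre_functor_def Let_def)

lemma fibre_arr_Ide:
  assumes P: "P \<in> Ob (PSh (prefix_cat L))" and y: "y \<in> FO P []"
  shows "fibre_arr (Ide (PSh (prefix_cat L)) P) y c = Ide (PSh (prefix_cat (branch L c))) (fibre P y c)"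
proof (rule prefix_cat.PSh_hom_eqI)
  note Ide = category.ide[OF prefix_cat.category_PSh P]
  show "fibre_arr (Ide (PSh (prefix_cat L)) P) y c \<in>
      hom (PSh (prefix_cat (branch L c))) (fibre P y c) (fibre P y c)"
    using fibre_arr_hom[OF Ide, of y c] prefix_cat.app_Ide[OF _ y, of L] root by simp
  show "Ide (PSh (prefix_cat (branch L c))) (fibre P y c) \<in>
      hom (PSh (prefix_cat (branch L c))) (fibre P y c) (fibre P y c)"
    by (rule category.ide[OF prefix_cat.category_PSh fibre_in[OF P]])
  fix w x assume "w \<in> Ob (prefix_cat (branch L c))" and x: "x \<in> FO (fibre P y c) w"
  then have w: "c # w \<in> L" by simp
  then show "app (fibre_arr (Ide (PSh (prefix_cat L)) P) y c) w x =
      app (Ide (PSh (prefix_cat (branch L c))) (fibre P y c)) w x"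
    using app_fibre_arr[OF Ide w x] fibreD[OF w x] x by simp
qed

lemma fibre_arr_Cmp:
  assumes \<alpha>: "\<alpha> \<in> hom (PSh (prefix_cat L)) P Q" and \<beta>: "\<beta> \<in> hom (PSh (prefix_cat L)) Q R"
    and y: "y \<in> FO P []"
  shows "fibre_arr (Cmp (PSh (prefix_cat L)) \<beta> \<alpha>) y c =
    Cmp (PSh (prefix_cat (branch L c))) (fibre_arr \<beta> (app \<alpha> [] y) c) (fibre_arr \<alpha> y c)"
proof (rule prefix_cat.PSh_hom_eqI)
  note \<beta>\<alpha> = category.cmp[OF prefix_cat.category_PSh \<alpha> \<beta>]
  show "fibre_arr (Cmp (PSh (prefix_cat L)) \<beta> \<alpha>) y c \<in>
      hom (PSh (prefix_cat (branch L c))) (fibre P y c) (fibre R (app \<beta> [] (app \<alpha> [] y)) c)"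
    using fibre_arr_hom[OF \<beta>\<alpha>, of y c] prefix_cat.app_Cmp[OF \<alpha> _ y] root by simp
  show "Cmp (PSh (prefix_cat (branch L c))) (fibre_arr \<beta> (app \<alpha> [] y) c) (fibre_arr \<alpha> y c) \<in>
      hom (PSh (prefix_cat (branch L c))) (fibre P y c) (fibre R (app \<beta> [] (app \<alpha> [] y)) c)"
    by (rule category.cmp[OF prefix_cat.category_PSh fibre_arr_hom[OF \<alpha>] fibre_arr_hom[OF \<beta>]])
  fix w x assume w': "w \<in> Ob (prefix_cat (branch L c))" and x: "x \<in> FO (fibre P y c) w"
  then have w: "c # w \<in> L" by simp
  show "app (fibre_arr (Cmp (PSh (prefix_cat L)) \<beta> \<alpha>) y c) w x =
      app (Cmp (PSh (prefix_cat (branch L c))) (fibre_arr \<beta> (app \<alpha> [] y) c) (fibre_arr \<alpha> y c)) w x"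
    using prefix_cat.app_Cmp[OF \<alpha>, of "c # w" x] w fibreD[OF w x]
    by (simp add: app_fibre_arr[OF \<beta>\<alpha> w x] app_fibre_arr[OF \<alpha> w x]
        prefix_cat.app_Cmp[OF fibre_arr_hom[OF \<alpha>] w' x] app_fibre_arr[OF \<beta> w app_in_fibre[OF \<alpha> w x]])
qed

lemma is_functor_fibre_functor: "is_functor (PSh (prefix_cat L)) (Fam Branches) fibre_functor"
proof (rule is_functorI)
  fix P :: "('l, 'u) word_psh"
  assume P: "P \<in> Ob (PSh (prefix_cat L))"
  show "FO fibre_functor P \<in> Ob (Fam Branches)"
    using fibre_in[OF P] by (auto simp: FO_fibre_functor Fam_simps product_cat_simps)
  show "FA fibre_functor (Ide (PSh (prefix_cat L)) P) = Ide (Fam Branches) (FO fibre_functor P)"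
    using fibre_arr_Ide[OF P] root
    by (auto simp: FO_fibre_functor FA_fibre_functor[OF category.ide[OF prefix_cat.category_PSh P]]
        Fam_simps product_cat_simps fun_eq_iff)
next
  fix \<alpha> and P Q :: "('l, 'u) word_psh"
  assume \<alpha>: "\<alpha> \<in> hom (PSh (prefix_cat L)) P Q"
  note P = prefix_cat.PSh_homD(1)[OF \<alpha>] and Q = prefix_cat.PSh_homD(2)[OF \<alpha>]
  show "FA fibre_functor \<alpha> \<in> hom (Fam Branches) (FO fibre_functor P) (FO fibre_functor Q)"
    using fibre_in[OF P] fibre_in[OF Q] fibre_arr_hom[OF \<alpha>] prefix_cat.app_in[OF \<alpha>] root
    by (auto simp: FO_fibre_functor FA_fibre_functor[OF \<alpha>] Fam_hom_iff product_cat_simps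
        product_cat_hom_iff)
next
  fix \<alpha> \<beta> and P Q R :: "('l, 'u) word_psh"
  assume \<alpha>: "\<alpha> \<in> hom (PSh (prefix_cat L)) P Q" and \<beta>: "\<beta> \<in> hom (PSh (prefix_cat L)) Q R"
  note \<beta>\<alpha> = category.cmp[OF prefix_cat.category_PSh \<alpha> \<beta>]
  show "FA fibre_functor (Cmp (PSh (prefix_cat L)) \<beta> \<alpha>) =
      Cmp (Fam Branches) (FA fibre_functor \<beta>) (FA fibre_functor \<alpha>)"
    using prefix_cat.app_in[OF \<alpha>] prefix_cat.app_Cmp[OF \<alpha>] fibre_arr_Cmp[OF \<alpha> \<beta>] root
    by (auto simp: FO_fibre_functor FA_fibre_functor[OF \<alpha>] FA_fibre_functor[OF \<beta>]
        FA_fibre_functor[OF \<beta>\<alpha>] Fam_simps product_cat_simps fun_eq_iff compose_def)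
qed

lemma fibre_functor_faithful:
  assumes \<alpha>: "\<alpha> \<in> hom (PSh (prefix_cat L)) P Q" and \<beta>: "\<beta> \<in> hom (PSh (prefix_cat L)) P Q"
    and eq: "FA fibre_functor \<alpha> = FA fibre_functor \<beta>"
  shows "\<alpha> = \<beta>"
proof (rule prefix_cat.PSh_hom_eqI[OF \<alpha> \<beta>])
  have on_root: "(\<lambda>y\<in>FO P []. app \<alpha> [] y) = (\<lambda>y\<in>FO P []. app \<beta> [] y)"
    and on_fibres: "(\<lambda>y\<in>FO P []. \<lambda>c\<in>I. fibre_arr \<alpha> y c) = (\<lambda>y\<in>FO P []. \<lambda>c\<in>I. fibre_arr \<beta> y c)"
    using eq by (auto simp: FA_fibre_functor[OF \<alpha>] FA_fibre_functor[OF \<beta>])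
  fix w x assume "w \<in> Ob (prefix_cat L)" and x: "x \<in> FO P w"
  then have w: "w \<in> L" by simp
  show "app \<alpha> w x = app \<beta> w x"
  proof (cases w)
    case Nil
    then show ?thesis using fun_cong[OF on_root, of x] x by simp
  next
    case (Cons c v)
    let ?y = "act P ([], w) x"
    have c: "c \<in> I" "c # v \<in> L" using heads w Cons by auto
    have y: "?y \<in> FO P []" by (rule act_root[OF prefix_cat.PSh_homD(1)[OF \<alpha>] w x])
    have x': "x \<in> FO (fibre P ?y c) v" using c x Cons by (auto intro: fibreI)
    show ?thesis
      using app_fibre_arr[OF \<alpha> c(2) x'] app_fibre_arr[OF \<beta> c(2) x'] Cons c(1) y
        fun_cong[OF fun_cong[OF on_fibres, of ?y], of c] by simp
  qed
qed

definition glue where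
  "glue P u v w x = (case w of [] \<Rightarrow> u x | c # w' \<Rightarrow> app (v (act P ([], w) x) c) w' x)"

lemma glue_simps [simp]:
  "glue P u v [] x = u x" "glue P u v (c # w) x = app (v (act P ([], c # w) x) c) w x"
  by (simp_all add: glue_def)

lemma glue_in_fibre:
  assumes P: "P \<in> Ob (PSh (prefix_cat L))"
    and v: "\<And>y c. y \<in> FO P [] \<Longrightarrow> c \<in> I \<Longrightarrow>
      v y c \<in> hom (PSh (prefix_cat (branch L c))) (fibre P y c) (fibre Q (u y) c)"
    and w: "c # w \<in> L" and x: "x \<in> FO P (c # w)"
  shows "glue P u v (c # w) x \<in> FO (fibre Q (u (act P ([], c # w) x)) c) w"
  using prefix_cat.app_in[OF v[OF act_root[OF P w x] heads[OF w]]] w x by (auto intro: fibreI)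

lemma glue_act:
  assumes P: "P \<in> Ob (PSh (prefix_cat L))" and Q: "Q \<in> Ob (PSh (prefix_cat L))"
    and u: "\<And>y. y \<in> FO P [] \<Longrightarrow> u y \<in> FO Q []"
    and v: "\<And>y c. y \<in> FO P [] \<Longrightarrow> c \<in> I \<Longrightarrow>
      v y c \<in> hom (PSh (prefix_cat (branch L c))) (fibre P y c) (fibre Q (u y) c)"
    and f: "(w', w) \<in> hom (prefix_cat L) w' w" and x: "x \<in> FO P w"
  shows "glue P u v w' (act P (w', w) x) = act Q (w', w) (glue P u v w x)"
proof -
  have w: "w' \<in> L" "w \<in> L" and pre: "prefix w' w" using f by (auto simp: prefix_cat_hom_iff)
  have in_fibre: "glue P u v (c # z) x \<in> FO (fibre Q (u (act P ([], c # z) x)) c) z"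
    if "c # z \<in> L" "x \<in> FO P (c # z)" for c z
    by (rule glue_in_fibre[OF P _ that]) (rule v)
  consider "w' = []" "w = []" | c z where "w' = []" "w = c # z"
    | c z' z where "w' = c # z'" "w = c # z" "prefix z' z"
    using pre by (cases w'; cases w) auto
  then show ?thesis
  proof cases
    case 1
    then show ?thesis
      using x u[of x] prefix_cat.act_Ide[OF P, of "[]"] prefix_cat.act_Ide[OF Q, of "[]"] root
      by simp
  next
    case (2 c z)
    then have "c # z \<in> L" "x \<in> FO P (c # z)" using w x by simp_all
    from fibreD[OF this(1) in_fibre[OF this]] 2 show ?thesis by simp
  next
    case (3 c z' z)
    have c: "c \<in> I" and f': "(z', z) \<in> hom (prefix_cat (branch L c)) z' z"
      using heads w 3 by (auto simp: prefix_cat_hom_iff)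
    let ?y = "act P ([], w) x"
    have x': "x \<in> FO (fibre P ?y c) z" using w x 3 by (auto intro: fibreI)
    have "glue P u v w' (act P (w', w) x) = app (v ?y c) z' (act (fibre P ?y c) (z', z) x)"
      using act_root_act[OF P f x] act_fibre[OF f' x'] 3 by simp
    also have "\<dots> = act (fibre Q (u ?y) c) (z', z) (app (v ?y c) z x)"
      by (rule prefix_cat.app_act[OF v[OF act_root[OF P w(2) x] c] f' x'])
    also have "\<dots> = act Q (w', w) (glue P u v w x)"
      using act_fibre[OF f'] in_fibre[of c z] w x 3 by simp
    finally show ?thesis .
  qed
qed

lemma glue_hom:
  assumes P: "P \<in> Ob (PSh (prefix_cat L))" and Q: "Q \<in> Ob (PSh (prefix_cat L))"
    and u: "\<And>y. y \<in> FO P [] \<Longrightarrow> u y \<in> FO Q []"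
    and v: "\<And>y c. y \<in> FO P [] \<Longrightarrow> c \<in> I \<Longrightarrow>
      v y c \<in> hom (PSh (prefix_cat (branch L c))) (fibre P y c) (fibre Q (u y) c)"
  shows "mk_psh_arr (prefix_cat L) P (glue P u v) Q \<in> hom (PSh (prefix_cat L)) P Q"
proof (rule prefix_cat.mk_psh_arr_in[OF P Q])
  show "glue P u v w x \<in> FO Q w" if "w \<in> Ob (prefix_cat L)" "x \<in> FO P w" for w x
  proof (cases w)
    case Nil
    then show ?thesis using that u by simp
  next
    case (Cons c z)
    then have cz: "c # z \<in> L" and x: "x \<in> FO P (c # z)" using that by simp_all
    have "glue P u v (c # z) x \<in> FO (fibre Q (u (act P ([], c # z) x)) c) z"
      by (rule glue_in_fibre[OF P _ cz x]) (rule v)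
    from fibreD[OF cz this] show ?thesis using Cons by simp
  qed
  show "glue P u v w' (act P f x) = act Q f (glue P u v w x)"
    if "f \<in> hom (prefix_cat L) w' w" "x \<in> FO P w" for f w' w x
    using glue_act[OF P Q u v _ that(2)] that(1) by (simp add: prefix_cat_hom_iff)
qed

lemma fibre_functor_full:
  assumes P: "P \<in> Ob (PSh (prefix_cat L))" and Q: "Q \<in> Ob (PSh (prefix_cat L))"
    and g: "g \<in> hom (Fam Branches) (FO fibre_functor P) (FO fibre_functor Q)"
  shows "\<exists>\<alpha>\<in>hom (PSh (prefix_cat L)) P Q. FA fibre_functor \<alpha> = g"
proof -
  obtain u v where g_eq: "g = Arrow (FO fibre_functor P) (u, v) (FO fibre_functor Q)"
    and u: "u \<in> FO P [] \<rightarrow>\<^sub>E FO Q []" and v_ext: "v \<in> extensional (FO P [])"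
    and v_hom: "\<And>y. y \<in> FO P [] \<Longrightarrow> v y \<in> hom Branches (\<lambda>c\<in>I. fibre P y c) (\<lambda>c\<in>I. fibre Q (u y) c)"
    using g unfolding FO_fibre_functor by (auto simp: Fam_hom_iff PiE_iff)
  have v: "v y c \<in> hom (PSh (prefix_cat (branch L c))) (fibre P y c) (fibre Q (u y) c)"
    if "y \<in> FO P []" "c \<in> I" for y c
    using v_hom[OF that(1)] that(2) by (auto simp: product_cat_hom_iff)
  define \<alpha> where "\<alpha> = mk_psh_arr (prefix_cat L) P (glue P u v) Q"
  have \<alpha>: "\<alpha> \<in> hom (PSh (prefix_cat L)) P Q"
    unfolding \<alpha>_def by (rule glue_hom[OF P Q]) (use u v in auto)
  have app_\<alpha>: "app \<alpha> w x = glue P u v w x" if "w \<in> L" "x \<in> FO P w" for w x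
    using that by (simp add: \<alpha>_def)
  have "fibre_arr \<alpha> y c = v y c" if y: "y \<in> FO P []" and c: "c \<in> I" for y c
  proof (rule prefix_cat.PSh_hom_eqI[OF _ v[OF y c]])
    show "fibre_arr \<alpha> y c \<in> hom (PSh (prefix_cat (branch L c))) (fibre P y c) (fibre Q (u y) c)"
      using fibre_arr_hom[OF \<alpha>, of y c] app_\<alpha>[OF root y] by simp
    fix w x assume "w \<in> Ob (prefix_cat (branch L c))" and x: "x \<in> FO (fibre P y c) w"
    then show "app (fibre_arr \<alpha> y c) w x = app (v y c) w x"
      using app_fibre_arr[OF \<alpha> _ x] app_\<alpha>[of "c # w" x] fibreD[OF _ x] by simp
  qed
  then have "(\<lambda>y\<in>FO P []. \<lambda>c\<in>I. fibre_arr \<alpha> y c) = v"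
    using v_ext v_hom by (intro extensionalityI[OF _ v_ext])
      (auto simp: product_cat_hom_iff intro!: extensionalityI[of _ I])
  moreover have "(\<lambda>y\<in>FO P []. app \<alpha> [] y) = u"
    using u app_\<alpha>[OF root] by (auto simp: fun_eq_iff restrict_def PiE_iff extensional_def)
  ultimately have "FA fibre_functor \<alpha> = g" by (simp add: FA_fibre_functor[OF \<alpha>] g_eq)
  then show ?thesis using \<alpha> by blast
qed

end

subsection \<open>Grafting a family of presheaves onto a root\<close>

definition pairing :: "'u \<times> 'u \<Rightarrow> 'u::infinite" where
  "pairing = (SOME f. inj f)"

lemma inj_pairing: "inj (pairing :: 'u \<times> 'u \<Rightarrow> 'u::infinite)"
proof -
  have "\<exists>f. bij_betw f (UNIV \<times> UNIV :: ('u \<times> 'u) set) (UNIV :: 'u set)"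
    unfolding card_of_ordIso by (rule card_of_Times_same_infinite) (rule infinite_UNIV)
  then have "\<exists>f :: 'u \<times> 'u \<Rightarrow> 'u. inj f" by (auto simp: bij_betw_def)
  then show ?thesis unfolding pairing_def by (rule someI_ex)
qed

lemma inv_pairing [simp]: "inv pairing (pairing z) = z"
  by (rule inv_f_f[OF inj_pairing])

fun graft_Ob :: "'u set \<Rightarrow> ('u \<Rightarrow> 'l \<Rightarrow> ('l, 'u) word_psh) \<Rightarrow>
    'l list \<Rightarrow> 'u::infinite set" where
  "graft_Ob Y p [] = Y"
| "graft_Ob Y p (c # w) = pairing ` (SIGMA y : Y. FO (p y c) w)"

fun graft_act :: "('u \<Rightarrow> 'l \<Rightarrow> ('l, 'u) word_psh) \<Rightarrow>
    'l list \<times> 'l list \<Rightarrow> 'u \<Rightarrow> 'u::infinite" where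
  "graft_act p (v, []) x = x"
| "graft_act p ([], c # w) x = fst (inv pairing x)"
| "graft_act p (b # v, c # w) x =
    (let (y, z) = inv pairing x in pairing (y, act (p y c) (v, w) z))"

definition graft where
  "graft L Y p = mk_psh (prefix_cat L) (graft_Ob Y p) (graft_act p)"

context rooted_words
begin

lemma graft_in:
  assumes p: "\<And>y c. y \<in> Y \<Longrightarrow> c \<in> I \<Longrightarrow> p y c \<in> Ob (PSh (prefix_cat (branch L c)))"
  shows "graft L Y p \<in> Ob (PSh (prefix_cat L))"
  unfolding graft_def
proof (rule prefix_cat.mk_psh_in)
  have Cons_hom_branch: "c \<in> I" "(v, w) \<in> hom (prefix_cat (branch L c)) v w"
    if "f \<in> hom (prefix_cat L) (b # v) (c # w)" for f b c v w
    using that heads by (auto simp: prefix_cat_hom_iff)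
  show "graft_act p f x \<in> graft_Ob Y p v"
    if f: "f \<in> hom (prefix_cat L) v w" and x: "x \<in> graft_Ob Y p w" for f v w x
  proof -
    have f_eq: "f = (v, w)" and pre: "prefix v w" using f by (auto simp: prefix_cat_hom_iff)
    show ?thesis
      using f x pre prefix_cat.act_in[OF p Cons_hom_branch(2)] Cons_hom_branch(1)
      unfolding f_eq by (cases w; cases v) auto
  qed
  show "graft_act p (Ide (prefix_cat L) w) x = x"
    if "w \<in> Ob (prefix_cat L)" "x \<in> graft_Ob Y p w" for w x
    using that heads prefix_cat.act_Ide[OF p] by (cases w) auto
  show "graft_act p (Cmp (prefix_cat L) g f) x = graft_act p f (graft_act p g x)"
    if f: "f \<in> hom (prefix_cat L) u v" and g: "g \<in> hom (prefix_cat L) v w"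
      and x: "x \<in> graft_Ob Y p w" for f g u v w x
  proof -
    have eqs: "f = (u, v)" "g = (v, w)" and pre: "prefix u v" "prefix v w"
      using f g by (auto simp: prefix_cat_hom_iff)
    show ?thesis
      using f g x pre prefix_cat.act_Cmp[OF p Cons_hom_branch(2) Cons_hom_branch(2)] Cons_hom_branch(1)
      unfolding eqs by (cases w; cases v; cases u) auto
  qed
qed

lemma FO_graft: "w \<in> L \<Longrightarrow> FO (graft L Y p) w = graft_Ob Y p w"
  by (simp add: graft_def)

lemma act_graft:
  "f \<in> hom (prefix_cat L) v w \<Longrightarrow> x \<in> graft_Ob Y p w \<Longrightarrow> act (graft L Y p) f x = graft_act p f x"
  by (simp add: graft_def prefix_cat.act_mk_psh)

lemma FO_fibre_graft:
  assumes "c # w \<in> L" "y \<in> Y"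
  shows "FO (fibre (graft L Y p) y c) w = (\<lambda>z. pairing (y, z)) ` FO (p y c) w"
  using assms act_graft[OF root_hom[OF assms(1)], of _ Y p]
  by (auto simp: FO_fibre[OF assms(1)] FO_graft[OF assms(1)])

definition ungraft where
  "ungraft Y p y c = mk_psh_arr (prefix_cat (branch L c)) (fibre (graft L Y p) y c)
    (\<lambda>w x. snd (inv pairing x)) (p y c)"

lemma
  assumes p: "\<And>y c. y \<in> Y \<Longrightarrow> c \<in> I \<Longrightarrow> p y c \<in> Ob (PSh (prefix_cat (branch L c)))"
    and y: "y \<in> Y" and c: "c \<in> I"
  shows ungraft_hom: "ungraft Y p y c \<in>
      hom (PSh (prefix_cat (branch L c))) (fibre (graft L Y p) y c) (p y c)"
    and ungraft_iso: "is_iso (PSh (prefix_cat (branch L c))) (ungraft Y p y c)"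
proof -
  let ?G = "graft L Y p" and ?W = "prefix_cat (branch L c)"
  note FO = FO_fibre_graft[OF _ y, of c _ p]
  show hom: "ungraft Y p y c \<in> hom (PSh ?W) (fibre ?G y c) (p y c)"
    unfolding ungraft_def
  proof (rule prefix_cat.mk_psh_arr_in[OF fibre_in[OF graft_in[OF p]] p[OF y c]])
    fix f v w x assume f: "f \<in> hom ?W v w" and x: "x \<in> FO (fibre ?G y c) w"
    have f_eq: "f = (v, w)" and w: "c # w \<in> L" using f by (auto simp: prefix_cat_hom_iff)
    then obtain z where z: "x = pairing (y, z)" "z \<in> FO (p y c) w" using x FO by auto
    then show "snd (inv pairing (act (fibre ?G y c) f x)) = act (p y c) f (snd (inv pairing x))"
      unfolding act_fibre[OF f x] using act_graft[OF Cons_hom[OF f], of x Y p] y by (auto simp: f_eq)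
  qed (use FO in auto)
  show "is_iso (PSh ?W) (ungraft Y p y c)"
  proof (rule prefix_cat.PSh_is_isoI[OF hom])
    fix w assume "w \<in> Ob ?W"
    then have w: "c # w \<in> L" by simp
    show "bij_betw (app (ungraft Y p y c) w) (FO (fibre ?G y c) w) (FO (p y c) w)"
      by (rule bij_betw_byWitness[where f' = "\<lambda>z. pairing (y, z)"])
        (auto simp: ungraft_def FO[OF w] w)
  qed
qed

lemma fibre_functor_ess_surj:
  fixes B :: "('u::infinite, 'l \<Rightarrow> ('l, 'u) word_psh) fam"
  assumes B: "B \<in> Ob (Fam Branches)"
  shows "\<exists>P\<in>Ob (PSh (prefix_cat L)). \<exists>e\<in>hom (Fam Branches) (FO fibre_functor P) B.
    is_iso (Fam Branches) e"
proof -
  obtain Y p where B_eq: "B = (Y, p)" and p_prod: "p \<in> Y \<rightarrow>\<^sub>E Ob Branches"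
    using B by (auto simp: Fam_simps)
  have p: "p y c \<in> Ob (PSh (prefix_cat (branch L c)))" if "y \<in> Y" "c \<in> I" for y c
    using p_prod that by (auto simp: product_cat_simps PiE_iff)
  let ?G = "graft L Y p"
  note G = graft_in[OF p]
  have FO_G: "FO fibre_functor ?G = (Y, \<lambda>y\<in>Y. \<lambda>c\<in>I. fibre ?G y c)"
    by (simp add: FO_fibre_functor FO_graft[OF root])
  have hom: "(\<lambda>c\<in>I. ungraft Y p y c) \<in> hom Branches (\<lambda>c\<in>I. fibre ?G y c) (p y)" if "y \<in> Y" for y
    using ungraft_hom[OF p that] p_prod that
    by (auto simp: product_cat_hom_iff product_cat_simps PiE_iff)
  let ?e = "Arrow (FO fibre_functor ?G) (\<lambda>y\<in>Y. y, \<lambda>y\<in>Y. \<lambda>c\<in>I. ungraft Y p y c) B"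
  have e: "?e \<in> hom (Fam Branches) (FO fibre_functor ?G) B"
    using p_prod hom fibre_in[OF G] by (auto simp: FO_G B_eq Fam_hom_iff product_cat_simps)
  moreover have "is_iso (Fam Branches) ?e"
    unfolding FO_G B_eq
  proof (rule Fam_is_iso[OF category_Branches])
    fix y assume y: "y \<in> Y"
    have "is_iso Branches (\<lambda>c\<in>I. ungraft Y p y c)"
      by (rule product_cat_is_iso[OF prefix_cat.category_PSh hom[OF y]])
        (use ungraft_iso[OF p y] in auto)
    then show "is_iso Branches ((\<lambda>y\<in>Y. \<lambda>c\<in>I. ungraft Y p y c) y)" using y by simp
  qed (use e in \<open>simp add: FO_G B_eq\<close>)
  ultimately show ?thesis using G by (intro bexI[of _ ?G] bexI[of _ ?e])
qed

theorem PSh_equivalent_Fam: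
  "equivalent_categories
    (PSh (prefix_cat L) :: (('l, 'u::infinite) word_psh, _) cat)
    (Fam Branches :: (('u, 'l \<Rightarrow> ('l, 'u) word_psh) fam, _) cat)"
proof (rule is_equivalence_imp_equivalent[OF prefix_cat.category_PSh category_Fam[OF category_Branches]])
  let ?V = "PSh (prefix_cat L) :: (('l, 'u) word_psh, _) cat"
  have "fully_faithful ?V (Fam Branches) fibre_functor"
    by (rule fully_faithfulI[OF is_functor_fibre_functor fibre_functor_faithful fibre_functor_full])
  moreover have "essentially_surjective ?V (Fam Branches) fibre_functor"
    unfolding essentially_surjective_def by (intro ballI fibre_functor_ess_surj)
  moreover have "is_functor ?V (Fam Branches) fibre_functor" by (rule is_functor_fibre_functor)
  ultimately show "is_equivalence ?V (Fam Branches) fibre_functor" by (simp add: is_equivalence_def)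
qed

end

section \<open>The base category\<close>

fun src_arity :: "bobj \<Rightarrow> nat" where
  "src_arity (Tick n) = n" | "src_arity (ParaL n) = n" | "src_arity (ParaR n) = n"
| "src_arity (Nu n) = n" | "src_arity (IotaP n i) = n" | "src_arity (IotaM n i) = n" | "src_arity _ = 0"

fun tgt_arity :: "bobj \<Rightarrow> nat" where
  "tgt_arity (Nu n) = Suc n" | "tgt_arity c = src_arity c"

lemma st_obj_arities: "st_obj c n n' \<Longrightarrow> n = src_arity c \<and> n' = tgt_arity c"
  by (induction rule: st_obj.induct) auto

lemma st_obj_arity_le: "st_obj c n n' \<Longrightarrow> n \<le> n'"
  by (induction rule: st_obj.induct) auto

fun gen_src :: "gen \<Rightarrow> bobj" where
  "gen_src (Gd n i) = Star"
| "gen_src (Gs c) = Pl (src_arity c)" | "gen_src (Gt c) = Pl (tgt_arity c)"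
| "gen_src (Gl n) = ParaL n" | "gen_src (Gr n) = ParaR n"
| "gen_src (Geps n i m j) = IotaP n i" | "gen_src (Grho n i m j) = IotaM m j"

fun gen_tgt :: "gen \<Rightarrow> bobj" where
  "gen_tgt (Gd n i) = Pl n" | "gen_tgt (Gs c) = c" | "gen_tgt (Gt c) = c"
| "gen_tgt (Gl n) = Para n" | "gen_tgt (Gr n) = Para n"
| "gen_tgt (Geps n i m j) = Tau n i m j" | "gen_tgt (Grho n i m j) = Tau n i m j"

lemma edge_gen_src_tgt: "edge a g b \<Longrightarrow> a = gen_src g \<and> b = gen_tgt g"
  by (induction rule: edge.induct) (auto dest: st_obj_arities)

lemmas edge_d = edge.intros(1) and edge_s = edge.intros(2) and edge_t = edge.intros(3)

lemma st_obj_bobjs: "st_obj c n n' \<Longrightarrow> c \<in> bobjs"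
  by (induction rule: st_obj.induct) (auto simp: bobjs_def)

lemma bobjs_simps [simp]:
  "Star \<in> bobjs" "Pl n \<in> bobjs" "Tick n \<in> bobjs" "ParaL n \<in> bobjs" "ParaR n \<in> bobjs"
  "Nu n \<in> bobjs" "Para n \<in> bobjs"
  "IotaP n i \<in> bobjs \<longleftrightarrow> i \<in> {1..n}" "IotaM n i \<in> bobjs \<longleftrightarrow> i \<in> {1..n}"
  "Tau n i m j \<in> bobjs \<longleftrightarrow> i \<in> {1..n} \<and> j \<in> {1..m}"
  by (auto simp: bobjs_def)

lemma edge_bobjs: "edge a g b \<Longrightarrow> a \<in> bobjs \<and> b \<in> bobjs"
  by (induction rule: edge.induct) (auto dest: st_obj_bobjs)

lemma bpath_bobjs: "bpath a p b \<Longrightarrow> a \<in> bobjs \<and> b \<in> bobjs"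
  by (induction rule: bpath.induct) (auto dest: edge_bobjs)

lemma bpath_Nil [simp]: "bpath a [] b \<longleftrightarrow> a = b \<and> a \<in> bobjs"
  by (auto elim: bpath.cases intro: bpath.intros)

lemma bpath_Cons: "bpath a (g # p) b \<longleftrightarrow> edge a g (gen_tgt g) \<and> bpath (gen_tgt g) p b"
proof
  assume "bpath a (g # p) b"
  then show "edge a g (gen_tgt g) \<and> bpath (gen_tgt g) p b"
    by cases (use edge_gen_src_tgt in blast)
qed (auto intro: bpath.intros)

lemma bpath_append: "bpath a (p @ q) c \<longleftrightarrow> (\<exists>b. bpath a p b \<and> bpath b q c)"
  by (induction p arbitrary: a) (auto simp: bpath_Cons dest: bpath_bobjs)

lemma bpath_edge: "edge a g b \<Longrightarrow> bpath a [g] b"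
  using edge_gen_src_tgt edge_bobjs by (auto simp: bpath_Cons)

lemma brel_bpath: "brel u v \<Longrightarrow> \<exists>a b. bpath a u b \<and> bpath a v b"
proof (induction rule: brel.induct)
  case (1 c n n' i)
  then show ?case using st_obj_arity_le[OF 1(1)] st_obj_bobjs[OF 1(1)]
      edge_d[of i n] edge_d[of i n'] edge_s[OF 1(1)] edge_t[OF 1(1)]
    by (intro exI[of _ Star] exI[of _ c]) (auto simp: bpath_Cons)
next
  case (2 n)
  then show ?case
    using edge.intros(4,5)[of n] edge_s[OF st_obj.intros(2)[of n]]
        edge_s[OF st_obj.intros(3)[of n]]
    by (intro exI[of _ "Pl n"] exI[of _ "Para n"]) (auto simp: bpath_Cons)
next
  case (3 i n j m)
  then show ?case
    using edge.intros(6,7)[OF 3] edge_d[OF 3(1)] edge_d[OF 3(2)]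
      edge_s[OF st_obj.intros(5)[OF 3(1)]] edge_s[OF st_obj.intros(6)[OF 3(2)]]
    by (intro exI[of _ Star] exI[of _ "Tau n i m j"]) (auto simp: bpath_Cons)
qed

lemma bpath_unique: "bpath a p b \<Longrightarrow> bpath a' p b' \<Longrightarrow> p \<noteq> [] \<Longrightarrow> a = a' \<and> b = b'"
proof (induction p arbitrary: a a')
  case (Cons g p)
  then have "edge a g (gen_tgt g)" "edge a' g (gen_tgt g)" by (auto simp: bpath_Cons)
  then have "a = a'" by (metis edge_gen_src_tgt)
  moreover have "b = b'" using Cons by (cases "p = []") (auto simp: bpath_Cons)
  ultimately show ?case by simp
qed simp

lemma brel_length: "brel u v \<Longrightarrow> 2 \<le> length u \<and> length v = length u"
  by (induction rule: brel.induct) auto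

lemma brel_bpath_iff:
  assumes "brel u v"
  shows "bpath a u b \<longleftrightarrow> bpath a v b"
proof -
  obtain a' b' where uv: "bpath a' u b'" "bpath a' v b'" using brel_bpath[OF assms] by blast
  have ne: "u \<noteq> []" "v \<noteq> []" using brel_length[OF assms] by auto
  show ?thesis using uv bpath_unique[OF _ uv(1) ne(1)] bpath_unique[OF _ uv(2) ne(2)] by blast
qed

lemma bcong_bpath: "bcong p q \<Longrightarrow> bpath a p b \<longleftrightarrow> bpath a q b"
proof (induction rule: bcong.induct)
  case (bcong_rel u v p q)
  show ?case unfolding bpath_append brel_bpath_iff[OF bcong_rel] ..
qed simp_all

lemma bcong_length: "bcong p q \<Longrightarrow> length p = length q \<and> (length p < 2 \<longrightarrow> p = q)"
proof (induction rule: bcong.induct)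
  case (bcong_rel u v p q)
  then show ?case using brel_length[OF bcong_rel] by simp
next
  case (bcong_sym p q)
  then show ?case by metis
next
  case (bcong_trans p q r)
  then show ?case by metis
qed simp

lemma bcong_context: "bcong p q \<Longrightarrow> bcong (u @ p @ v) (u @ q @ v)"
proof (induction rule: bcong.induct)
  case (bcong_rel x y p q)
  then show ?case using bcong.bcong_rel[of x y "u @ p" "q @ v"] by simp
qed (blast intro: bcong.intros)+

lemma bcong_append: "bcong p p' \<Longrightarrow> bcong q q' \<Longrightarrow> bcong (p @ q) (p' @ q')"
  using bcong_context[of p p' "[]" q] bcong_context[of q q' p' "[]"] by (auto intro: bcong_trans)

lemma barrow_eq_iff: "barrow a p b = barrow a' q b' \<longleftrightarrow> a = a' \<and> b = b' \<and> bcong p q"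
  unfolding barrow_def by (auto intro: bcong.intros)

lemma Base_simps [simp]:
  "Ob Base = bobjs" "Dom Base = src" "Cod Base = tgt" "Ide Base a = barrow a [] a"
  by (simp_all add: Base_def)

lemma src_barrow [simp]: "src (barrow a p b) = a" and tgt_barrow [simp]: "tgt (barrow a p b) = b"
  by (simp_all add: barrow_def)

lemma hom_Base_iff: "f \<in> hom Base a b \<longleftrightarrow> (\<exists>p. f = barrow a p b \<and> bpath a p b)"
  by (auto simp: hom_def) (auto simp: Base_def)

lemma barrow_hom: "bpath a p b \<Longrightarrow> barrow a p b \<in> hom Base a b"
  by (auto simp: hom_Base_iff)

lemma Cmp_barrow [simp]: "Cmp Base (barrow b q c) (barrow a p b') = barrow a (p @ q) c"
  unfolding Base_def by (auto simp: barrow_def intro: bcong.intros bcong_append)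

interpretation Base: category Base
proof
  fix f assume "f \<in> Arr Base"
  then show "Dom Base f \<in> Ob Base \<and> Cod Base f \<in> Ob Base"
    using bpath_bobjs by (auto simp: Base_def)
next
  fix f a b g c assume "f \<in> hom Base a b" "g \<in> hom Base b c"
  then obtain p q where pq: "f = barrow a p b" "g = barrow b q c"
    and path: "bpath a p b" "bpath b q c"
    by (auto simp: hom_Base_iff)
  then have "bpath a (p @ q) c" by (auto simp: bpath_append)
  then show "Cmp Base g f \<in> hom Base a c" unfolding pq Cmp_barrow by (rule barrow_hom)
qed (auto simp: hom_Base_iff barrow_eq_iff bpath_append intro: bcong.intros)

interpretation Chat: category Chat
  unfolding Chat_def by (rule Base.category_PSh)

lemmas Chat_act_in = Base.act_in[folded Chat_def]
lemmas Chat_act_Ide = Base.act_Ide[folded Chat_def]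
lemmas Chat_act_Cmp = Base.act_Cmp[folded Chat_def]
lemmas Chat_app_in = Base.app_in[folded Chat_def, simplified Base_simps]
lemmas Chat_app_act = Base.app_act[folded Chat_def]
lemmas Chat_app_Cmp = Base.app_Cmp[folded Chat_def, simplified Base_simps]
lemmas Chat_app_Ide = Base.app_Ide[folded Chat_def, simplified Base_simps]
lemmas Chat_hom_eqI = Base.PSh_hom_eqI[folded Chat_def, simplified Base_simps]
lemmas Chat_is_isoI = Base.PSh_is_isoI[folded Chat_def, simplified Base_simps]

lemma Chat_Dom [simp]: "Dom Chat = src" and Chat_Cod [simp]: "Cod Chat = tgt"
  by (simp_all add: Chat_def functor_cat_simps)

lemma Chat_homD:
  assumes "\<alpha> \<in> hom Chat X Y"
  shows "\<alpha> \<in> Arr Chat" "src \<alpha> = X" "tgt \<alpha> = Y" "X \<in> Ob Chat" "Y \<in> Ob Chat"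
  using homD[OF assms] Chat.hom_Ob[OF assms] by simp_all

lemma Chat_Arr_hom: "\<alpha> \<in> Arr Chat \<Longrightarrow> \<alpha> \<in> hom Chat (src \<alpha>) (tgt \<alpha>)"
  using Arr_hom[of \<alpha> Chat] by simp

lemma Chat_iso_hom: "is_iso Chat x \<Longrightarrow> x \<in> hom Chat (src x) (tgt x)"
  by (simp add: is_iso_def Chat_Arr_hom)

definition gen_act :: "'u psh \<Rightarrow> gen \<Rightarrow> 'u \<Rightarrow> 'u" where
  "gen_act X g = act X (barrow (gen_src g) [g] (gen_tgt g))"

lemma act_generator: "edge a g b \<Longrightarrow> act X (barrow a [g] b) = gen_act X g"
  using edge_gen_src_tgt by (auto simp: gen_act_def)

lemma gen_act_in: "X \<in> Ob Chat \<Longrightarrow> edge a g b \<Longrightarrow> x \<in> FO X b \<Longrightarrow> gen_act X g x \<in> FO X a"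
  using Chat_act_in[OF _ barrow_hom[OF bpath_edge]] by (simp add: act_generator)

lemma act_Cons_path:
  assumes "X \<in> Ob Chat" "bpath a (g # p) b" "x \<in> FO X b"
  shows "act X (barrow a (g # p) b) x = gen_act X g (act X (barrow (gen_tgt g) p b) x)"
  using assms Chat_act_Cmp[OF assms(1) barrow_hom[OF bpath_edge[of a g "gen_tgt g"]]
      barrow_hom[of "gen_tgt g" p b] assms(3)]
  by (auto simp: bpath_Cons act_generator)

lemma gen_act_channel:
  assumes X: "X \<in> Ob Chat" and st: "st_obj c n n'" and i: "i \<in> {1..n}" and x: "x \<in> FO X c"
  shows "gen_act X (Gd n i) (gen_act X (Gs c) x) = gen_act X (Gd n' i) (gen_act X (Gt c) x)"
proof -
  have i': "i \<in> {1..n'}" using i st_obj_arity_le[OF st] by auto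
  have paths: "bpath Star [Gd n i, Gs c] c" "bpath Star [Gd n' i, Gt c] c"
    using edge_d[OF i] edge_d[OF i'] edge_s[OF st] edge_t[OF st] st_obj_bobjs[OF st]
    by (auto simp: bpath_Cons)
  have "bcong [Gd n i, Gs c] [Gd n' i, Gt c]"
    using bcong_rel[OF brel.intros(1)[OF st i], of "[]" "[]"] by simp
  then have "act X (barrow Star [Gd n i, Gs c] c) x = act X (barrow Star [Gd n' i, Gt c] c) x"
    by (simp add: barrow_eq_iff[THEN iffD2])
  then show ?thesis
    using paths[THEN act_Cons_path[OF X _ x]]
    by (simp add: act_generator[OF edge_s[OF st]] act_generator[OF edge_t[OF st]])
qed

lemma app_gen_act:
  "\<alpha> \<in> hom Chat X Y \<Longrightarrow> edge a g b \<Longrightarrow> x \<in> FO X b \<Longrightarrow> app \<alpha> a (gen_act X g x) = gen_act Y g (app \<alpha> b x)"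
  using Chat_app_act[OF _ barrow_hom[OF bpath_edge]] by (simp add: act_generator)

lemma Chat_homI:
  assumes X: "X \<in> Ob Chat" and Y: "Y \<in> Ob Chat"
    and h: "\<And>c x. c \<in> bobjs \<Longrightarrow> x \<in> FO X c \<Longrightarrow> h c x \<in> FO Y c"
    and g: "\<And>a g b x. edge a g b \<Longrightarrow> x \<in> FO X b \<Longrightarrow> h a (gen_act X g x) = gen_act Y g (h b x)"
  shows "mk_psh_arr Base X h Y \<in> hom Chat X Y"
  unfolding Chat_def
proof (rule Base.mk_psh_arr_in)
  fix f a b x assume "f \<in> hom Base a b" and x: "x \<in> FO X b"
  then obtain p where p: "f = barrow a p b" "bpath a p b" by (auto simp: hom_Base_iff)
  have "h a (act X (barrow a p b) x) = act Y (barrow a p b) (h b x)"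
    using p(2)
  proof (induction p arbitrary: a)
    case Nil
    then show ?case using Chat_act_Ide[OF X, of b x] Chat_act_Ide[OF Y, of b "h b x"] x h by auto
  next
    case (Cons q p)
    then have e: "edge a q (gen_tgt q)" and p: "bpath (gen_tgt q) p b" by (auto simp: bpath_Cons)
    have b: "b \<in> bobjs" using bpath_bobjs[OF p] by simp
    show ?case
      using g[OF e Chat_act_in[OF X barrow_hom[OF p] x]] Cons.IH[OF p]
        act_Cons_path[OF X Cons.prems x] act_Cons_path[OF Y Cons.prems h[OF b x]] by simp
  qed
  then show "h a (act X f x) = act Y f (h b x)" using p by simp
qed (use X Y h in \<open>auto simp: Chat_def\<close>)

section \<open>Countable presheaves from actions of the generators\<close>

definition nat_elt :: "nat \<Rightarrow> 'u::infinite" where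
  "nat_elt = (SOME f. inj f)"

lemma inj_nat_elt: "inj nat_elt"
  unfolding nat_elt_def using infinite_countable_subset[OF infinite_UNIV]
  by (metis (mono_tags) someI_ex)

lemma nat_elt_eq_iff [simp]: "nat_elt k = nat_elt l \<longleftrightarrow> k = l"
  using inj_nat_elt by (auto dest: injD)

lemma inv_nat_elt [simp]: "inv nat_elt (nat_elt k) = k"
  by (rule inv_f_f[OF inj_nat_elt])

definition path_act :: "(gen \<Rightarrow> nat \<Rightarrow> nat) \<Rightarrow> gen list \<Rightarrow> nat \<Rightarrow> nat" where
  "path_act G p x = foldr G p x"

definition nat_psh :: "(bobj \<Rightarrow> nat set) \<Rightarrow> (gen \<Rightarrow> nat \<Rightarrow> nat) \<Rightarrow> 'u::infinite psh" where
  "nat_psh S G = mk_psh Base (\<lambda>c. nat_elt ` S c)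
    (\<lambda>f x. nat_elt (path_act G (SOME p. p \<in> val f) (inv nat_elt x)))"

locale gen_action =
  fixes S :: "bobj \<Rightarrow> nat set" and G :: "gen \<Rightarrow> nat \<Rightarrow> nat"
  assumes gen_in: "edge a g b \<Longrightarrow> x \<in> S b \<Longrightarrow> G g x \<in> S a"
    and gen_rel: "brel u v \<Longrightarrow> bpath a u b \<Longrightarrow> x \<in> S b \<Longrightarrow> path_act G u x = path_act G v x"
begin

lemma path_act_in: "bpath a p b \<Longrightarrow> x \<in> S b \<Longrightarrow> path_act G p x \<in> S a"
  by (induction p arbitrary: a) (auto simp: path_act_def bpath_Cons intro: gen_in)

lemma path_act_append: "path_act G (p @ q) x = path_act G p (path_act G q x)"
  by (simp add: path_act_def)

lemma path_act_bcong: "bcong p q \<Longrightarrow> bpath a p b \<Longrightarrow> x \<in> S b \<Longrightarrow> path_act G p x = path_act G q x"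
proof (induction arbitrary: a b x rule: bcong.induct)
  case (bcong_rel u v p q)
  then obtain c d where "bpath c u d" "bpath d q b" by (auto simp: bpath_append)
  then show ?case using bcong_rel gen_rel path_act_in by (auto simp: path_act_append)
next
  case (bcong_sym p q)
  then show ?case using bcong_bpath by metis
next
  case (bcong_trans p q r)
  then show ?case using bcong_bpath by metis
qed simp

lemma path_act_some:
  assumes p: "bpath a p b" and x: "x \<in> S b"
  shows "path_act G (SOME q. q \<in> val (barrow a p b)) x = path_act G p x"
proof -
  have "bcong p (SOME q. bcong p q)" by (rule someI) (rule bcong_refl)
  then show ?thesis using path_act_bcong[OF _ p x] by (simp add: barrow_def)
qed

lemma nat_psh_in: "nat_psh S G \<in> Ob Chat"
  unfolding nat_psh_def Chat_def
proof (rule Base.mk_psh_in)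
  fix f a b x assume "f \<in> hom Base a b" "x \<in> nat_elt ` S b"
  then show "nat_elt (path_act G (SOME p. p \<in> val f) (inv nat_elt x)) \<in> nat_elt ` S a"
    by (auto simp: hom_Base_iff path_act_some path_act_in)
next
  fix a x assume "a \<in> Ob Base" "x \<in> nat_elt ` S a"
  then show "nat_elt (path_act G (SOME p. p \<in> val (Ide Base a)) (inv nat_elt x)) = x"
    using path_act_some[of a "[]" a] by (auto simp: path_act_def)
next
  fix f g a b c x
  assume arrows: "f \<in> hom Base a b" "g \<in> hom Base b c" and x: "x \<in> nat_elt ` S c"
  have "bpath a (p @ q) c" if "bpath a p b" "bpath b q c" for p q
    using that by (auto simp: bpath_append)
  with arrows x show "nat_elt (path_act G (SOME p. p \<in> val (Cmp Base g f)) (inv nat_elt x)) =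
      nat_elt (path_act G (SOME p. p \<in> val f)
        (inv nat_elt (nat_elt (path_act G (SOME p. p \<in> val g) (inv nat_elt x)))))"
    by (auto simp: hom_Base_iff path_act_some path_act_in path_act_append)
qed

lemma FO_nat_psh: "c \<in> bobjs \<Longrightarrow> FO (nat_psh S G) c = nat_elt ` S c"
  by (simp add: nat_psh_def)

lemma gen_act_nat_psh: "edge a g b \<Longrightarrow> k \<in> S b \<Longrightarrow> gen_act (nat_psh S G) g (nat_elt k) = nat_elt (G g k)"
proof -
  assume e: "edge a g b" and k: "k \<in> S b"
  have "act (nat_psh S G) (barrow a [g] b) (nat_elt k :: 'a) =
      nat_elt (path_act G (SOME q. q \<in> val (barrow a [g] b)) (inv nat_elt (nat_elt k :: 'a)))"
    unfolding nat_psh_def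
    by (rule Base.act_mk_psh[OF barrow_hom[OF bpath_edge[OF e]]]) (use k in auto)
  then show ?thesis
    using e k path_act_some[OF bpath_edge[OF e] k] by (simp add: act_generator path_act_def)
qed

end

section \<open>Representable presheaves\<close>

abbreviation unit_elt :: "bobj \<Rightarrow> 'u::infinite" where
  "unit_elt c \<equiv> enc (barrow c [] c)"

abbreviation elt :: "'u::infinite parr \<Rightarrow> bobj \<Rightarrow> 'u" where
  "elt \<alpha> c \<equiv> app \<alpha> c (unit_elt c)"

lemma dec_enc: "f \<in> hom Base a b \<Longrightarrow> dec (enc f :: 'u::infinite) = f"
  by (simp add: dec_def hom_def inv_into_f_f[OF inj_on_enc])

lemma enc_eq_iff: "f \<in> hom Base a b \<Longrightarrow> g \<in> hom Base a' b' \<Longrightarrow> (enc f :: 'u::infinite) = enc g \<longleftrightarrow> f = g"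
  by (auto simp: hom_def dest: inj_onD[OF inj_on_enc])

lemma yo_eq_mk_psh: "yo c = mk_psh Base (\<lambda>d. enc ` hom Base d c) (\<lambda>f x. enc (Cmp Base (dec x) f))"
  by (auto simp: yo_def mk_psh_def)

lemma yo_in: "yo c \<in> Ob Chat"
  unfolding yo_eq_mk_psh Chat_def
proof (rule Base.mk_psh_in)
  fix f a b and x :: 'a assume "f \<in> hom Base a b" "x \<in> enc ` hom Base b c"
  then show "enc (Cmp Base (dec x) f) \<in> (enc ` hom Base a c :: 'a set)"
    using Base.cmp by (auto simp: dec_enc)
next
  fix a and x :: 'a assume "a \<in> Ob Base" "x \<in> enc ` hom Base a c"
  then show "enc (Cmp Base (dec x) (Ide Base a)) = x"
    using Base.ide_right by (auto simp: dec_enc simp del: Base_simps)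
next
  fix f g a b d and x :: 'a assume "f \<in> hom Base a b" "g \<in> hom Base b d" "x \<in> enc ` hom Base d c"
  then show "enc (Cmp Base (dec x) (Cmp Base g f)) =
      (enc (Cmp Base (dec (enc (Cmp Base (dec x) g) :: 'a)) f) :: 'a)"
    using Base.assoc[of f a b g d _ c] by (auto simp: dec_enc dec_enc[OF Base.cmp[of g b d _ c]])
qed

lemma FO_yo: "d \<in> bobjs \<Longrightarrow> FO (yo c) d = enc ` hom Base d c"
  by (simp add: yo_def)

lemma act_yo: "f \<in> hom Base a b \<Longrightarrow> g \<in> hom Base b c \<Longrightarrow> act (yo c) f (enc g) = enc (Cmp Base g f)"
  unfolding yo_eq_mk_psh by (subst Base.act_mk_psh) (auto simp: dec_enc)

lemma unit_elt_in: "c \<in> bobjs \<Longrightarrow> unit_elt c \<in> FO (yo c) c"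
  using barrow_hom[of c "[]" c] by (simp add: FO_yo)

lemma dec_unit_elt: "c \<in> bobjs \<Longrightarrow> dec (unit_elt c) = barrow c [] c"
  by (rule dec_enc[OF barrow_hom]) simp

lemma app_eq_act_elt:
  assumes "\<alpha> \<in> hom Chat (yo c) X" "f \<in> hom Base d c"
  shows "app \<alpha> d (enc f) = act X f (elt \<alpha> c)"
proof -
  have c: "c \<in> bobjs" using Base.hom_Ob[OF assms(2)] by simp
  have "act (yo c) f (unit_elt c) = (enc f :: 'a)"
    using act_yo[OF assms(2) barrow_hom[of c "[]" c]] c Base.ide_left[OF assms(2)] by simp
  then show ?thesis using Chat_app_act[OF assms unit_elt_in[OF c]] by simp
qed

lemma yo_hom_eqI:
  assumes "\<alpha> \<in> hom Chat (yo c) X" "\<beta> \<in> hom Chat (yo c) X" "elt \<alpha> c = elt \<beta> c"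
  shows "\<alpha> = \<beta>"
  using assms by (intro Chat_hom_eqI[OF assms(1,2)]) (auto simp: FO_yo app_eq_act_elt)

definition elt_arr :: "bobj \<Rightarrow> 'u psh \<Rightarrow> 'u \<Rightarrow> 'u::infinite parr" where
  "elt_arr c X x = mk_psh_arr Base (yo c) (\<lambda>d e. act X (dec e) x) X"

lemma elt_arr_hom:
  assumes X: "X \<in> Ob Chat" and x: "x \<in> FO X c"
  shows "elt_arr c X x \<in> hom Chat (yo c) X"
  unfolding elt_arr_def Chat_def
proof (rule Base.mk_psh_arr_in)
  fix d e assume "d \<in> Ob Base" "e \<in> FO (yo c) d"
  then show "act X (dec e) x \<in> FO X d"
    using Chat_act_in[OF X _ x] by (auto simp: FO_yo dec_enc)
next
  fix f a b e assume "f \<in> hom Base a b" "e \<in> FO (yo c) b"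
  then show "act X (dec (act (yo c) f e)) x = act X f (act X (dec e) x)"
    using Base.hom_Ob[of f a b] Chat_act_Cmp[OF X _ _ x]
    by (auto simp: FO_yo act_yo dec_enc dec_enc[OF Base.cmp[of f a b _ c]])
qed (use X yo_in in \<open>auto simp: Chat_def\<close>)

lemma elt_elt_arr: "X \<in> Ob Chat \<Longrightarrow> c \<in> bobjs \<Longrightarrow> x \<in> FO X c \<Longrightarrow> elt (elt_arr c X x) c = x"
  using Chat_act_Ide[of X c x] by (simp add: elt_arr_def unit_elt_in dec_unit_elt)

lemma elt_in: "\<alpha> \<in> hom Chat (yo c) X \<Longrightarrow> c \<in> bobjs \<Longrightarrow> elt \<alpha> c \<in> FO X c"
  by (rule Chat_app_in[OF _ _ unit_elt_in])

lemma yo_arr_hom: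
  assumes "f \<in> hom Base a b"
  shows "yo_arr f \<in> hom Chat (yo a) (yo b :: 'u::infinite psh)" "elt (yo_arr f) a = (enc f :: 'u)"
proof -
  have a: "a \<in> bobjs" using Base.hom_Ob[OF assms] by simp
  have f: "src f = a" "tgt f = b" using assms by (auto simp: hom_def)
  have eq: "(yo_arr f :: 'u parr) = mk_psh_arr Base (yo a) (\<lambda>d x. enc (Cmp Base f (dec x))) (yo b)"
    by (auto simp: yo_arr_def mk_psh_arr_def f FO_yo fun_eq_iff)
  show "yo_arr f \<in> hom Chat (yo a) (yo b :: 'u psh)"
    unfolding eq Chat_def
  proof (rule Base.mk_psh_arr_in)
    fix d and e :: 'u assume "d \<in> Ob Base" "e \<in> FO (yo a) d"
    then show "enc (Cmp Base f (dec e)) \<in> FO (yo b :: 'u psh) d"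
      using Base.cmp[OF _ assms] by (auto simp: FO_yo dec_enc)
  next
    fix g d d' and e :: 'u assume g: "g \<in> hom Base d d'" and "e \<in> FO (yo a) d'"
    then obtain k where k: "e = enc k" "k \<in> hom Base d' a"
      using Base.hom_Ob[OF g] by (auto simp: FO_yo)
    show "enc (Cmp Base f (dec (act (yo a) g e))) = act (yo b) g (enc (Cmp Base f (dec e)) :: 'u)"
      using Base.assoc[OF g k(2) assms]
      by (simp add: k(1) act_yo[OF g k(2)] act_yo[OF g Base.cmp[OF k(2) assms]]
        dec_enc[OF k(2)] dec_enc[OF Base.cmp[OF g k(2)]])
  qed (use yo_in in \<open>auto simp: Chat_def\<close>)
  show "elt (yo_arr f) a = (enc f :: 'u)"
    unfolding eq using a Base.ide_right[OF assms] by (simp add: unit_elt_in dec_unit_elt)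
qed

lemma yo_generator_hom: "edge a g b \<Longrightarrow> yo_path a [g] b \<in> hom Chat (yo a) (yo b)"
  by (rule yo_arr_hom[OF barrow_hom[OF bpath_edge]])

lemma gen_act_unit_elt: "edge a g b \<Longrightarrow> gen_act (yo b) g (unit_elt b) = enc (barrow a [g] b)"
  using act_yo[OF barrow_hom[OF bpath_edge] barrow_hom[of b "[]" b]] edge_bobjs
  by (auto simp: act_generator[symmetric])

lemma elt_yo_generator:
  assumes "edge a g b"
  shows "elt (yo_path a [g] b) a = gen_act (yo b) g (unit_elt b)"
  using yo_arr_hom(2)[OF barrow_hom[OF bpath_edge[OF assms]]]
  by (simp add: gen_act_unit_elt[OF assms])

lemma elt_Cmp_generator:
  assumes "edge a g b" "\<alpha> \<in> hom Chat (yo b) X"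
  shows "elt (\<alpha> \<odot> yo_path a [g] b) a = gen_act X g (elt \<alpha> b)"
proof -
  note f = barrow_hom[OF bpath_edge[OF assms(1)]]
  have a: "a \<in> bobjs" using edge_bobjs[OF assms(1)] by simp
  show ?thesis
    by (simp add: Chat_app_Cmp[OF yo_arr_hom(1)[OF f] a unit_elt_in[OF a]] yo_arr_hom(2)[OF f]
        app_eq_act_elt[OF assms(2) f] act_generator[OF assms(1)])
qed

lemma elt_Cmp: "\<alpha> \<in> hom Chat (yo c) X \<Longrightarrow> c \<in> bobjs \<Longrightarrow> elt (\<beta> \<odot> \<alpha>) c = app \<beta> c (elt \<alpha> c)"
  by (rule Chat_app_Cmp[OF _ _ unit_elt_in])

lemma iso_yo_hom_eqI:
  assumes \<zeta>: "is_iso Chat \<zeta>" "\<zeta> \<in> hom Chat (yo c) Y" and r: "r \<in> hom Chat Y Q"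
    and r': "r' \<in> hom Chat Y Q"
    and "elt (r \<odot> \<zeta>) c = elt (r' \<odot> \<zeta>) c"
  shows "r = r'"
  using yo_hom_eqI[OF Chat.cmp[OF \<zeta>(2) r] Chat.cmp[OF \<zeta>(2) r']] assms(5)
  by (intro Chat.iso_cancel_right[OF \<zeta> r r'])

lemma iso_yo_hom_exists:
  assumes \<zeta>: "is_iso Chat \<zeta>" "\<zeta> \<in> hom Chat (yo c) Y"
    and Q: "Q \<in> Ob Chat" and c: "c \<in> bobjs" and y: "y \<in> FO Q c"
  shows "\<exists>r\<in>hom Chat Y Q. elt (r \<odot> \<zeta>) c = y"
proof -
  obtain \<zeta>' where \<zeta>': "\<zeta>' \<in> hom Chat Y (yo c)" "\<zeta>' \<odot> \<zeta> = Ide Chat (yo c)"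
    using Chat.is_isoE[OF \<zeta>] by metis
  note el = elt_arr_hom[OF Q y]
  have "(elt_arr c Q y \<odot> \<zeta>') \<odot> \<zeta> = elt_arr c Q y"
    by (rule Chat.cancel_inverse_right[OF el \<zeta>'(1) \<zeta>(2) \<zeta>'(2)])
  then show ?thesis using Chat.cmp[OF \<zeta>'(1) el] elt_elt_arr[OF Q c y] by metis
qed

subsection \<open>Players\<close>

fun height :: "bobj \<Rightarrow> nat" where
  "height Star = 0" | "height (Pl n) = 1" | "height (Para n) = 3" | "height (Tau n i m j) = 3" |
      "height _ = 2"

lemma st_obj_height: "st_obj c n n' \<Longrightarrow> height c = 2"
  by (induction rule: st_obj.induct) auto

lemma edge_height: "edge a g b \<Longrightarrow> height a < height b"
  by (induction rule: edge.induct) (auto dest: st_obj_height)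

lemma bpath_height: "bpath a p b \<Longrightarrow> a = b \<or> height a < height b"
  by (induction rule: bpath.induct) (auto dest: edge_height)

lemma edge_not_Star: "edge a g b \<Longrightarrow> b \<noteq> Star"
  by (auto dest: edge_height)

lemma edge_into_Pl: "edge a g (Pl n) \<Longrightarrow> \<exists>i\<in>{1..n}. a = Star \<and> g = Gd n i"
  by (erule edge.cases) (auto dest: st_obj_height)

lemma bpath_into_Pl:
  "bpath a p (Pl n) \<longleftrightarrow> a = Pl n \<and> p = [] \<or> (\<exists>i\<in>{1..n}. a = Star \<and> p = [Gd n i])"
proof
  assume "bpath a p (Pl n)"
  then show "a = Pl n \<and> p = [] \<or> (\<exists>i\<in>{1..n}. a = Star \<and> p = [Gd n i])"
  proof cases
    case (2 g b p')
    have "b = Pl n \<or> b = Star" using bpath_height[OF 2(3)] by (cases b) auto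
    moreover have "b \<noteq> Star" using edge_height[OF 2(2)] by auto
    ultimately have b: "b = Pl n" by simp
    have "p' = []"
    proof (cases p')
      case (Cons g' p'')
      then have "height (Pl n) < height (gen_tgt g')"
        "gen_tgt g' = Pl n \<or> height (gen_tgt g') < height (Pl n)"
        using 2(3) b edge_height[of "Pl n" g' "gen_tgt g'"] bpath_height[of "gen_tgt g'" p'' "Pl n"]
            by (auto simp: bpath_Cons)
      then show ?thesis by auto
    qed simp
    then show ?thesis using 2 b edge_into_Pl by auto
  qed simp
qed (use bpath_edge[OF edge_d] in auto)

abbreviation chan :: "nat \<Rightarrow> nat \<Rightarrow> 'u::infinite" where
  "chan n i \<equiv> enc (barrow Star [Gd n i] (Pl n))"

lemma hom_Base_Pl:
  "hom Base Star (Pl n) = (\<lambda>i. barrow Star [Gd n i] (Pl n)) ` {1..n}"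
  "hom Base (Pl m) (Pl n) = (if m = n then {barrow (Pl n) [] (Pl n)} else {})"
  "c \<noteq> Star \<Longrightarrow> c \<noteq> Pl n \<Longrightarrow> hom Base c (Pl n) = {}"
  by (auto simp: set_eq_iff hom_Base_iff bpath_into_Pl)

lemma FO_yo_Pl_Star: "FO (yo (Pl n)) Star = chan n ` {1..n}"
  by (simp add: FO_yo hom_Base_Pl image_image)

lemma FO_yo_Pl: "FO (yo (Pl n)) (Pl m) = (if m = n then {unit_elt (Pl n)} else {})"
  by (simp add: FO_yo hom_Base_Pl)

lemma FO_yo_Pl_other: "c \<in> bobjs \<Longrightarrow> c \<noteq> Star \<Longrightarrow> c \<noteq> Pl n \<Longrightarrow> FO (yo (Pl n)) c = {}"
  by (simp add: FO_yo hom_Base_Pl)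

lemma chan_eq_iff:
  assumes "i \<in> {1..n}" "j \<in> {1..n}"
  shows "(chan n i :: 'u::infinite) = chan n j \<longleftrightarrow> i = j"
  using enc_eq_iff[OF barrow_hom[OF bpath_edge[OF edge_d[OF assms(1)]]]
      barrow_hom[OF bpath_edge[OF edge_d[OF assms(2)]]]]
  by (auto simp: barrow_eq_iff intro: bcong.intros dest: bcong_length)

lemma app_chan: "\<alpha> \<in> hom Chat (yo (Pl n)) X \<Longrightarrow> i \<in> {1..n} \<Longrightarrow> app \<alpha> Star (chan n i) =
    gen_act X (Gd n i) (elt \<alpha> (Pl n))"
  using app_eq_act_elt[OF _ barrow_hom[OF bpath_edge[OF edge_d]]]
  by (simp add: act_generator[OF edge_d])

lemma yd_hom: "i \<in> {1..n} \<Longrightarrow> yd n i \<in> hom Chat (yo Star) (yo (Pl n))"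
  by (rule yo_generator_hom[OF edge_d])

lemma yo_Pl_hom_unique:
  assumes "\<alpha> \<in> hom Chat (yo (Pl m)) (yo (Pl n) :: 'u::infinite psh)"
  shows "m = n" "\<alpha> = Ide Chat (yo (Pl n))"
proof -
  have "elt \<alpha> (Pl m) \<in> FO (yo (Pl n)) (Pl m)" using elt_in[OF assms] by simp
  then show m: "m = n" by (auto simp: FO_yo_Pl split: if_splits)
  have "elt \<beta> (Pl n) = unit_elt (Pl n)" if "\<beta> \<in> hom Chat (yo (Pl n)) (yo (Pl n) :: 'u psh)" for \<beta>
    using elt_in[OF that] by (simp add: FO_yo_Pl)
  then show "\<alpha> = Ide Chat (yo (Pl n))"
    using assms m Chat.ide[OF yo_in[of "Pl n"]] by (intro yo_hom_eqI[of _ "Pl n"]) auto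
qed

lemma yo_iso_imp_eq:
  assumes "is_iso Chat \<alpha>" "\<alpha> \<in> hom Chat (yo a) (yo b :: 'u::infinite psh)" "a \<in> bobjs" "b \<in> bobjs"
  shows "a = b"
proof -
  obtain \<beta> where "\<beta> \<in> hom Chat (yo b) (yo a :: 'u psh)" by (rule Chat.is_isoE[OF assms(1,2)])
  from elt_in[OF this assms(4)] elt_in[OF assms(2,3)]
  obtain p q where "bpath b p a" "bpath a q b" using assms by (auto simp: FO_yo hom_Base_iff)
  then show ?thesis using bpath_height[of b p a] bpath_height[of a q b] by auto
qed

section \<open>Pushouts and cospans\<close>

context category
begin

lemma is_iso_cancel_right:
  assumes gf: "is_iso C (Cmp C g f)" and "is_iso C f" and f: "f \<in> hom C a b" and g: "g \<in> hom C b c"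
  shows "is_iso C g"
proof -
  obtain f' where f': "f' \<in> hom C b a" "Cmp C f f' = Ide C b" "is_iso C f'"
    using is_isoE[OF \<open>is_iso C f\<close> f] by metis
  have "is_iso C (Cmp C (Cmp C g f) f')" by (rule is_iso_Cmp[OF f'(3) gf f'(1) cmp[OF f g]])
  then show ?thesis by (simp add: cancel_inverse_right[OF g f f'(1,2)])
qed

lemma square_inverse:
  assumes f: "f \<in> hom C a b" and f': "f' \<in> hom C a' b'" and x: "x \<in> hom C a a'"
    and u: "u \<in> hom C b b'"
    and x': "x' \<in> hom C a' a" "Cmp C x x' = Ide C a'"
      and u': "u' \<in> hom C b' b" "Cmp C u' u = Ide C b"
    and square: "Cmp C f' x = Cmp C u f"
  shows "Cmp C f x' = Cmp C u' f'"
proof -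
  have "Cmp C u' (Cmp C f' x) = f" using cancel_inverse_left[OF f u u'] square by simp
  then have "Cmp C f x' = Cmp C (Cmp C (Cmp C u' f') x) x'" using assoc[OF x f' u'(1)] by simp
  also have "\<dots> = Cmp C u' f'" by (rule cancel_inverse_right[OF cmp[OF f' u'(1)] x x'])
  finally show ?thesis .
qed

lemma square_comp:
  assumes "f \<in> hom C a b" "f' \<in> hom C a' b'" "f'' \<in> hom C a'' b''"
    and "x \<in> hom C a a'" "x' \<in> hom C a' a''" "u \<in> hom C b b'" "u' \<in> hom C b' b''"
    and "Cmp C f' x = Cmp C u f" "Cmp C f'' x' = Cmp C u' f'"
  shows "Cmp C f'' (Cmp C x' x) = Cmp C (Cmp C u' u) f"
  using assoc[OF assms(4,5,3)] assoc[OF assms(4,2,7)] assoc[OF assms(1,6,7)] assms(8,9) by simp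

lemma pushout_homD:
  assumes "is_pushout C f z p q" "f \<in> hom C a b" "z \<in> hom C a c"
  shows "p \<in> hom C b (Cod C p)" "q \<in> hom C c (Cod C p)" "Cmp C p f = Cmp C q z"
  using assms by (auto simp: is_pushout_def comm_square_def hom_def)

lemma pushout_ex1:
  assumes po: "is_pushout C f z p q" and f: "f \<in> hom C a b" and z: "z \<in> hom C a c"
    and p': "p' \<in> hom C b d" and q': "q' \<in> hom C c d" and "Cmp C p' f = Cmp C q' z"
  shows "\<exists>!m. m \<in> hom C (Cod C p) d \<and> Cmp C m p = p' \<and> Cmp C m q = q'"
proof -
  have "comm_square C f z p' q'" using assms by (auto simp: comm_square_def hom_def)
  then have "\<exists>!m. m \<in> hom C (Cod C p) (Cod C p') \<and> Cmp C m p = p' \<and> Cmp C m q = q'"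
    using po unfolding is_pushout_def by blast
  then show ?thesis using homD(3)[OF p'] by simp
qed

lemma pushout_Ide:
  assumes f: "f \<in> hom C a b"
  shows "is_pushout C f (Ide C a) (Ide C b) f"
proof -
  note Ide_a = ide[OF hom_Ob(1)[OF f]] and Ide_b = ide[OF hom_Ob(2)[OF f]]
  have "\<exists>!m. m \<in> hom C (Cod C (Ide C b)) (Cod C p) \<and> Cmp C m (Ide C b) = p \<and> Cmp C m f = q"
    if square: "comm_square C f (Ide C a) p q" for p q
  proof -
    have p: "p \<in> hom C b (Cod C p)" and q: "q \<in> hom C a (Cod C p)"
      and "Cmp C p f = Cmp C q (Ide C a)"
      using square homD[OF f] homD[OF Ide_a] by (auto simp: comm_square_def hom_def)
    then have "Cmp C p f = q" by (metis ide_right)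
    moreover have "m = p" if "m \<in> hom C b (Cod C p)" "Cmp C m (Ide C b) = p" for m
      using that ide_right by metis
    ultimately show ?thesis using p ide_right[OF p] homD(3)[OF Ide_b] by (intro ex1I[of _ p]) auto
  qed
  moreover have "comm_square C f (Ide C a) (Ide C b) f"
    using f Ide_a Ide_b ide_left[OF f] ide_right[OF f] by (auto simp: comm_square_def hom_def)
  ultimately show ?thesis by (simp add: is_pushout_def)
qed

lemma pushout_along_iso:
  assumes po: "is_pushout C f z p q" and "is_iso C z" and f: "f \<in> hom C a b" and z: "z \<in> hom C a c"
  shows "is_iso C p"
proof -
  note p = pushout_homD(1)[OF po f z] and q = pushout_homD(2)[OF po f z]
  obtain z' where z': "z' \<in> hom C c a" "Cmp C z' z = Ide C a" "Cmp C z z' = Ide C c"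
    using is_isoE[OF \<open>is_iso C z\<close> z] by metis
  note fz' = cmp[OF z'(1) f] and Ide_b = ide[OF hom_Ob(2)[OF f]]
  have "Cmp C (Ide C b) f = Cmp C (Cmp C f z') z"
    using cancel_inverse_right[OF f z'(1) z z'(2)] ide_left[OF f] by simp
  then obtain m where m: "m \<in> hom C (Cod C p) b" "Cmp C m p = Ide C b" "Cmp C m q = Cmp C f z'"
    using pushout_ex1[OF po f z Ide_b fz'] by blast
  note pm = cmp[OF m(1) p]
  have "Cmp C (Cmp C p m) q = Cmp C p (Cmp C f z')" using assoc[OF q m(1) p] m(3) by simp
  also have "\<dots> = Cmp C (Cmp C q z) z'" using assoc[OF z'(1) f p] pushout_homD(3)[OF po f z] by simp
  also have "\<dots> = q" by (rule cancel_inverse_right[OF q z z'(1,3)])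
  finally have "Cmp C (Cmp C p m) q = q" .
  moreover have "Cmp C (Cmp C p m) p = p" using assoc[OF p m(1) p] m(2) ide_right[OF p] by simp
  ultimately have "Cmp C p m = Ide C (Cod C p)"
    using pushout_ex1[OF po f z p q pushout_homD(3)[OF po f z]] pm ide[OF hom_Ob(2)[OF p]]
      ide_left[OF p] ide_left[OF q] by blast
  then show ?thesis using is_isoI[OF p m(1,2)] by simp
qed

lemma pushout_iso_universal_extension:
  assumes po: "is_pushout C f z p q" and "is_iso C p" and f: "f \<in> hom C a b" and z: "z \<in> hom C a c"
  obtains w where "w \<in> hom C c b" "Cmp C w z = f"
    "\<And>g h d. g \<in> hom C b d \<Longrightarrow> h \<in> hom C c d \<Longrightarrow> Cmp C g f = Cmp C h z \<Longrightarrow> h = Cmp C g w"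
proof -
  note p = pushout_homD(1)[OF po f z] and q = pushout_homD(2)[OF po f z]
  obtain p' where p': "p' \<in> hom C (Cod C p) b" "Cmp C p' p = Ide C b" "Cmp C p p' = Ide C (Cod C p)"
    using is_isoE[OF \<open>is_iso C p\<close> p] by metis
  have "Cmp C (Cmp C p' q) z = Cmp C p' (Cmp C p f)"
    using assoc[OF z q p'(1)] pushout_homD(3)[OF po f z] by simp
  then have "Cmp C (Cmp C p' q) z = f" by (simp add: cancel_inverse_left[OF f p p'(1,2)])
  moreover have "h = Cmp C g (Cmp C p' q)"
    if g: "g \<in> hom C b d" and h: "h \<in> hom C c d" and gh: "Cmp C g f = Cmp C h z" for g h d
  proof -
    obtain m where m: "m \<in> hom C (Cod C p) d" "Cmp C m p = g" "Cmp C m q = h"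
      using pushout_ex1[OF po f z g h gh] by blast
    have "Cmp C g p' = m" using cancel_inverse_right[OF m(1) p p'(1,3)] m(2) by simp
    then show ?thesis using assoc[OF q p'(1) g] m(3) by simp
  qed
  ultimately show ?thesis using that cmp[OF q p'(1)] by blast
qed

end

subsection \<open>Isomorphisms of cospans\<close>

lemma cospan_hom:
  assumes "is_cospan M"
  shows "fst M \<in> hom Chat (src (fst M)) (tgt (fst M))" "snd M \<in> hom Chat (src (snd M)) (tgt (fst M))"
  using assms Chat_Arr_hom[of "fst M"] Chat_Arr_hom[of "snd M"] by (auto simp: is_cospan_def)

lemma cospan_iso_byI:
  assumes "is_cospan M" "is_cospan N" "is_iso Chat x" "x \<in> hom Chat (src (fst M)) (src (fst N))"
    "is_iso Chat u" "u \<in> hom Chat (tgt (fst M)) (tgt (fst N))"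
    "is_iso Chat y" "y \<in> hom Chat (src (snd M)) (src (snd N))"
    "fst N \<odot> x = u \<odot> fst M" "snd N \<odot> y = u \<odot> snd M"
  shows "cospan_iso_by x u y M N"
  using assms Chat_homD[OF assms(4)] Chat_homD[OF assms(6)] Chat_homD[OF assms(8)]
  by (simp add: cospan_iso_by_def)

lemma
  fixes M N :: "'u cospan"
  assumes "cospan_iso_by x u y M N"
  shows cospan_iso_by_cospan: "is_cospan M" "is_cospan N"
    and cospan_iso_by_iso: "is_iso Chat x" "is_iso Chat u" "is_iso Chat y"
    and cospan_iso_by_hom: "x \<in> hom Chat (src (fst M)) (src (fst N))"
      "u \<in> hom Chat (tgt (fst M)) (tgt (fst N))" "y \<in> hom Chat (src (snd M)) (src (snd N))"
    and cospan_iso_by_commute: "fst N \<odot> x = u \<odot> fst M" "snd N \<odot> y = u \<odot> snd M"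
  using assms Chat_iso_hom[of x] Chat_iso_hom[of u] Chat_iso_hom[of y]
  by (simp_all add: cospan_iso_by_def)

lemma cospan_iso_by_refl:
  assumes "is_cospan M"
  shows "cospan_iso_by (Ide Chat (src (fst M))) (Ide Chat (tgt (fst M))) (Ide Chat (src (snd M))) M M"
proof -
  note legs = cospan_hom[OF assms]
  show ?thesis
    using Chat.hom_Ob[OF legs(1)] Chat.hom_Ob[OF legs(2)] Chat.ide_left[OF legs(1)]
      Chat.ide_right[OF legs(1)] Chat.ide_left[OF legs(2)] Chat.ide_right[OF legs(2)]
    by (intro cospan_iso_byI assms) (auto intro: Chat.ide Chat.is_iso_Ide)
qed

lemma cospan_iso_by_sym:
  assumes "cospan_iso_by x u y M N"
  shows "\<exists>x u y. cospan_iso_by x u y N M"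
proof -
  note cospans = cospan_iso_by_cospan[OF assms] and isos = cospan_iso_by_iso[OF assms]
    and homs = cospan_iso_by_hom[OF assms] and squares = cospan_iso_by_commute[OF assms]
  note M = cospan_hom[OF cospans(1)] and N = cospan_hom[OF cospans(2)]
  obtain x' where x': "x' \<in> hom Chat (src (fst N)) (src (fst M))"
    "x \<odot> x' = Ide Chat (src (fst N))" "is_iso Chat x'"
    using Chat.is_isoE[OF isos(1) homs(1)] by metis
  obtain u' where u': "u' \<in> hom Chat (tgt (fst N)) (tgt (fst M))"
    "u' \<odot> u = Ide Chat (tgt (fst M))" "is_iso Chat u'"
    using Chat.is_isoE[OF isos(2) homs(2)] by metis
  obtain y' where y': "y' \<in> hom Chat (src (snd N)) (src (snd M))"
    "y \<odot> y' = Ide Chat (src (snd N))" "is_iso Chat y'"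
    using Chat.is_isoE[OF isos(3) homs(3)] by metis
  have "cospan_iso_by x' u' y' N M"
    using cospans x' u' y'
      Chat.square_inverse[OF M(1) N(1) homs(1,2) x'(1,2) u'(1,2) squares(1)]
      Chat.square_inverse[OF M(2) N(2) homs(3,2) y'(1,2) u'(1,2) squares(2)]
    by (intro cospan_iso_byI)
  then show ?thesis by blast
qed

lemma cospan_iso_by_trans:
  assumes MN: "cospan_iso_by x u y M N" and NR: "cospan_iso_by x' u' y' N R"
  shows "cospan_iso_by (x' \<odot> x) (u' \<odot> u) (y' \<odot> y) M R"
proof -
  note M = cospan_hom[OF cospan_iso_by_cospan(1)[OF MN]]
    and N = cospan_hom[OF cospan_iso_by_cospan(2)[OF MN]]
    and R = cospan_hom[OF cospan_iso_by_cospan(2)[OF NR]]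
  note homs = cospan_iso_by_hom[OF MN] and homs' = cospan_iso_by_hom[OF NR]
  note isos = cospan_iso_by_iso[OF MN] and isos' = cospan_iso_by_iso[OF NR]
  note squares = cospan_iso_by_commute[OF MN] and squares' = cospan_iso_by_commute[OF NR]
  show ?thesis
    using cospan_iso_by_cospan(1)[OF MN] cospan_iso_by_cospan(2)[OF NR]
      Chat.is_iso_Cmp[OF isos(1) isos'(1) homs(1) homs'(1)] Chat.cmp[OF homs(1) homs'(1)]
      Chat.is_iso_Cmp[OF isos(2) isos'(2) homs(2) homs'(2)] Chat.cmp[OF homs(2) homs'(2)]
      Chat.is_iso_Cmp[OF isos(3) isos'(3) homs(3) homs'(3)] Chat.cmp[OF homs(3) homs'(3)]
      Chat.square_comp[OF M(1) N(1) R(1) homs(1) homs'(1) homs(2) homs'(2) squares(1) squares'(1)]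
      Chat.square_comp[OF M(2) N(2) R(2) homs(3) homs'(3) homs(2) homs'(2) squares(2) squares'(2)]
    by (rule cospan_iso_byI)
qed

lemma basic_cospan_hom:
  assumes "st_obj c n n'"
  shows "fst (basic_cospan c n n') \<in> hom Chat (yo (Pl n)) (yo c :: 'u::infinite psh)"
    "snd (basic_cospan c n n') \<in> hom Chat (yo (Pl n')) (yo c :: 'u::infinite psh)"
  using yo_generator_hom[OF edge_s[OF assms]] yo_generator_hom[OF edge_t[OF assms]]
  by (auto simp: basic_cospan_def)

lemma basic_cospan_ends:
  assumes "st_obj c n n'"
  shows "src (fst (basic_cospan c n n')) = (yo (Pl n) :: 'u::infinite psh)"
    "tgt (fst (basic_cospan c n n')) = (yo c :: 'u::infinite psh)"
    "src (snd (basic_cospan c n n')) = (yo (Pl n') :: 'u::infinite psh)"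
    "is_cospan (basic_cospan c n n' :: 'u::infinite cospan)"
  using Chat_homD[OF basic_cospan_hom(1)[OF assms, where 'u = 'u]]
    Chat_homD[OF basic_cospan_hom(2)[OF assms, where 'u = 'u]]
  by (auto simp: is_cospan_def)

section \<open>Basic moves\<close>

subsection \<open>Copowers of the channel\<close>

lemma copower_in: "is_copower_star n I \<iota> \<Longrightarrow> i \<in> {1..n} \<Longrightarrow> \<iota> i \<in> hom Chat (yo Star) I"
  by (auto simp: is_copower_star_def is_colimit_def is_cocone_def)

lemma copower_ex1:
  assumes I: "is_copower_star n I \<iota>" and "X \<in> Ob Chat"
    and "\<And>i. i \<in> {1..n} \<Longrightarrow> r i \<in> hom Chat (yo Star) X"
  shows "\<exists>!m. m \<in> hom Chat I X \<and> (\<forall>i\<in>{1..n}. m \<odot> \<iota> i = r i)"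
proof -
  have "is_cocone Chat {1..n} (\<lambda>_. yo Star) {} X r" using assms by (auto simp: is_cocone_def)
  then show ?thesis using I unfolding is_copower_star_def is_colimit_def by blast
qed

lemma copower_eqI:
  assumes I: "is_copower_star n I \<iota>" and m: "m \<in> hom Chat I X" and m': "m' \<in> hom Chat I X"
    and "\<And>i. i \<in> {1..n} \<Longrightarrow> m \<odot> \<iota> i = m' \<odot> \<iota> i"
  shows "m = m'"
proof -
  have "\<exists>!k. k \<in> hom Chat I X \<and> (\<forall>i\<in>{1..n}. k \<odot> \<iota> i = m \<odot> \<iota> i)"
    by (rule copower_ex1[OF I Chat.hom_Ob(2)[OF m]]) (rule Chat.cmp[OF copower_in[OF I] m])
  then show ?thesis using assms(2-4) by metis
qed

definition channels :: "nat \<Rightarrow> 'u::infinite psh" where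
  "channels n = nat_psh (\<lambda>c. if c = Star then {1..n} else {}) (\<lambda>_ k. k)"

lemma channels_action: "gen_action (\<lambda>c. if c = Star then {1..n} else {}) (\<lambda>_ k. k)"
proof
  fix u v a b and x :: nat assume "brel u v"
  then show "path_act (\<lambda>_ k. k) u x = path_act (\<lambda>_ k. k) v x"
    by (induction rule: brel.induct) (auto simp: path_act_def)
qed (auto split: if_splits dest: edge_not_Star)

lemma channels_in: "channels n \<in> Ob Chat"
  unfolding channels_def by (rule gen_action.nat_psh_in[OF channels_action])

lemma FO_channels: "c \<in> bobjs \<Longrightarrow> FO (channels n) c = (if c = Star then nat_elt ` {1..n} else {})"
  unfolding channels_def by (simp add: gen_action.FO_nat_psh[OF channels_action])

lemma channels_position: "is_position (channels n)"
proof -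
  have "(SIGMA c : Ob Base. FO (channels n) c) \<subseteq> {Star} \<times> nat_elt ` {1..n}"
    by (auto simp: FO_channels split: if_splits)
  then have "finite (SIGMA c : Ob Base. FO (channels n) c)" by (rule finite_subset) simp
  then show ?thesis using channels_in by (auto simp: is_position_def FO_channels)
qed

lemma channels_copower:
  "is_copower_star n (channels n) (\<lambda>i. elt_arr Star (channels n) (nat_elt i :: 'u::infinite))"
  unfolding is_copower_star_def is_colimit_def
proof (intro conjI allI impI)
  let ?I = "channels n :: 'u psh"
  let ?\<iota> = "\<lambda>i. elt_arr Star ?I (nat_elt i)"
  have \<iota>: "?\<iota> i \<in> hom Chat (yo Star) ?I" "elt (?\<iota> i) Star = nat_elt i" if "i \<in> {1..n}" for i
    using that channels_in by (auto intro!: elt_arr_hom elt_elt_arr simp: FO_channels)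
  show "is_cocone Chat {1..n} (\<lambda>_. yo Star) {} ?I ?\<iota>"
    using \<iota> channels_in by (auto simp: is_cocone_def)
  fix Q :: "'u psh" and r assume "is_cocone Chat {1..n} (\<lambda>_. yo Star) {} Q r"
  then have Q: "Q \<in> Ob Chat" and r: "\<And>i. i \<in> {1..n} \<Longrightarrow> r i \<in> hom Chat (yo Star) Q"
    by (auto simp: is_cocone_def)
  let ?m = "mk_psh_arr Base ?I (\<lambda>c x. elt (r (inv nat_elt x)) Star) Q"
  have m: "?m \<in> hom Chat ?I Q"
    by (rule Chat_homI) (use channels_in Q elt_in[OF r] edge_not_Star edge_bobjs in
        \<open>auto simp: FO_channels split: if_splits\<close>)
  have app_m: "app f Star (nat_elt i) = elt (f \<odot> ?\<iota> i) Star" if "i \<in> {1..n}" for f i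
    using elt_Cmp[OF \<iota>(1)[OF that], of f] \<iota>(2)[OF that] by simp
  show "\<exists>!m. m \<in> hom Chat ?I Q \<and> (\<forall>j\<in>{1..n}. m \<odot> ?\<iota> j = r j)"
  proof (rule ex1I[of _ ?m], intro conjI ballI m)
    fix i assume i: "i \<in> {1..n}"
    show "?m \<odot> ?\<iota> i = r i"
      using i app_m[OF i, of ?m] Chat.cmp[OF \<iota>(1)[OF i] m] r[OF i]
      by (intro yo_hom_eqI[of _ Star Q]) (auto simp: FO_channels)
  next
    fix m' assume m': "m' \<in> hom Chat ?I Q \<and> (\<forall>j\<in>{1..n}. m' \<odot> ?\<iota> j = r j)"
    show "m' = ?m"
    proof (rule Chat_hom_eqI[OF conjunct1[OF m'] m])
      fix c and x :: 'u assume "c \<in> bobjs" "x \<in> FO ?I c"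
      then obtain i where "c = Star" "x = nat_elt i" "i \<in> {1..n}"
        by (auto simp: FO_channels split: if_splits)
      then show "app m' c x = app ?m c x"
        using app_m[of i m'] m' by (auto simp: FO_channels)
    qed
  qed
qed (auto simp: yo_in)

lemma copower_elements:
  assumes I: "is_copower_star n (I :: 'u::infinite psh) \<iota>" and c: "c \<in> bobjs" and x: "x \<in> FO I c"
  shows "c = Star" "\<exists>i\<in>{1..n}. x = elt (\<iota> i) Star"
proof -
  let ?J = "channels n :: 'u psh" and ?\<kappa> = "\<lambda>i. elt_arr Star (channels n) (nat_elt i :: 'u)"
  note J = channels_copower[of n, where 'u = 'u]
  have I_in: "I \<in> Ob Chat" using I by (auto simp: is_copower_star_def is_colimit_def is_cocone_def)
  obtain m where m: "m \<in> hom Chat I ?J" "\<forall>i\<in>{1..n}. m \<odot> \<iota> i = ?\<kappa> i"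
    using copower_ex1[OF I channels_in, of ?\<kappa>] copower_in[OF J] by blast
  obtain m' where m': "m' \<in> hom Chat ?J I" "\<forall>i\<in>{1..n}. m' \<odot> ?\<kappa> i = \<iota> i"
    using copower_ex1[OF J I_in, of \<iota>] copower_in[OF I] by blast
  have "m' \<odot> m = Ide Chat I"
  proof (rule copower_eqI[OF I Chat.cmp[OF m(1) m'(1)] Chat.ide[OF I_in]])
    fix i assume i: "i \<in> {1..n}"
    note \<iota>i = copower_in[OF I i]
    show "(m' \<odot> m) \<odot> \<iota> i = Ide Chat I \<odot> \<iota> i"
      using Chat.assoc[OF \<iota>i m(1) m'(1)] m(2) m'(2) i Chat.ide_left[OF \<iota>i] by simp
  qed
  then have x_eq: "x = app m' c (app m c x)"
    using Chat_app_Cmp[OF m(1) c x, of m'] Chat_app_Ide[OF c x] by simp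
  have "app m c x \<in> FO ?J c" by (rule Chat_app_in[OF m(1) c x])
  then obtain i where star: "c = Star" and i: "i \<in> {1..n}" "app m c x = nat_elt i"
    by (auto simp: FO_channels[OF c] split: if_splits)
  then show "c = Star" by simp
  have "elt (?\<kappa> i) Star = nat_elt i"
    using i(1) channels_in by (auto intro!: elt_elt_arr simp: FO_channels)
  then have "x = elt (m' \<odot> ?\<kappa> i) Star"
    using x_eq elt_Cmp[OF copower_in[OF J i(1)], of m'] star i(2) by simp
  then show "\<exists>i\<in>{1..n}. x = elt (\<iota> i) Star" using m'(2) i(1) by auto
qed

lemma copower_into_player_inj:
  assumes I: "is_copower_star n (I :: 'u::infinite psh) \<iota>" and a: "a \<in> hom Chat I (yo (Pl n))"
    and yd: "\<And>i. i \<in> {1..n} \<Longrightarrow> a \<odot> \<iota> i = yd n i" and c: "c \<in> bobjs"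
  shows "inj_on (app a c) (FO I c)"
proof (rule inj_onI)
  have app_a: "app a Star (elt (\<iota> i) Star) = chan n i" if "i \<in> {1..n}" for i
    using elt_Cmp[OF copower_in[OF I that], of a] yd[OF that]
      yo_arr_hom(2)[OF barrow_hom[OF bpath_edge[OF edge_d[OF that]]], where 'u = 'u] by simp
  fix x y assume x: "x \<in> FO I c" and y: "y \<in> FO I c" and eq: "app a c x = app a c y"
  obtain i j where "i \<in> {1..n}" "x = elt (\<iota> i) Star" "j \<in> {1..n}" "y = elt (\<iota> j) Star"
    using copower_elements(2)[OF I c x] copower_elements(2)[OF I c y] by blast
  then show "x = y"
    using eq copower_elements(1)[OF I c x] app_a chan_eq_iff[of i n j, where 'u = 'u] by simp
qed

subsection \<open>Extending a basic move of a lone player\<close>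

text \<open>Plays the role of a subobject classifier for the cells that a pushout adds to a player; only the
  channels of players cannot be marked.\<close>

definition marking_psh :: "'u::infinite psh" where
  "marking_psh = nat_psh (\<lambda>_. {0, 1}) (\<lambda>g k. if gen_src g = Star then 0 else k)"

definition is_marking :: "'u psh \<Rightarrow> (bobj \<Rightarrow> 'u \<Rightarrow> bool) \<Rightarrow> bool" where
  "is_marking X \<phi> \<longleftrightarrow>
    (\<forall>a g b. \<forall>x\<in>FO X b. edge a g b \<longrightarrow> \<phi> a (gen_act X g x) = (a \<noteq> Star \<and> \<phi> b x))"

definition marking_arr :: "'u psh \<Rightarrow> (bobj \<Rightarrow> 'u \<Rightarrow> bool) \<Rightarrow> 'u::infinite parr" where
  "marking_arr X \<phi> = mk_psh_arr Base X (\<lambda>c x. nat_elt (if \<phi> c x then 1 else 0)) marking_psh"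

lemma marking_action: "gen_action (\<lambda>_. {0, 1}) (\<lambda>g k. if gen_src g = Star then 0 else k)"
proof
  fix u v a b and x :: nat assume "brel u v"
  then show "path_act (\<lambda>g k. if gen_src g = Star then 0 else k) u x =
      path_act (\<lambda>g k. if gen_src g = Star then 0 else k) v x"
    by (induction rule: brel.induct) (auto simp: path_act_def)
qed auto

lemma marking_psh_in: "marking_psh \<in> Ob Chat"
  unfolding marking_psh_def by (rule gen_action.nat_psh_in[OF marking_action])

lemma marking_arr_hom:
  fixes X :: "'u::infinite psh"
  assumes X: "X \<in> Ob Chat" and \<phi>: "is_marking X \<phi>"
  shows "marking_arr X \<phi> \<in> hom Chat X marking_psh"
  unfolding marking_arr_def
proof (rule Chat_homI[OF X marking_psh_in])
  fix a g b x assume e: "edge a g b" and x: "x \<in> FO X b"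
  have "gen_act marking_psh g (nat_elt k :: 'u) = nat_elt (if gen_src g = Star then 0 else k)"
    if "k \<in> {0, 1}" for k
    unfolding marking_psh_def by (rule gen_action.gen_act_nat_psh[OF marking_action e that])
  moreover have "\<phi> a (gen_act X g x) = (gen_src g \<noteq> Star \<and> \<phi> b x)"
    using \<phi> e x edge_gen_src_tgt[OF e] by (auto simp: is_marking_def)
  ultimately show "nat_elt (if \<phi> a (gen_act X g x) then 1 else 0) =
      (gen_act marking_psh g (nat_elt (if \<phi> b x then 1 else 0)) :: 'u)"
    by simp
next
  fix c x assume "c \<in> bobjs"
  then show "nat_elt (if \<phi> c x then 1 else 0) \<in> FO (marking_psh :: 'u psh) c"
    unfolding marking_psh_def by (subst gen_action.FO_nat_psh[OF marking_action]) auto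
qed

lemma app_marking_arr:
  "c \<in> bobjs \<Longrightarrow> x \<in> FO X c \<Longrightarrow> app (marking_arr X \<phi>) c x = nat_elt (if \<phi> c x then 1 else 0)"
  by (simp add: marking_arr_def)

lemma pushout_iso_marking:
  fixes X :: "'u::infinite psh"
  assumes po: "is_pushout Chat a z x zx" and x: "is_iso Chat x"
    and a: "a \<in> hom Chat I X" and z: "z \<in> hom Chat I Z"
    and \<phi>: "is_marking Z \<phi>" and image: "\<And>c y. c \<in> bobjs \<Longrightarrow> y \<in> FO I c \<Longrightarrow> \<not> \<phi> c (app z c y)"
    and c: "c \<in> bobjs" and p: "p \<in> FO Z c"
  shows "\<not> \<phi> c p"
proof -
  obtain w where w: "w \<in> hom Chat Z X"
    and universal: "\<And>g h Q. g \<in> hom Chat X Q \<Longrightarrow> h \<in> hom Chat Z Q \<Longrightarrow> g \<odot> a = h \<odot> z \<Longrightarrow> h = g \<odot> w"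
    using Chat.pushout_iso_universal_extension[OF po x a z] by metis
  let ?f = "marking_arr X (\<lambda>_ _. False)" and ?g = "marking_arr Z \<phi>"
  have f: "?f \<in> hom Chat X marking_psh"
    by (rule marking_arr_hom[OF Chat.hom_Ob(2)[OF a]]) (simp add: is_marking_def)
  have g: "?g \<in> hom Chat Z marking_psh" by (rule marking_arr_hom[OF Chat.hom_Ob(2)[OF z] \<phi>])
  have "?f \<odot> a = ?g \<odot> z"
  proof (rule Chat_hom_eqI[OF Chat.cmp[OF a f] Chat.cmp[OF z g]])
    fix d y assume d: "d \<in> bobjs" and y: "y \<in> FO I d"
    show "app (?f \<odot> a) d y = app (?g \<odot> z) d y"
      using Chat_app_in[OF a d y] Chat_app_in[OF z d y] image[OF d y]
      by (simp add: Chat_app_Cmp[OF a d y] Chat_app_Cmp[OF z d y] app_marking_arr[OF d])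
  qed
  then have "app ?g c p = app (?f \<odot> w) c p" using universal[OF f g] by simp
  then show ?thesis
    using p Chat_app_in[OF w c p] c
    by (simp add: Chat_app_Cmp[OF w c p] app_marking_arr split: if_splits)
qed

lemma pushout_iso_surj:
  fixes X :: "'u::infinite psh"
  assumes po: "is_pushout Chat a z x zx" and x: "is_iso Chat x"
    and a: "a \<in> hom Chat I X" and z: "z \<in> hom Chat I Z"
    and I: "\<And>c. c \<in> bobjs \<Longrightarrow> c \<noteq> Star \<Longrightarrow> FO I c = {}" and c: "c \<in> bobjs"
  shows "app z c ` FO I c = FO Z c"
proof -
  note unmarked = pushout_iso_marking[OF po x a z]
  have "is_marking Z (\<lambda>c _. c \<noteq> Star)" using edge_not_Star by (auto simp: is_marking_def)
  then have Z: "FO Z d = {}" if "d \<in> bobjs" "d \<noteq> Star" for d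
    using unmarked[of "\<lambda>c _. c \<noteq> Star" d] I that by blast
  have "is_marking Z (\<lambda>c p. p \<notin> app z c ` FO I c)"
    unfolding is_marking_def using Z edge_not_Star edge_bobjs by blast
  then have "FO Z c \<subseteq> app z c ` FO I c"
    using unmarked[of "\<lambda>c p. p \<notin> app z c ` FO I c" c] c by blast
  then show ?thesis using Chat_app_in[OF z c] by blast
qed

lemma player_extension_iso:
  fixes X :: "'u::infinite psh"
  assumes I: "is_copower_star n I \<iota>" and a: "a \<in> hom Chat I X"
    and x0: "is_iso Chat x0" "x0 \<in> hom Chat (yo (Pl n)) X"
    and yd: "\<And>i. i \<in> {1..n} \<Longrightarrow> a \<odot> \<iota> i = x0 \<odot> yd n i"
    and z: "z \<in> hom Chat I Z" and po: "is_pushout Chat a z x zx" and x: "is_iso Chat x"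
  shows "is_iso Chat z"
proof (rule Chat_is_isoI[OF z])
  fix c assume c: "c \<in> bobjs"
  obtain w where w: "w \<in> hom Chat Z X" "w \<odot> z = a"
    using Chat.pushout_iso_universal_extension[OF po x a z] by metis
  obtain x0' where x0': "x0' \<in> hom Chat X (yo (Pl n))" "x0' \<odot> x0 = Ide Chat (yo (Pl n))"
    using Chat.is_isoE[OF x0] by metis
  have "inj_on (app (x0' \<odot> a) c) (FO I c)"
  proof (rule copower_into_player_inj[OF I Chat.cmp[OF a x0'(1)] _ c])
    fix i assume i: "i \<in> {1..n}"
    show "(x0' \<odot> a) \<odot> \<iota> i = yd n i"
      using Chat.assoc[OF copower_in[OF I i] a x0'(1)] yd[OF i]
        Chat.cancel_inverse_left[OF yd_hom[OF i] x0(2) x0'] by simp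
  qed
  moreover have "app (x0' \<odot> a) c p = app x0' c (app w c (app z c p))" if "p \<in> FO I c" for p
    using Chat_app_Cmp[OF a c that, of x0'] Chat_app_Cmp[OF z c that, of w] w(2) by simp
  ultimately have "inj_on (app z c) (FO I c)" by (metis (no_types, lifting) inj_on_def)
  moreover have "app z c ` FO I c = FO Z c"
    using copower_elements(1)[OF I] by (intro pushout_iso_surj[OF po x a z _ c]) blast
  ultimately show "bij_betw (app z c) (FO I c) (FO Z c)" by (simp add: bij_betw_def)
qed

lemma yo_Pl_iso_unique:
  fixes X :: "'u::infinite psh"
  assumes \<xi>: "is_iso Chat \<xi>" "\<xi> \<in> hom Chat (yo (Pl n)) X" and \<alpha>: "\<alpha> \<in> hom Chat (yo (Pl m)) X"
  shows "m = n" "\<alpha> = \<xi>"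
proof -
  obtain \<xi>' where \<xi>': "\<xi>' \<in> hom Chat X (yo (Pl n))" "\<xi> \<odot> \<xi>' = Ide Chat X"
    using Chat.is_isoE[OF \<xi>] by metis
  note unique = yo_Pl_hom_unique[OF Chat.cmp[OF \<alpha> \<xi>'(1)]]
  show "m = n" by (rule unique(1))
  have "\<alpha> = \<xi> \<odot> (\<xi>' \<odot> \<alpha>)" using Chat.cancel_inverse_left[OF \<alpha> \<xi>'(1) \<xi>(2) \<xi>'(2)] by simp
  also have "\<dots> = \<xi>" unfolding unique(2) by (rule Chat.ide_right[OF \<xi>(2)])
  finally show "\<alpha> = \<xi>" .
qed

lemma extended_basic_move_iso:
  fixes N :: "'u::infinite cospan"
  assumes ext: "extended basic_move N"
    and \<xi>: "is_iso Chat \<xi>" "\<xi> \<in> hom Chat (yo (Pl n)) (src (fst N))"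
  shows "\<exists>c n' u y. st_obj c n n' \<and> cospan_iso_by \<xi> u y (basic_cospan c n n') N"
proof -
  obtain M a b z x zx u zu y zy where N: "is_cospan N" and "basic_move M a b"
    and z: "z \<in> hom Chat (src a) (tgt z)"
    and po_x: "is_pushout Chat a z x zx" and "tgt x = src (fst N)"
    and po_u: "is_pushout Chat (fst M \<odot> a) z u zu" and "tgt u = tgt (fst N)"
    and po_y: "is_pushout Chat b z y zy" and "tgt y = src (snd N)"
    and squares: "fst N \<odot> x = u \<odot> fst M" "snd N \<odot> y = u \<odot> snd M"
    using ext unfolding extended_def by blast
  then obtain c m n' x0 u0 y0 I \<iota> where st: "st_obj c m n'"
    and M_iso: "cospan_iso_by x0 u0 y0 (basic_cospan c m n') M" and I: "is_copower_star m I \<iota>"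
    and a: "a \<in> hom Chat I (src (fst M))" and b: "b \<in> hom Chat I (src (snd M))"
    and yd: "\<And>i. i \<in> {1..m} \<Longrightarrow> a \<odot> \<iota> i = x0 \<odot> yd m i"
    unfolding basic_move_def by blast
  note ends = basic_cospan_ends[OF st, where 'u = 'u]
  have M: "is_cospan M" by (rule cospan_iso_by_cospan(2)[OF M_iso])
  note legs = cospan_hom[OF M]
  have x0: "is_iso Chat x0" "x0 \<in> hom Chat (yo (Pl m)) (src (fst M))"
    using cospan_iso_by_iso(1)[OF M_iso] cospan_iso_by_hom(1)[OF M_iso] ends by auto
  have z: "z \<in> hom Chat I (tgt z)" using z Chat_homD(2)[OF a] by simp
  note Ma = Chat.cmp[OF a legs(1)]
  have x: "x \<in> hom Chat (src (fst M)) (src (fst N))"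
    and u: "u \<in> hom Chat (tgt (fst M)) (tgt (fst N))"
    and y: "y \<in> hom Chat (src (snd M)) (src (snd N))"
    using Chat.pushout_homD(1)[OF po_x a z] Chat.pushout_homD(1)[OF po_u Ma z]
      Chat.pushout_homD(1)[OF po_y b z] \<open>tgt x = _\<close> \<open>tgt u = _\<close> \<open>tgt y = _\<close> by simp_all
  note xx0 = yo_Pl_iso_unique[OF \<xi> Chat.cmp[OF x0(2) x]]
  have x_iso: "is_iso Chat x" using Chat.is_iso_cancel_right[OF _ x0 x] xx0(2) \<xi>(1) by simp
  have z_iso: "is_iso Chat z" by (rule player_extension_iso[OF I a x0 yd z po_x x_iso])
  have "is_iso Chat u" "is_iso Chat y"
    using Chat.pushout_along_iso[OF po_u z_iso Ma z] Chat.pushout_along_iso[OF po_y z_iso b z] .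
  then have "cospan_iso_by x u y M N" by (intro cospan_iso_byI M N x_iso x u y squares)
  then have "cospan_iso_by (x \<odot> x0) (u \<odot> u0) (y \<odot> y0) (basic_cospan c m n') N"
    by (rule cospan_iso_by_trans[OF M_iso])
  then show ?thesis using st xx0 by auto
qed

subsection \<open>The basic moves of the base category\<close>

lemma position_Pl: "is_position (yo (Pl n) :: 'u::infinite psh)"
proof -
  have "FO (yo (Pl n) :: 'u psh) c = {}" if "c \<in> Ob Base - ({Star} \<union> range Pl)" for c
    using that by (intro FO_yo_Pl_other) auto
  moreover
  have "(SIGMA c : Ob Base. FO (yo (Pl n) :: 'u psh) c) \<subseteq>
      {Star} \<times> chan n ` {1..n} \<union> {(Pl n, unit_elt (Pl n))}"
  proof
    fix z assume "z \<in> (SIGMA c : Ob Base. FO (yo (Pl n) :: 'u psh) c)"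
    then obtain c x where z: "z = (c, x)" "c \<in> bobjs" "x \<in> FO (yo (Pl n)) c" by auto
    consider "c = Star" | "c = Pl n" | "c \<noteq> Star" "c \<noteq> Pl n" by blast
    then show "z \<in> {Star} \<times> chan n ` {1..n} \<union> {(Pl n, unit_elt (Pl n))}"
      using z by cases (auto simp: FO_yo_Pl_Star FO_yo_Pl FO_yo_Pl_other)
  qed
  then have "finite (SIGMA c : Ob Base. FO (yo (Pl n) :: 'u psh) c)" by (rule finite_subset) auto
  ultimately show ?thesis using yo_in[of "Pl n", where 'a = 'u] unfolding is_position_def by blast
qed

lemma basic_cospan_channels:
  assumes st: "st_obj c n n'" and i: "i \<in> {1..n}"
  shows "fst (basic_cospan c n n') \<odot> yd n i = snd (basic_cospan c n n') \<odot> (yd n' i :: 'u::infinite parr)"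
proof -
  have i': "i \<in> {1..n'}" using i st_obj_arity_le[OF st] by auto
  note bc = basic_cospan_hom[OF st, where 'u = 'u]
  note y = yd_hom[OF i, where 'a = 'u] yd_hom[OF i', where 'a = 'u]
  have elts: "elt (fst (basic_cospan c n n')) (Pl n) = gen_act (yo c) (Gs c) (unit_elt c :: 'u)"
    "elt (snd (basic_cospan c n n')) (Pl n') = gen_act (yo c) (Gt c) (unit_elt c :: 'u)"
    unfolding basic_cospan_def by (simp_all add: elt_yo_generator edge_s[OF st] edge_t[OF st])
  show ?thesis
  proof (rule yo_hom_eqI[OF Chat.cmp[OF y(1) bc(1)] Chat.cmp[OF y(2) bc(2)]])
    show "elt (fst (basic_cospan c n n') \<odot> yd n i) Star =
        elt (snd (basic_cospan c n n') \<odot> (yd n' i :: 'u parr)) Star"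
      unfolding elt_Cmp_generator[OF edge_d[OF i] bc(1)] elt_Cmp_generator[OF edge_d[OF i'] bc(2)] elts
      by (rule gen_act_channel[OF yo_in st i unit_elt_in[OF st_obj_bobjs[OF st]]])
  qed
qed

lemma basic_cospan_move:
  assumes st: "st_obj c n n'"
  obtains a b I where "basic_move (basic_cospan c n n' :: 'u::infinite cospan) a b" "is_position I"
    "a \<in> hom Chat I (yo (Pl n))" "b \<in> hom Chat I (yo (Pl n'))"
    "fst (basic_cospan c n n') \<odot> a = snd (basic_cospan c n n') \<odot> b"
proof -
  let ?M = "basic_cospan c n n' :: 'u cospan"
  note bc = basic_cospan_hom[OF st, where 'u = 'u] and ends = basic_cospan_ends[OF st, where 'u = 'u]
  note I = channels_copower[of n, where 'u = 'u]
  let ?I = "channels n :: 'u psh" and ?\<iota> = "\<lambda>i. elt_arr Star (channels n) (nat_elt i :: 'u)"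
  have i': "i \<in> {1..n'}" if "i \<in> {1..n}" for i using that st_obj_arity_le[OF st] by auto
  obtain a where a: "a \<in> hom Chat ?I (yo (Pl n))" "\<And>i. i \<in> {1..n} \<Longrightarrow> a \<odot> ?\<iota> i = yd n i"
    using copower_ex1[OF I yo_in, of "yd n" "Pl n"] yd_hom[of _ n, where 'a = 'u] by metis
  obtain b where b: "b \<in> hom Chat ?I (yo (Pl n'))" "\<And>i. i \<in> {1..n} \<Longrightarrow> b \<odot> ?\<iota> i = yd n' i"
    using copower_ex1[OF I yo_in, of "yd n'" "Pl n'"] yd_hom[OF i', where 'a = 'u] by metis
  have "cospan_iso_by (Ide Chat (yo (Pl n))) (Ide Chat (yo c)) (Ide Chat (yo (Pl n'))) ?M ?M"
    using cospan_iso_by_refl[OF ends(4)] by (simp add: ends)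
  moreover have "Ide Chat (yo (Pl m)) \<odot> yd m i = (yd m i :: 'u parr)" if "i \<in> {1..m}" for m i
    by (rule Chat.ide_left[OF yd_hom[OF that]])
  ultimately have "basic_move ?M a b"
    unfolding basic_move_def ends using st I a b i' by metis
  moreover have "fst ?M \<odot> a = snd ?M \<odot> b"
  proof (rule copower_eqI[OF I Chat.cmp[OF a(1) bc(1)] Chat.cmp[OF b(1) bc(2)]])
    fix i assume i: "i \<in> {1..n}"
    show "(fst ?M \<odot> a) \<odot> ?\<iota> i = (snd ?M \<odot> b) \<odot> ?\<iota> i"
      using Chat.assoc[OF copower_in[OF I i] a(1) bc(1)] Chat.assoc[OF copower_in[OF I i] b(1) bc(2)]
        a(2)[OF i] b(2)[OF i] basic_cospan_channels[OF st i, where 'u = 'u] by simp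
  qed
  ultimately show ?thesis using that channels_position a(1) b(1) by blast
qed

lemma extended_basic_cospan:
  assumes st: "st_obj c n n'"
  shows "extended basic_move (basic_cospan c n n' :: 'u::infinite cospan)"
proof -
  let ?M = "basic_cospan c n n' :: 'u cospan"
  note bc = basic_cospan_hom[OF st, where 'u = 'u] and ends = basic_cospan_ends[OF st, where 'u = 'u]
  obtain a b I where M: "basic_move ?M a b" and I: "is_position I"
    and a: "a \<in> hom Chat I (yo (Pl n))" and b: "b \<in> hom Chat I (yo (Pl n'))"
    and ab: "fst ?M \<odot> a = snd ?M \<odot> b"
    by (rule basic_cospan_move[OF st])
  have Ide_I: "Ide Chat I \<in> hom Chat I I" by (rule Chat.ide[OF Chat.hom_Ob(1)[OF a]])
  have tgt_Ide: "tgt (Ide Chat (yo d :: 'u psh)) = yo d" for d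
    by (rule Chat_homD(3)[OF Chat.ide[OF yo_in]])
  show ?thesis
    unfolding extended_def
  proof (intro conjI exI)
    show "is_cospan ?M" "basic_move ?M a b" by (fact ends(4), fact M)
    show "Ide Chat I \<in> hom Chat (src a) (tgt (Ide Chat I))" "is_position (tgt (Ide Chat I))"
      using Ide_I Chat_homD(2)[OF a] Chat_homD(3)[OF Ide_I] I by simp_all
    show "is_pushout Chat a (Ide Chat I) (Ide Chat (yo (Pl n))) a" by (rule Chat.pushout_Ide[OF a])
    show "is_pushout Chat (fst ?M \<odot> a) (Ide Chat I) (Ide Chat (yo c)) (fst ?M \<odot> a)"
      by (rule Chat.pushout_Ide[OF Chat.cmp[OF a bc(1)]])
    show "is_pushout Chat b (Ide Chat I) (Ide Chat (yo (Pl n'))) b" by (rule Chat.pushout_Ide[OF b])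
    show "tgt (Ide Chat (yo (Pl n))) = src (fst ?M)" "tgt (Ide Chat (yo c)) = tgt (fst ?M)"
      "tgt (Ide Chat (yo (Pl n'))) = src (snd ?M)"
      by (simp_all add: tgt_Ide ends)
    show "fst ?M \<odot> Ide Chat (yo (Pl n)) = Ide Chat (yo c) \<odot> fst ?M"
      "snd ?M \<odot> Ide Chat (yo (Pl n')) = Ide Chat (yo c) \<odot> snd ?M"
      using Chat.ide_left[OF bc(1)] Chat.ide_right[OF bc(1)] Chat.ide_left[OF bc(2)]
        Chat.ide_right[OF bc(2)] by simp_all
    show "fst ?M \<odot> a = fst ?M \<odot> a" "snd ?M \<odot> b = fst ?M \<odot> a" using ab by simp_all
  qed
qed

section \<open>Words of moves and their threads\<close>

fun composable :: "nat \<Rightarrow> bobj list \<Rightarrow> bool" where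
  "composable n [] \<longleftrightarrow> True"
| "composable n (c # cs) \<longleftrightarrow> st_obj c n (tgt_arity c) \<and> composable (tgt_arity c) cs"

definition arity_at :: "nat \<Rightarrow> bobj list \<Rightarrow> nat \<Rightarrow> nat" where
  "arity_at n cs k = (if k = 0 then n else tgt_arity (cs ! (k - 1)))"

lemma arity_at_0 [simp]: "arity_at n cs 0 = n"
  and arity_at_Suc [simp]: "arity_at n cs (Suc k) = tgt_arity (cs ! k)"
  by (simp_all add: arity_at_def)

lemma arity_at_snoc:
  "k \<le> length cs \<Longrightarrow> arity_at n (cs @ [c]) k = arity_at n cs k"
  by (auto simp: arity_at_def nth_append)

lemma composable_nth:
  "composable n cs \<Longrightarrow> k < length cs \<Longrightarrow> st_obj (cs ! k) (arity_at n cs k) (arity_at n cs (Suc k))"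
proof (induction cs arbitrary: n k)
  case (Cons c cs)
  show ?case
  proof (cases k)
    case (Suc l)
    have "arity_at n (c # cs) (Suc l) = arity_at (tgt_arity c) cs l" by (cases l) auto
    then show ?thesis using Cons Suc by auto
  qed (use Cons in auto)
qed simp

lemma composable_snoc:
  assumes "composable n cs" "st_obj c (arity_at n cs (length cs)) m"
  shows "composable n (cs @ [c])"
  using assms
proof (induction cs arbitrary: n)
  case Nil
  then show ?case using st_obj_arities by simp
next
  case (Cons b cs)
  have "arity_at n (b # cs) (length (b # cs)) = arity_at (tgt_arity b) cs (length cs)"
    by (cases cs) (simp_all add: arity_at_def)
  then show ?case using Cons by simp
qed

lemma arity_at_mono:
  "composable n cs \<Longrightarrow> k \<le> l \<Longrightarrow> l \<le> length cs \<Longrightarrow> arity_at n cs k \<le> arity_at n cs l"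
proof (induction l)
  case (Suc l)
  have "arity_at n cs l \<le> arity_at n cs (Suc l)"
    using st_obj_arity_le[OF composable_nth[OF Suc.prems(1)]] Suc.prems by simp
  then show ?case using Suc by (cases "k = Suc l") auto
qed simp

lemma
  assumes "composable n cs" "k < length cs"
  shows composable_edge_s: "edge (Pl (arity_at n cs k)) (Gs (cs ! k)) (cs ! k)"
    and composable_edge_t: "edge (Pl (arity_at n cs (Suc k))) (Gt (cs ! k)) (cs ! k)"
    and composable_bobjs: "cs ! k \<in> bobjs"
    and composable_height: "height (cs ! k) = 2"
  using composable_nth[OF assms] by (auto intro: edge_s edge_t st_obj_bobjs st_obj_height)

text \<open>A thread is the data of a map into \<open>X\<close> out of the view given by the word \<open>cs\<close>: the image \<open>x\<close> of the
  initial player and the images \<open>e k\<close> of the moves. \<open>player\<close> is the resulting sequence of players.\<close>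

definition player :: "'u psh \<Rightarrow> bobj list \<Rightarrow> 'u \<Rightarrow> (nat \<Rightarrow> 'u) \<Rightarrow> nat \<Rightarrow> 'u" where
  "player X cs x e k = (if k = 0 then x else gen_act X (Gt (cs ! (k - 1))) (e (k - 1)))"

definition thread :: "'u psh \<Rightarrow> nat \<Rightarrow> bobj list \<Rightarrow> 'u \<Rightarrow> (nat \<Rightarrow> 'u) \<Rightarrow> bool" where
  "thread X n cs x e \<longleftrightarrow> x \<in> FO X (Pl n) \<and>
    (\<forall>k<length cs. e k \<in> FO X (cs ! k) \<and> gen_act X (Gs (cs ! k)) (e k) = player X cs x e k)"

definition maps_thread ::
  "'u parr \<Rightarrow> nat \<Rightarrow> bobj list \<Rightarrow> 'u \<Rightarrow> (nat \<Rightarrow> 'u) \<Rightarrow> 'u \<Rightarrow> (nat \<Rightarrow> 'u) \<Rightarrow> bool" where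
  "maps_thread m n cs x e x' e' \<longleftrightarrow>
    app m (Pl n) x = x' \<and> (\<forall>k<length cs. app m (cs ! k) (e k) = e' k)"

definition universal_thread :: "'u psh \<Rightarrow> nat \<Rightarrow> bobj list \<Rightarrow> 'u \<Rightarrow> (nat \<Rightarrow> 'u::infinite) \<Rightarrow> bool" where
  "universal_thread V n cs x e \<longleftrightarrow> V \<in> Ob Chat \<and> composable n cs \<and> thread V n cs x e \<and>
    (\<forall>Q x' e'. Q \<in> Ob Chat \<longrightarrow> thread Q n cs x' e' \<longrightarrow>
      (\<exists>!m. m \<in> hom Chat V Q \<and> maps_thread m n cs x e x' e'))"

lemma player_0 [simp]: "player X cs x e 0 = x"
  and player_Suc [simp]: "player X cs x e (Suc k) = gen_act X (Gt (cs ! k)) (e k)"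
  by (simp_all add: player_def)

lemma threadD:
  assumes "thread X n cs x e"
  shows "x \<in> FO X (Pl n)" "k < length cs \<Longrightarrow> e k \<in> FO X (cs ! k)"
    "k < length cs \<Longrightarrow> gen_act X (Gs (cs ! k)) (e k) = player X cs x e k"
  using assms by (auto simp: thread_def)

lemma player_in:
  assumes "X \<in> Ob Chat" "composable n cs" "thread X n cs x e" "k \<le> length cs"
  shows "player X cs x e k \<in> FO X (Pl (arity_at n cs k))"
proof (cases k)
  case (Suc l)
  then show ?thesis
    using assms gen_act_in[OF assms(1) composable_edge_t[OF assms(2)]] threadD(2)[OF assms(3)]
    by simp
qed (use threadD(1)[OF assms(3)] in simp)

lemma app_player:
  assumes "m \<in> hom Chat X Y" "composable n cs" "thread X n cs x e" "k \<le> length cs"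
  shows "app m (Pl (arity_at n cs k)) (player X cs x e k) =
    player Y cs (app m (Pl n) x) (\<lambda>k. app m (cs ! k) (e k)) k"
proof (cases k)
  case (Suc l)
  then show ?thesis
    using assms app_gen_act[OF assms(1) composable_edge_t[OF assms(2)]] threadD(2)[OF assms(3)]
    by simp
qed simp

lemma thread_map:
  assumes m: "m \<in> hom Chat X Y" and comp: "composable n cs" and t: "thread X n cs x e"
  shows "thread Y n cs (app m (Pl n) x) (\<lambda>k. app m (cs ! k) (e k))"
  unfolding thread_def
proof (intro conjI allI impI)
  show "app m (Pl n) x \<in> FO Y (Pl n)" using Chat_app_in[OF m] threadD(1)[OF t] by simp
  fix k assume k: "k < length cs"
  note e = threadD(2,3)[OF t k]
  show "app m (cs ! k) (e k) \<in> FO Y (cs ! k)"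
    by (rule Chat_app_in[OF m composable_bobjs[OF comp k] e(1)])
  show "gen_act Y (Gs (cs ! k)) (app m (cs ! k) (e k)) =
      player Y cs (app m (Pl n) x) (\<lambda>k. app m (cs ! k) (e k)) k"
    using app_gen_act[OF m composable_edge_s[OF comp k] e(1)] e(2) app_player[OF m comp t, of k] k
    by simp
qed

lemma thread_cong:
  assumes "\<And>k. k < length cs \<Longrightarrow> e k = e' k"
  shows "thread X n cs x e \<longleftrightarrow> thread X n cs x e'"
proof -
  have "player X cs x e k = player X cs x e' k" if "k < length cs" for k
    using assms that by (cases k) auto
  then show ?thesis using assms by (simp add: thread_def)
qed

lemma thread_prefix:
  assumes "thread X n cs' x e" "prefix cs cs'"
  shows "thread X n cs x e"
proof -
  have nth: "cs' ! k = cs ! k \<and> k < length cs'" if "k < length cs" for k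
    using assms(2) that by (auto simp: prefix_def nth_append)
  moreover have "player X cs' x e k = player X cs x e k" if "k < length cs" for k
    using that nth by (cases k) auto
  ultimately show ?thesis using assms(1) unfolding thread_def by metis
qed

lemma thread_channels:
  assumes X: "X \<in> Ob Chat" and comp: "composable n cs" and t: "thread X n cs x e"
    and k: "k \<le> l" "l \<le> length cs" and i: "i \<in> {1..arity_at n cs k}"
  shows "gen_act X (Gd (arity_at n cs k) i) (player X cs x e k) =
    gen_act X (Gd (arity_at n cs l) i) (player X cs x e l)"
  using k
proof (induction l)
  case (Suc l)
  show ?case
  proof (cases "k = Suc l")
    case False
    then have kl: "k \<le> l" "l \<le> length cs" and l: "l < length cs" using Suc.prems by auto
    have i': "i \<in> {1..arity_at n cs l}" using i arity_at_mono[OF comp kl] by auto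
    show ?thesis
      using Suc.IH[OF kl] gen_act_channel[OF X composable_nth[OF comp l] i' threadD(2)[OF t l]]
        threadD(3)[OF t l] by simp
  qed simp
qed simp

lemma universal_threadD:
  assumes "universal_thread V n cs x e"
  shows "V \<in> Ob Chat" "composable n cs" "thread V n cs x e"
  using assms by (simp_all add: universal_thread_def)

lemma universal_thread_ex1:
  "universal_thread V n cs x e \<Longrightarrow> Q \<in> Ob Chat \<Longrightarrow> thread Q n cs x' e' \<Longrightarrow>
    \<exists>!m. m \<in> hom Chat V Q \<and> maps_thread m n cs x e x' e'"
  by (simp add: universal_thread_def)

lemma universal_thread_hom_eqI:
  assumes V: "universal_thread V n cs x e" and m: "m \<in> hom Chat V Q" and m': "m' \<in> hom Chat V Q"
    and "app m (Pl n) x = app m' (Pl n) x"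
    and "\<And>k. k < length cs \<Longrightarrow> app m (cs ! k) (e k) = app m' (cs ! k) (e k)"
  shows "m = m'"
  using universal_thread_ex1[OF V Chat.hom_Ob(2)[OF m] thread_map[OF m universal_threadD(2,3)[OF V]]]
    assms unfolding maps_thread_def by metis

lemma universal_thread_cong:
  assumes "\<And>k. k < length cs \<Longrightarrow> e k = e' k"
  shows "universal_thread V n cs x e \<longleftrightarrow> universal_thread V n cs x e'"
  using assms thread_cong[of cs e e'] by (simp add: universal_thread_def maps_thread_def)

subsection \<open>The view of a word\<close>

fun word_view_elts :: "nat \<Rightarrow> bobj list \<Rightarrow> bobj \<Rightarrow> nat set" where
  "word_view_elts n cs Star = {1..arity_at n cs (length cs)}"
| "word_view_elts n cs (Pl m) = {k. k \<le> length cs \<and> arity_at n cs k = m}"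
| "word_view_elts n cs c = {k. k < length cs \<and> cs ! k = c}"

fun word_view_act :: "gen \<Rightarrow> nat \<Rightarrow> nat" where
  "word_view_act (Gd n i) k = i" | "word_view_act (Gt c) k = Suc k" | "word_view_act _ k = k"

lemma word_view_elts_move: "height c \<ge> 2 \<Longrightarrow> word_view_elts n cs c = {k. k < length cs \<and> cs ! k = c}"
  by (cases c) auto

lemma word_view_action:
  assumes comp: "composable n cs"
  shows "gen_action (word_view_elts n cs) word_view_act"
proof
  have move: "k < length cs \<and> cs ! k = c" if "st_obj c m m'" "k \<in> word_view_elts n cs c" for c m m' k
    using that st_obj_height[OF that(1)] by (auto simp: word_view_elts_move)
  have empty: "k \<notin> word_view_elts n cs c" if "height c = 3" for k c
    using that composable_height[OF comp, of k] by (auto simp: word_view_elts_move)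
  show "word_view_act g x \<in> word_view_elts n cs a"
    if "edge a g b" "x \<in> word_view_elts n cs b" for a g b x
    using that
  proof (induction rule: edge.induct)
    case (1 i m)
    then show ?case using arity_at_mono[OF comp, of x "length cs"] by auto
  next
    case (2 c m m')
    then show ?case
      using move[OF 2] st_obj_arities[OF 2(1)] st_obj_arities[OF composable_nth[OF comp, of x]]
      by auto
  next
    case (3 c m m')
    then show ?case using move[OF 3] st_obj_arities[OF 3(1)] by auto
  qed (use composable_height[OF comp, of x] in auto)
  show "path_act word_view_act u x = path_act word_view_act v x"
    if "brel u v" "bpath a u b" "x \<in> word_view_elts n cs b" for u v a b x
    using that
  proof (induction rule: brel.induct)
    case (3 i n' j m)
    then have "b = Tau n' i m j" using bpath_bobjs by (auto simp: bpath_Cons)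
    then show ?case using 3 empty[of b x] by simp
  qed (auto simp: path_act_def)
qed

definition word_view :: "nat \<Rightarrow> bobj list \<Rightarrow> 'u::infinite psh" where
  "word_view n cs = nat_psh (word_view_elts n cs) word_view_act"

lemma word_view_in: "composable n cs \<Longrightarrow> word_view n cs \<in> Ob Chat"
  unfolding word_view_def by (rule gen_action.nat_psh_in[OF word_view_action])

lemma FO_word_view:
  "composable n cs \<Longrightarrow> c \<in> bobjs \<Longrightarrow> FO (word_view n cs) c = nat_elt ` word_view_elts n cs c"
  unfolding word_view_def by (rule gen_action.FO_nat_psh[OF word_view_action])

lemma gen_act_word_view:
  "composable n cs \<Longrightarrow> edge a g b \<Longrightarrow> k \<in> word_view_elts n cs b \<Longrightarrow>
    gen_act (word_view n cs) g (nat_elt k) = nat_elt (word_view_act g k)"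
  unfolding word_view_def by (rule gen_action.gen_act_nat_psh[OF word_view_action])

lemma word_view_elts_nth: "composable n cs \<Longrightarrow> k < length cs \<Longrightarrow> k \<in> word_view_elts n cs (cs ! k)"
  by (simp add: composable_height word_view_elts_move)

lemma
  assumes comp: "composable n cs" and k: "k < length cs"
  shows gen_act_word_view_s: "gen_act (word_view n cs) (Gs (cs ! k)) (nat_elt k) = (nat_elt k :: 'u::infinite)"
    and gen_act_word_view_t: "gen_act (word_view n cs) (Gt (cs ! k)) (nat_elt k) = (nat_elt (Suc k) :: 'u)"
  using gen_act_word_view[OF comp composable_edge_s[OF comp k] word_view_elts_nth[OF comp k]]
    gen_act_word_view[OF comp composable_edge_t[OF comp k] word_view_elts_nth[OF comp k]] by simp_all

lemma player_word_view:
  "composable n cs \<Longrightarrow> k \<le> length cs \<Longrightarrow> player (word_view n cs) cs (nat_elt 0) nat_elt k = nat_elt k"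
  by (cases k) (simp_all add: gen_act_word_view_t)

lemma thread_word_view: "composable n cs \<Longrightarrow> thread (word_view n cs) n cs (nat_elt 0) nat_elt"
  by (auto simp: thread_def FO_word_view composable_bobjs word_view_elts_nth player_word_view
      gen_act_word_view_s)

lemma word_view_cases:
  assumes comp: "composable n cs" and c: "c \<in> bobjs" and x: "x \<in> FO (word_view n cs) c"
  obtains (channel) i where "c = Star" "x = nat_elt i" "i \<in> {1..arity_at n cs (length cs)}"
  | (player) k where "c = Pl (arity_at n cs k)" "x = nat_elt k" "k \<le> length cs"
  | (move) k where "c = cs ! k" "x = nat_elt k" "k < length cs"
proof -
  obtain k where k: "x = nat_elt k" "k \<in> word_view_elts n cs c"
    using x by (auto simp: FO_word_view[OF comp c])
  consider "c = Star" | m where "c = Pl m" | "height c \<ge> 2" by (cases c) auto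
  then show ?thesis
  proof cases
    case 3
    then show ?thesis using k that(3)[of k] by (simp add: word_view_elts_move)
  qed (use k that(1,2)[of k] in auto)
qed

definition thread_elt :: "'u psh \<Rightarrow> nat \<Rightarrow> bobj list \<Rightarrow> 'u \<Rightarrow> (nat \<Rightarrow> 'u) \<Rightarrow> bobj \<Rightarrow> nat \<Rightarrow> 'u" where
  "thread_elt Q n cs x e c k = (case c of
      Star \<Rightarrow> gen_act Q (Gd (arity_at n cs (length cs)) k) (player Q cs x e (length cs))
    | Pl _ \<Rightarrow> player Q cs x e k
    | _ \<Rightarrow> e k)"

lemma thread_elt_simps [simp]:
  "thread_elt Q n cs x e Star k =
    gen_act Q (Gd (arity_at n cs (length cs)) k) (player Q cs x e (length cs))"
  "thread_elt Q n cs x e (Pl m) k = player Q cs x e k"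
  by (simp_all add: thread_elt_def)

lemma thread_elt_move: "height c \<ge> 2 \<Longrightarrow> thread_elt Q n cs x e c k = e k"
  by (cases c) (auto simp: thread_elt_def)

lemma thread_elt_in:
  assumes Q: "Q \<in> Ob Chat" and comp: "composable n cs" and t: "thread Q n cs x e"
    and c: "c \<in> bobjs" and k: "nat_elt k \<in> FO (word_view n cs :: 'u::infinite psh) c"
  shows "thread_elt Q n cs x e c k \<in> FO Q c"
  using comp c k
proof (cases rule: word_view_cases)
  case (channel i)
  then show ?thesis using gen_act_in[OF Q edge_d player_in[OF Q comp t]] by simp
next
  case (player l)
  then show ?thesis using player_in[OF Q comp t] by simp
next
  case (move l)
  then show ?thesis using threadD(2)[OF t] composable_height[OF comp] by (simp add: thread_elt_move)
qed

lemma thread_elt_gen_act: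
  assumes Q: "Q \<in> Ob Chat" and comp: "composable n cs" and t: "thread Q n cs x e"
    and "edge a g b" "k \<in> word_view_elts n cs b"
  shows "thread_elt Q n cs x e a (word_view_act g k) = gen_act Q g (thread_elt Q n cs x e b k)"
  using assms(4,5)
proof (induction rule: edge.induct)
  case (1 i m)
  then show ?case using thread_channels[OF Q comp t, of k "length cs" i] by auto
next
  case (2 c m m')
  then have "k < length cs" "cs ! k = c" using st_obj_height[OF 2(1)]
    by (auto simp: word_view_elts_move)
  then show ?case using st_obj_height[OF 2(1)] threadD(3)[OF t] by (auto simp: thread_elt_move)
next
  case (3 c m m')
  then have "k < length cs" "cs ! k = c" using st_obj_height[OF 3(1)]
    by (auto simp: word_view_elts_move)
  then show ?case using st_obj_height[OF 3(1)] by (auto simp: thread_elt_move)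
qed (use composable_height[OF comp, of k] in auto)

lemma thread_induces_map:
  fixes Q :: "'u::infinite psh"
  assumes Q: "Q \<in> Ob Chat" and comp: "composable n cs" and t: "thread Q n cs x e"
  shows "\<exists>m\<in>hom Chat (word_view n cs) Q. maps_thread m n cs (nat_elt 0) nat_elt x e"
proof
  let ?W = "word_view n cs :: 'u psh"
  let ?m = "mk_psh_arr Base ?W (\<lambda>c y. thread_elt Q n cs x e c (inv nat_elt y)) Q"
  show "?m \<in> hom Chat ?W Q"
  proof (rule Chat_homI[OF word_view_in[OF comp] Q])
    fix c y assume c: "c \<in> bobjs" and y: "y \<in> FO ?W c"
    then obtain k where "y = nat_elt k" by (auto simp: FO_word_view[OF comp])
    then show "thread_elt Q n cs x e c (inv nat_elt y) \<in> FO Q c"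
      using thread_elt_in[OF Q comp t c] y by simp
  next
    fix a g b y assume edge: "edge a g b" and "y \<in> FO ?W b"
    then obtain k where "y = nat_elt k" "k \<in> word_view_elts n cs b"
      using edge_bobjs by (auto simp: FO_word_view[OF comp])
    then show "thread_elt Q n cs x e a (inv nat_elt (gen_act ?W g y)) =
        gen_act Q g (thread_elt Q n cs x e b (inv nat_elt y))"
      using thread_elt_gen_act[OF Q comp t edge] by (simp add: gen_act_word_view[OF comp edge])
  qed
  show "maps_thread ?m n cs (nat_elt 0) nat_elt x e"
    unfolding maps_thread_def
    using composable_bobjs[OF comp] word_view_elts_nth[OF comp] composable_height[OF comp]
    by (auto simp: FO_word_view[OF comp] thread_elt_move)
qed

lemma word_view_hom_eqI:
  fixes m m' :: "'u::infinite parr"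
  assumes comp: "composable n cs" and m: "m \<in> hom Chat (word_view n cs) Q"
    and m': "m' \<in> hom Chat (word_view n cs) Q"
    and origin: "app m (Pl n) (nat_elt 0) = app m' (Pl n) (nat_elt 0)"
    and moves: "\<And>k. k < length cs \<Longrightarrow> app m (cs ! k) (nat_elt k) = app m' (cs ! k) (nat_elt k)"
  shows "m = m'"
proof (rule Chat_hom_eqI[OF m m'])
  let ?W = "word_view n cs :: 'u psh"
  have players: "app m (Pl (arity_at n cs k)) (nat_elt k) = app m' (Pl (arity_at n cs k)) (nat_elt k)"
    if k: "k \<le> length cs" for k
  proof -
    have "player Q cs (app m (Pl n) (nat_elt 0)) (\<lambda>k. app m (cs ! k) (nat_elt k)) k =
        player Q cs (app m' (Pl n) (nat_elt 0)) (\<lambda>k. app m' (cs ! k) (nat_elt k)) k"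
      using k origin moves by (cases k) auto
    then show ?thesis
      using app_player[OF m comp thread_word_view[OF comp] k]
        app_player[OF m' comp thread_word_view[OF comp] k] by (simp add: player_word_view[OF comp k])
  qed
  fix c x assume c: "c \<in> bobjs" and x: "x \<in> FO ?W c"
  from comp c x show "app m c x = app m' c x"
  proof (cases rule: word_view_cases)
    case (channel i)
    let ?N = "length cs"
    have N: "nat_elt ?N \<in> FO ?W (Pl (arity_at n cs ?N))" by (simp add: FO_word_view[OF comp])
    have "x = gen_act ?W (Gd (arity_at n cs ?N) i) (nat_elt ?N)"
      using channel gen_act_word_view[OF comp edge_d[OF channel(3)], where 'a = 'u] by simp
    then show ?thesis
      using app_gen_act[OF m edge_d[OF channel(3)] N] app_gen_act[OF m' edge_d[OF channel(3)] N]
        players[of ?N] channel(1) by simp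
  next
    case (player k)
    then show ?thesis using players by simp
  next
    case (move k)
    then show ?thesis using moves by simp
  qed
qed

lemma universal_thread_word_view:
  assumes comp: "composable n cs"
  shows "universal_thread (word_view n cs :: 'u::infinite psh) n cs (nat_elt 0) nat_elt"
proof -
  have "\<exists>!m. m \<in> hom Chat (word_view n cs) Q \<and> maps_thread m n cs (nat_elt 0) nat_elt x e"
    if Q: "Q \<in> Ob Chat" and t: "thread Q n cs x e" for Q :: "'u psh" and x e
  proof -
    obtain m where m: "m \<in> hom Chat (word_view n cs) Q" "maps_thread m n cs (nat_elt 0) nat_elt x e"
      using thread_induces_map[OF Q comp t] by blast
    then show ?thesis
    proof (intro ex1I[of _ m] conjI)
      fix m'
      assume m': "m' \<in> hom Chat (word_view n cs) Q \<and> maps_thread m' n cs (nat_elt 0) nat_elt x e"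
      show "m' = m"
        by (rule word_view_hom_eqI[OF comp conjunct1[OF m'] m(1)])
          (use m' m(2) in \<open>simp_all add: maps_thread_def\<close>)
    qed
  qed
  then show ?thesis
    using word_view_in[OF comp] comp thread_word_view[OF comp] by (simp add: universal_thread_def)
qed

subsection \<open>Maps between views\<close>

lemma thread_into_word_view_nth:
  assumes comp: "composable n cs" "composable n cs'"
    and t: "thread (word_view n cs') n cs (nat_elt 0 :: 'u::infinite) e" and k: "k < length cs"
  shows "e k = nat_elt k \<and> k < length cs' \<and> cs' ! k = cs ! k"
proof -
  let ?W = "word_view n cs' :: 'u psh"
  have step: "e k = nat_elt k \<and> k < length cs' \<and> cs' ! k = cs ! k"
    if k: "k < length cs" and player: "player ?W cs (nat_elt 0) e k = nat_elt k" for k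
  proof -
    note bobj = composable_bobjs[OF comp(1) k]
    obtain j where j: "e k = nat_elt j" "j \<in> word_view_elts n cs' (cs ! k)"
      using threadD(2)[OF t k] by (auto simp: FO_word_view[OF comp(2) bobj])
    have "nat_elt j = (nat_elt k :: 'u)"
      using gen_act_word_view[OF comp(2) composable_edge_s[OF comp(1) k] j(2), where 'a = 'u]
        threadD(3)[OF t k] j(1) player by simp
    then show ?thesis using j by (simp add: word_view_elts_move composable_height[OF comp(1) k])
  qed
  show ?thesis
    using k
  proof (induction k)
    case 0
    then show ?case using step[of 0] by simp
  next
    case (Suc k)
    then have "e k = nat_elt k" "k < length cs'" "cs' ! k = cs ! k" by auto
    then have "player ?W cs (nat_elt 0) e (Suc k) = nat_elt (Suc k)"
      using gen_act_word_view_t[OF comp(2), of k, where 'u = 'u] by simp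
    then show ?case using step Suc.prems by blast
  qed
qed

lemma thread_into_word_view_prefix:
  assumes "composable n cs" "composable n cs'"
    and "thread (word_view n cs') n cs (nat_elt 0 :: 'u::infinite) e"
  shows "prefix cs cs'"
proof -
  note nth = thread_into_word_view_nth[OF assms]
  have "length cs \<le> length cs'"
  proof (cases "length cs")
    case (Suc l)
    then show ?thesis using nth[of l] by simp
  qed simp
  then have "take (length cs) cs' = cs" using nth by (intro nth_equalityI) auto
  then show ?thesis by (metis take_is_prefix)
qed

lemma universal_thread_to_word_view:
  fixes V :: "'u::infinite psh"
  assumes V: "universal_thread V n cs x e"
  obtains r where "r \<in> hom Chat V (word_view n cs)" "maps_thread r n cs x e (nat_elt 0) nat_elt"
    "\<And>c. c \<in> bobjs \<Longrightarrow> inj_on (app r c) (FO V c)"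
proof -
  note comp = universal_threadD(2)[OF V] and t = universal_threadD(3)[OF V]
  obtain r where r: "r \<in> hom Chat V (word_view n cs)" "maps_thread r n cs x e (nat_elt 0) nat_elt"
    using universal_thread_ex1[OF V word_view_in[OF comp] thread_word_view[OF comp]] by blast
  obtain s where s: "s \<in> hom Chat (word_view n cs) V" "maps_thread s n cs (nat_elt 0) nat_elt x e"
    using universal_thread_ex1[OF universal_thread_word_view[OF comp] universal_threadD(1)[OF V] t]
    by blast
  have "s \<odot> r = Ide Chat V"
  proof (rule universal_thread_hom_eqI[OF V Chat.cmp[OF r(1) s(1)] Chat.ide[OF universal_threadD(1)[OF V]]])
    show "app (s \<odot> r) (Pl n) x = app (Ide Chat V) (Pl n) x"
      using r(2) s(2) threadD(1)[OF t]
      by (simp add: Chat_app_Cmp[OF r(1)] Chat_app_Ide maps_thread_def)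
    show "app (s \<odot> r) (cs ! k) (e k) = app (Ide Chat V) (cs ! k) (e k)" if "k < length cs" for k
      using r(2) s(2) threadD(2)[OF t that] composable_bobjs[OF comp that] that
      by (simp add: Chat_app_Cmp[OF r(1)] Chat_app_Ide maps_thread_def)
  qed
  then have "app s c (app r c y) = y" if "c \<in> bobjs" "y \<in> FO V c" for c y
    using Chat_app_Cmp[OF r(1) that, of s] Chat_app_Ide[OF that] by simp
  then have "inj_on (app r c) (FO V c)" if "c \<in> bobjs" for c
    using that by (intro inj_on_inverseI[where g = "app s c"])
  then show ?thesis using that r by blast
qed

lemma universal_thread_hom_iff_prefix:
  fixes V :: "'u::infinite psh"
  assumes V: "universal_thread V n cs x e" and V': "universal_thread V' n cs' x' e'"
  shows "(\<exists>m\<in>hom Chat V V'. app m (Pl n) x = x') \<longleftrightarrow> prefix cs cs'"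
proof
  note t = universal_threadD(2,3)[OF V] and t' = universal_threadD[OF V']
  assume "\<exists>m\<in>hom Chat V V'. app m (Pl n) x = x'"
  then obtain m where m: "m \<in> hom Chat V V'" "app m (Pl n) x = x'" by blast
  obtain r where r: "r \<in> hom Chat V' (word_view n cs')" "maps_thread r n cs' x' e' (nat_elt 0) nat_elt"
    by (rule universal_thread_to_word_view[OF V'])
  have "thread (word_view n cs') n cs (nat_elt 0) (\<lambda>k. app (r \<odot> m) (cs ! k) (e k))"
    using thread_map[OF Chat.cmp[OF m(1) r(1)] t] threadD(1)[OF t(2)] m(2) r(2)
    by (simp add: Chat_app_Cmp[OF m(1)] maps_thread_def)
  then show "prefix cs cs'" by (rule thread_into_word_view_prefix[OF t(1) t'(2)])
next
  assume "prefix cs cs'"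
  then have "thread V' n cs x' e'" by (rule thread_prefix[OF universal_threadD(3)[OF V']])
  from universal_thread_ex1[OF V universal_threadD(1)[OF V'] this]
  show "\<exists>m\<in>hom Chat V V'. app m (Pl n) x = x'" by (auto simp: maps_thread_def)
qed

lemma universal_thread_hom_unique:
  fixes V :: "'u::infinite psh"
  assumes V: "universal_thread V n cs x e" and V': "universal_thread V' n cs' x' e'"
    and m: "m \<in> hom Chat V V'" "app m (Pl n) x = x'"
    and m': "m' \<in> hom Chat V V'" "app m' (Pl n) x = x'"
  shows "m = m'"
proof (rule universal_thread_hom_eqI[OF V m(1) m'(1)])
  note comp = universal_threadD(2)[OF V] and t = universal_threadD(3)[OF V]
  obtain r where r: "r \<in> hom Chat V' (word_view n cs')" "maps_thread r n cs' x' e' (nat_elt 0) nat_elt"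
    and inj: "\<And>c. c \<in> bobjs \<Longrightarrow> inj_on (app r c) (FO V' c)"
    by (rule universal_thread_to_word_view[OF V']) blast
  show "app m (Pl n) x = app m' (Pl n) x" using m(2) m'(2) by simp
  fix k assume k: "k < length cs"
  note bobj = composable_bobjs[OF comp k] and e = threadD(2)[OF t k]
  have "app r (cs ! k) (app f (cs ! k) (e k)) = nat_elt k"
    if f: "f \<in> hom Chat V V'" "app f (Pl n) x = x'" for f
  proof -
    have "thread (word_view n cs') n cs (nat_elt 0) (\<lambda>k. app (r \<odot> f) (cs ! k) (e k))"
      using thread_map[OF Chat.cmp[OF f(1) r(1)] comp t] threadD(1)[OF t] f(2) r(2)
      by (simp add: Chat_app_Cmp[OF f(1)] maps_thread_def)
    from thread_into_word_view_nth[OF comp universal_threadD(2)[OF V'] this k] show ?thesis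
      using bobj e by (simp add: Chat_app_Cmp[OF f(1)])
  qed
  then show "app m (cs ! k) (e k) = app m' (cs ! k) (e k)"
    using inj_onD[OF inj[OF bobj]] Chat_app_in[OF m(1) bobj e] Chat_app_in[OF m'(1) bobj e] m m'
    by simp
qed

lemma universal_thread_word_unique:
  fixes V :: "'u::infinite psh"
  assumes V: "universal_thread V n cs x e" and V': "universal_thread V n cs' x e'"
  shows "cs = cs'"
proof -
  have "Ide Chat V \<in> hom Chat V V" "app (Ide Chat V) (Pl n) x = x"
    using Chat.ide[OF universal_threadD(1)[OF V]] threadD(1)[OF universal_threadD(3)[OF V]]
    by (auto simp: Chat_app_Ide)
  then have "prefix cs cs'" "prefix cs' cs"
    using universal_thread_hom_iff_prefix[OF V V'] universal_thread_hom_iff_prefix[OF V' V] by blast+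
  then show ?thesis by (rule prefix_order.antisym)
qed

section \<open>Views as words of moves\<close>

subsection \<open>Colimits of zigzags of cospans\<close>

definition zigzag_cocone :: "nat \<Rightarrow> (nat \<Rightarrow> 'u psh) \<Rightarrow> (nat \<Rightarrow> 'u cospan) \<Rightarrow> 'u psh \<Rightarrow>
    (nat + nat \<Rightarrow> 'u parr) \<Rightarrow> bool" where
  "zigzag_cocone N X M Q r \<longleftrightarrow> Q \<in> Ob Chat \<and> (\<forall>k\<le>N. r (Inl k) \<in> hom Chat (X k) Q) \<and>
    (\<forall>k<N. r (Inr k) \<in> hom Chat (tgt (fst (M k))) Q \<and>
      r (Inr k) \<odot> fst (M k) = r (Inl k) \<and> r (Inr k) \<odot> snd (M k) = r (Inl (Suc k)))"

definition zigzag_arr where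
  "zigzag_arr N m q r \<longleftrightarrow> (\<forall>k\<le>N. m \<odot> q (Inl k) = r (Inl k)) \<and> (\<forall>k<N. m \<odot> q (Inr k) = r (Inr k))"

definition zigzag_colimit where
  "zigzag_colimit N X M V q \<longleftrightarrow> zigzag_cocone N X M V q \<and>
    (\<forall>Q r. zigzag_cocone N X M Q r \<longrightarrow> (\<exists>!m. m \<in> hom Chat V Q \<and> zigzag_arr N m q r))"

lemma is_colimit_zigzag_iff:
  fixes X :: "nat \<Rightarrow> 'u psh"
  assumes X: "\<And>k. k \<le> N \<Longrightarrow> X k \<in> Ob Chat"
    and M: "\<And>k. k < N \<Longrightarrow> is_cospan (M k) \<and> src (fst (M k)) = X k \<and> src (snd (M k)) = X (Suc k)"
  shows "is_colimit Chat (Inl ` {k. enat k \<le> enat N} \<union> Inr ` {k. enat k < enat N})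
      (case_sum X (\<lambda>k. tgt (fst (M k))))
      ((\<lambda>k. (Inl k, Inr k, fst (M k))) ` {k. enat k < enat N} \<union>
       (\<lambda>k. (Inl (Suc k), Inr k, snd (M k))) ` {k. enat k < enat N}) V q \<longleftrightarrow>
    zigzag_colimit N X M V q"
proof -
  let ?J = "Inl ` {k. k \<le> N} \<union> Inr ` {k. k < N} :: (nat + nat) set"
  let ?D = "case_sum X (\<lambda>k. tgt (fst (M k)))"
  let ?E = "(\<lambda>k. (Inl k, Inr k, fst (M k))) ` {k. k < N} \<union>
    (\<lambda>k. (Inl (Suc k), Inr k, snd (M k))) ` {k. k < N} :: ((nat + nat) \<times> (nat + nat) \<times> 'u parr) set"
  have legs: "fst (M k) \<in> hom Chat (X k) (tgt (fst (M k)))"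
    "snd (M k) \<in> hom Chat (X (Suc k)) (tgt (fst (M k)))" if "k < N" for k
    using cospan_hom[of "M k"] M[OF that] by auto
  have nodes: "\<forall>j\<in>?J. ?D j \<in> Ob Chat" using X Chat.hom_Ob(2)[OF legs(1)] by auto
  have edges: "\<forall>(j, k, f)\<in>?E. j \<in> ?J \<and> k \<in> ?J \<and> f \<in> hom Chat (?D j) (?D k)"
    using legs by auto
  have cocone_iff: "is_cocone Chat ?J ?D ?E Q r \<longleftrightarrow> zigzag_cocone N X M Q r" for Q r
    by (auto simp: is_cocone_def zigzag_cocone_def ball_Un)
  have arr_iff: "(\<forall>j\<in>?J. m \<odot> q j = r j) \<longleftrightarrow> zigzag_arr N m q r" for m r
    by (auto simp: zigzag_arr_def)
  show ?thesis
    unfolding is_colimit_def zigzag_colimit_def enat_ord_simps cocone_iff arr_iff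
    using nodes edges by (intro iffI; elim conjE; intro conjI)
qed

subsection \<open>Chains of moves along a word\<close>

locale word_chain =
  fixes n :: nat and cs :: "bobj list" and X :: "nat \<Rightarrow> 'u::infinite psh" and M :: "nat \<Rightarrow> 'u cospan"
    and \<xi> u :: "nat \<Rightarrow> 'u parr"
  assumes composable: "composable n cs"
    and \<xi>_iso: "k \<le> length cs \<Longrightarrow> is_iso Chat (\<xi> k)"
    and \<xi>_hom: "k \<le> length cs \<Longrightarrow> \<xi> k \<in> hom Chat (yo (Pl (arity_at n cs k))) (X k)"
    and src_fst: "k < length cs \<Longrightarrow> src (fst (M k)) = X k"
    and src_snd: "k < length cs \<Longrightarrow> src (snd (M k)) = X (Suc k)"
    and move_iso: "k < length cs \<Longrightarrow> cospan_iso_by (\<xi> k) (u k) (\<xi> (Suc k))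
      (basic_cospan (cs ! k) (arity_at n cs k) (arity_at n cs (Suc k))) (M k)"
begin

abbreviation N where "N \<equiv> length cs"

definition origin :: "(nat + nat \<Rightarrow> 'u parr) \<Rightarrow> 'u" where
  "origin r = elt (r (Inl 0) \<odot> \<xi> 0) (Pl n)"

definition moves :: "(nat + nat \<Rightarrow> 'u parr) \<Rightarrow> nat \<Rightarrow> 'u" where
  "moves r k = elt (r (Inr k) \<odot> u k) (cs ! k)"

lemma is_cospan_move: "k < N \<Longrightarrow> is_cospan (M k)"
  by (rule cospan_iso_by_cospan(2)[OF move_iso])

lemma fst_hom: "k < N \<Longrightarrow> fst (M k) \<in> hom Chat (X k) (tgt (fst (M k)))"
  and snd_hom: "k < N \<Longrightarrow> snd (M k) \<in> hom Chat (X (Suc k)) (tgt (fst (M k)))"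
  using cospan_hom[OF is_cospan_move] src_fst src_snd by auto

lemma u_iso: "k < N \<Longrightarrow> is_iso Chat (u k)"
  by (rule cospan_iso_by_iso(2)[OF move_iso])

lemma u_hom: "k < N \<Longrightarrow> u k \<in> hom Chat (yo (cs ! k)) (tgt (fst (M k)))"
  using cospan_iso_by_hom(2)[OF move_iso]
    basic_cospan_ends(2)[OF composable_nth[OF composable], where 'u = 'u]
  by simp

lemma elt_source:
  assumes k: "k < N" and r: "r \<in> hom Chat (tgt (fst (M k))) Q"
  shows "elt ((r \<odot> fst (M k)) \<odot> \<xi> k) (Pl (arity_at n cs k)) =
    gen_act Q (Gs (cs ! k)) (elt (r \<odot> u k) (cs ! k))"
proof -
  note edge = composable_edge_s[OF composable k]
  let ?s = "yo_path (Pl (arity_at n cs k)) [Gs (cs ! k)] (cs ! k)"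
  have "(r \<odot> fst (M k)) \<odot> \<xi> k = r \<odot> (u k \<odot> ?s)"
    using Chat.assoc[OF \<xi>_hom fst_hom[OF k] r] cospan_iso_by_commute(1)[OF move_iso[OF k]] k
    by (simp add: basic_cospan_def)
  also have "\<dots> = (r \<odot> u k) \<odot> ?s" by (rule Chat.assoc[OF yo_generator_hom[OF edge] u_hom[OF k] r])
  finally show ?thesis using elt_Cmp_generator[OF edge Chat.cmp[OF u_hom[OF k] r]] by simp
qed

lemma elt_target:
  assumes k: "k < N" and r: "r \<in> hom Chat (tgt (fst (M k))) Q"
  shows "elt ((r \<odot> snd (M k)) \<odot> \<xi> (Suc k)) (Pl (arity_at n cs (Suc k))) =
    gen_act Q (Gt (cs ! k)) (elt (r \<odot> u k) (cs ! k))"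
proof -
  note edge = composable_edge_t[OF composable k]
  let ?t = "yo_path (Pl (arity_at n cs (Suc k))) [Gt (cs ! k)] (cs ! k)"
  have "(r \<odot> snd (M k)) \<odot> \<xi> (Suc k) = r \<odot> (u k \<odot> ?t)"
    using Chat.assoc[OF \<xi>_hom snd_hom[OF k] r] cospan_iso_by_commute(2)[OF move_iso[OF k]] k
    by (simp add: basic_cospan_def)
  also have "\<dots> = (r \<odot> u k) \<odot> ?t" by (rule Chat.assoc[OF yo_generator_hom[OF edge] u_hom[OF k] r])
  finally show ?thesis using elt_Cmp_generator[OF edge Chat.cmp[OF u_hom[OF k] r]] by simp
qed

lemma zigzag_coconeD:
  assumes "zigzag_cocone N X M Q r"
  shows "Q \<in> Ob Chat" "k \<le> N \<Longrightarrow> r (Inl k) \<in> hom Chat (X k) Q"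
    "k < N \<Longrightarrow> r (Inr k) \<in> hom Chat (tgt (fst (M k))) Q"
    "k < N \<Longrightarrow> r (Inr k) \<odot> fst (M k) = r (Inl k)" "k < N \<Longrightarrow> r (Inr k) \<odot> snd (M k) = r (Inl (Suc k))"
  using assms by (auto simp: zigzag_cocone_def)

lemma cocone_player:
  assumes r: "zigzag_cocone N X M Q r" and k: "k \<le> N"
  shows "player Q cs (origin r) (moves r) k = elt (r (Inl k) \<odot> \<xi> k) (Pl (arity_at n cs k))"
proof (cases k)
  case 0
  then show ?thesis by (simp add: origin_def)
next
  case (Suc j)
  then have j: "j < N" using k by simp
  show ?thesis
    using elt_target[OF j zigzag_coconeD(3)[OF r j]] zigzag_coconeD(5)[OF r j] Suc
    by (simp add: moves_def)
qed

lemma cocone_thread: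
  assumes r: "zigzag_cocone N X M Q r"
  shows "thread Q n cs (origin r) (moves r)"
  unfolding thread_def
proof (intro conjI allI impI)
  have "r (Inl 0) \<odot> \<xi> 0 \<in> hom Chat (yo (Pl n)) Q"
    using Chat.cmp[OF \<xi>_hom zigzag_coconeD(2)[OF r], of 0] by simp
  then show "origin r \<in> FO Q (Pl n)" unfolding origin_def by (rule elt_in) simp
  fix k assume k: "k < N"
  show "moves r k \<in> FO Q (cs ! k)"
    unfolding moves_def
    by (rule elt_in[OF Chat.cmp[OF u_hom[OF k] zigzag_coconeD(3)[OF r k]] composable_bobjs[OF composable k]])
  show "gen_act Q (Gs (cs ! k)) (moves r k) = player Q cs (origin r) (moves r) k"
    using cocone_player[OF r] k elt_source[OF k zigzag_coconeD(3)[OF r k]] zigzag_coconeD(4)[OF r k]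
    by (simp add: moves_def)
qed

lemma cocone_eqI:
  assumes r: "zigzag_cocone N X M Q r" and r': "zigzag_cocone N X M Q r'"
    and origin: "origin r = origin r'" and moves: "\<And>k. k < N \<Longrightarrow> moves r k = moves r' k"
  shows "k \<le> N \<Longrightarrow> r (Inl k) = r' (Inl k)" "k < N \<Longrightarrow> r (Inr k) = r' (Inr k)"
proof -
  assume k: "k \<le> N"
  have "player Q cs (origin r) (moves r) k = player Q cs (origin r') (moves r') k"
    using origin moves k by (cases k) simp_all
  then show "r (Inl k) = r' (Inl k)"
    using cocone_player[OF r k] cocone_player[OF r' k]
    by (intro iso_yo_hom_eqI[OF \<xi>_iso[OF k] \<xi>_hom[OF k]
          zigzag_coconeD(2)[OF r k] zigzag_coconeD(2)[OF r' k]])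
      simp
next
  assume k: "k < N"
  show "r (Inr k) = r' (Inr k)"
    using moves[OF k]
    by (intro iso_yo_hom_eqI[OF u_iso[OF k] u_hom[OF k]
          zigzag_coconeD(3)[OF r k] zigzag_coconeD(3)[OF r' k]])
      (simp add: moves_def)
qed

lemma cocone_of_thread:
  assumes Q: "Q \<in> Ob Chat" and t: "thread Q n cs x e"
  obtains r where "zigzag_cocone N X M Q r" "origin r = x" "\<And>k. k < N \<Longrightarrow> moves r k = e k"
proof -
  have "\<exists>f\<in>hom Chat (X k) Q. elt (f \<odot> \<xi> k) (Pl (arity_at n cs k)) = player Q cs x e k"
    if "k \<le> N" for k
    by (rule iso_yo_hom_exists[OF \<xi>_iso[OF that] \<xi>_hom[OF that] Q _ player_in[OF Q composable t that]]) simp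
  then obtain f where f: "f k \<in> hom Chat (X k) Q"
    "elt (f k \<odot> \<xi> k) (Pl (arity_at n cs k)) = player Q cs x e k"
    if "k \<le> N" for k
    by metis
  have "\<exists>g\<in>hom Chat (tgt (fst (M k))) Q. elt (g \<odot> u k) (cs ! k) = e k" if "k < N" for k
    by (rule iso_yo_hom_exists[OF u_iso[OF that] u_hom[OF that] Q composable_bobjs[OF composable that]
          threadD(2)[OF t that]])
  then obtain g where g: "g k \<in> hom Chat (tgt (fst (M k))) Q" "elt (g k \<odot> u k) (cs ! k) = e k"
    if "k < N" for k
    by metis
  have "g k \<odot> fst (M k) = f k" if k: "k < N" for k
  proof (rule iso_yo_hom_eqI[OF \<xi>_iso \<xi>_hom Chat.cmp[OF fst_hom[OF k] g(1)[OF k]] f(1)])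
    show "elt ((g k \<odot> fst (M k)) \<odot> \<xi> k) (Pl (arity_at n cs k)) =
        elt (f k \<odot> \<xi> k) (Pl (arity_at n cs k))"
      using elt_source[OF k g(1)[OF k]] g(2)[OF k] f(2)[of k] threadD(3)[OF t k] k by simp
  qed (use k in auto)
  moreover have "g k \<odot> snd (M k) = f (Suc k)" if k: "k < N" for k
  proof (rule iso_yo_hom_eqI[OF \<xi>_iso \<xi>_hom Chat.cmp[OF snd_hom[OF k] g(1)[OF k]] f(1)])
    show "elt ((g k \<odot> snd (M k)) \<odot> \<xi> (Suc k)) (Pl (arity_at n cs (Suc k))) =
        elt (f (Suc k) \<odot> \<xi> (Suc k)) (Pl (arity_at n cs (Suc k)))"
      using elt_target[OF k g(1)[OF k]] g(2)[OF k] f(2)[of "Suc k"] k by simp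
  qed (use k in auto)
  ultimately have "zigzag_cocone N X M Q (case_sum f g)"
    using Q f(1) g(1) by (simp add: zigzag_cocone_def)
  then show ?thesis using that f(2)[of 0] g(2) by (simp add: origin_def moves_def)
qed

lemma cocone_map:
  assumes q: "zigzag_cocone N X M V q" and m: "m \<in> hom Chat V Q"
  shows "zigzag_cocone N X M Q (\<lambda>j. m \<odot> q j)" "origin (\<lambda>j. m \<odot> q j) = app m (Pl n) (origin q)"
    "k < N \<Longrightarrow> moves (\<lambda>j. m \<odot> q j) k = app m (cs ! k) (moves q k)"
proof -
  note cocone = zigzag_coconeD[OF q]
  show "zigzag_cocone N X M Q (\<lambda>j. m \<odot> q j)"
    unfolding zigzag_cocone_def
  proof (intro conjI allI impI)
    fix k assume k: "k < N"
    show "(m \<odot> q (Inr k)) \<odot> fst (M k) = m \<odot> q (Inl k)"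
      using Chat.assoc[OF fst_hom[OF k] cocone(3)[OF k] m] cocone(4)[OF k] by simp
    show "(m \<odot> q (Inr k)) \<odot> snd (M k) = m \<odot> q (Inl (Suc k))"
      using Chat.assoc[OF snd_hom[OF k] cocone(3)[OF k] m] cocone(5)[OF k] by simp
  qed (use Chat.hom_Ob(2)[OF m] Chat.cmp[OF cocone(2) m] Chat.cmp[OF cocone(3) m] in auto)
  have \<xi>0: "\<xi> 0 \<in> hom Chat (yo (Pl n)) (X 0)" using \<xi>_hom[of 0] by simp
  note q0 = cocone(2)[of 0, simplified]
  show "origin (\<lambda>j. m \<odot> q j) = app m (Pl n) (origin q)"
    unfolding origin_def using Chat.assoc[OF \<xi>0 q0 m] elt_Cmp[OF Chat.cmp[OF \<xi>0 q0], of m] by simp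
  show "moves (\<lambda>j. m \<odot> q j) k = app m (cs ! k) (moves q k)" if k: "k < N"
    unfolding moves_def
    using Chat.assoc[OF u_hom[OF k] cocone(3)[OF k] m] composable_bobjs[OF composable k]
      elt_Cmp[OF Chat.cmp[OF u_hom[OF k] cocone(3)[OF k]], of m] by simp
qed

lemma zigzag_arr_iff_maps_thread:
  assumes q: "zigzag_cocone N X M V q" and r: "zigzag_cocone N X M Q r" and m: "m \<in> hom Chat V Q"
  shows "zigzag_arr N m q r \<longleftrightarrow> maps_thread m n cs (origin q) (moves q) (origin r) (moves r)"
proof
  note map = cocone_map[OF q m]
  assume "zigzag_arr N m q r"
  then have "origin (\<lambda>j. m \<odot> q j) = origin r" "\<And>k. k < N \<Longrightarrow> moves (\<lambda>j. m \<odot> q j) k = moves r k"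
    by (simp_all add: zigzag_arr_def origin_def moves_def)
  then show "maps_thread m n cs (origin q) (moves q) (origin r) (moves r)"
    using map(2,3) by (simp add: maps_thread_def)
next
  note map = cocone_map[OF q m]
  assume "maps_thread m n cs (origin q) (moves q) (origin r) (moves r)"
  then show "zigzag_arr N m q r"
    using cocone_eqI[OF map(1) r] map(2,3) by (simp add: zigzag_arr_def maps_thread_def)
qed

theorem colimit_iff_universal_thread:
  assumes q: "zigzag_cocone N X M V q"
  shows "zigzag_colimit N X M V q \<longleftrightarrow> universal_thread V n cs (origin q) (moves q)"
proof
  assume colimit: "zigzag_colimit N X M V q"
  have "\<exists>!m. m \<in> hom Chat V Q \<and> maps_thread m n cs (origin q) (moves q) x e"
    if Q: "Q \<in> Ob Chat" and t: "thread Q n cs x e" for Q x e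
  proof -
    obtain r where r: "zigzag_cocone N X M Q r" "origin r = x" "\<And>k. k < N \<Longrightarrow> moves r k = e k"
      by (rule cocone_of_thread[OF Q t]) blast
    have "maps_thread m n cs (origin q) (moves q) x e \<longleftrightarrow> zigzag_arr N m q r"
      if "m \<in> hom Chat V Q" for m
      using zigzag_arr_iff_maps_thread[OF q r(1) that] r(2,3) by (simp add: maps_thread_def)
    then show ?thesis using colimit r(1) unfolding zigzag_colimit_def by metis
  qed
  then show "universal_thread V n cs (origin q) (moves q)"
    using zigzag_coconeD(1)[OF q] composable cocone_thread[OF q] by (simp add: universal_thread_def)
next
  assume universal: "universal_thread V n cs (origin q) (moves q)"
  have "\<exists>!m. m \<in> hom Chat V Q \<and> zigzag_arr N m q r" if r: "zigzag_cocone N X M Q r" for Q r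
    using universal_thread_ex1[OF universal zigzag_coconeD(1)[OF r] cocone_thread[OF r]]
      zigzag_arr_iff_maps_thread[OF q r] by metis
  then show "zigzag_colimit N X M V q" using q by (simp add: zigzag_colimit_def)
qed

end

lemma word_chain_snoc:
  fixes X :: "nat \<Rightarrow> 'u::infinite psh"
  assumes "word_chain n cs X M \<xi> u" and st: "st_obj c (arity_at n cs (length cs)) m"
    and iso: "cospan_iso_by (\<xi> (length cs)) v y
      (basic_cospan c (arity_at n cs (length cs)) m) (M (length cs))"
    and src: "src (fst (M (length cs))) = X (length cs)"
      "src (snd (M (length cs))) = X (Suc (length cs))"
  shows "word_chain n (cs @ [c]) X M (\<xi>(Suc (length cs) := y)) (u(length cs := v))"
proof -
  interpret word_chain n cs X M \<xi> u by fact
  have last: "arity_at n (cs @ [c]) (Suc N) = m" using st_obj_arities[OF st] by simp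
  have y: "y \<in> hom Chat (yo (Pl m)) (X (Suc N))"
    using cospan_iso_by_hom(3)[OF iso] basic_cospan_ends(3)[OF st, where 'u = 'u] src(2) by simp
  show ?thesis
  proof
    show "composable n (cs @ [c])" by (rule composable_snoc[OF composable st])
    fix k
    show "is_iso Chat ((\<xi>(Suc N := y)) k)" if "k \<le> length (cs @ [c])"
      using that \<xi>_iso cospan_iso_by_iso(3)[OF iso] by simp
    show "(\<xi>(Suc N := y)) k \<in> hom Chat (yo (Pl (arity_at n (cs @ [c]) k))) (X k)"
      if "k \<le> length (cs @ [c])"
      using that \<xi>_hom y last by (cases "k = Suc N") (simp_all add: arity_at_snoc del: arity_at_Suc)
    show "src (fst (M k)) = X k" "src (snd (M k)) = X (Suc k)" if "k < length (cs @ [c])"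
      using that src_fst src_snd src by (auto simp: less_Suc_eq)
    show "cospan_iso_by ((\<xi>(Suc N := y)) k) ((u(N := v)) k) ((\<xi>(Suc N := y)) (Suc k))
        (basic_cospan ((cs @ [c]) ! k) (arity_at n (cs @ [c]) k) (arity_at n (cs @ [c]) (Suc k)))
        (M k)"
      if "k < length (cs @ [c])"
      using that move_iso iso last
      by (cases "k = N") (simp_all add: arity_at_snoc nth_append del: arity_at_Suc)
  qed
qed

lemma ex_word_chain:
  fixes X :: "nat \<Rightarrow> 'u::infinite psh"
  assumes X0: "X 0 = yo (Pl n)"
    and moves: "\<And>k. k < N \<Longrightarrow> extended basic_move (M k) \<and>
      src (fst (M k)) = X k \<and> src (snd (M k)) = X (Suc k)"
  shows "\<exists>cs \<xi> u. length cs = N \<and> \<xi> 0 = Ide Chat (yo (Pl n)) \<and> word_chain n cs X M \<xi> u"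
  using moves
proof (induction N)
  case 0
  have "Ide Chat (X 0) \<in> hom Chat (X 0) (X 0)" unfolding X0 by (rule Chat.ide[OF yo_in])
  then have "word_chain n [] X M (\<lambda>_. Ide Chat (X 0)) u" for u
    using Chat.is_iso_Ide[OF yo_in[of "Pl n", where 'a = 'u]] X0 by unfold_locales auto
  then show ?case using X0 by (intro exI[of _ "[]"] exI[of _ "\<lambda>_. Ide Chat (X 0)"]) simp
next
  case (Suc N)
  then obtain cs \<xi> u where cs: "length cs = N" and \<xi>0: "\<xi> 0 = Ide Chat (yo (Pl n))"
    and chain: "word_chain n cs X M \<xi> u" by auto
  then interpret word_chain n cs X M \<xi> u by simp
  have move: "extended basic_move (M N)" "src (fst (M N)) = X N" "src (snd (M N)) = X (Suc N)"
    using Suc.prems[of N] cs by simp_all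
  have \<xi>: "is_iso Chat (\<xi> N)" "\<xi> N \<in> hom Chat (yo (Pl (arity_at n cs N))) (src (fst (M N)))"
    using \<xi>_iso[of N] \<xi>_hom[of N] cs move(2) by simp_all
  obtain c m v y where "st_obj c (arity_at n cs (length cs)) m"
    "cospan_iso_by (\<xi> (length cs)) v y
      (basic_cospan c (arity_at n cs (length cs)) m) (M (length cs))"
    using extended_basic_move_iso[OF move(1) \<xi>] cs by blast
  then have "word_chain n (cs @ [c]) X M (\<xi>(Suc (length cs) := y)) (u(length cs := v))"
    using move(2,3) cs by (intro word_chain_snoc[OF chain]) auto
  moreover have "length (cs @ [c]) = Suc N" "(\<xi>(Suc (length cs) := y)) 0 = Ide Chat (yo (Pl n))"
    using cs \<xi>0 by simp_all
  ultimately show ?case by blast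
qed

lemma view_universal_thread:
  fixes i :: "'u::infinite parr"
  assumes view: "is_view i" and src: "src i = yo (Pl n)"
  shows "\<exists>cs e. universal_thread (tgt i) n cs (elt i (Pl n)) e"
proof -
  obtain N where "chain_play (extended basic_move) (enat N) i" using view by (auto simp: is_view_def)
  then obtain X M q where X0: "X 0 = yo (Pl n)" and q0: "q (Inl 0) = i"
    and moves: "\<And>k. k < N \<Longrightarrow> extended basic_move (M k) \<and>
      src (fst (M k)) = X k \<and> src (snd (M k)) = X (Suc k)"
    and colimit: "is_colimit Chat (Inl ` {k. enat k \<le> enat N} \<union> Inr ` {k. enat k < enat N})
      (case_sum X (\<lambda>k. tgt (fst (M k))))
      ((\<lambda>k. (Inl k, Inr k, fst (M k))) ` {k. enat k < enat N} \<union>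
       (\<lambda>k. (Inl (Suc k), Inr k, snd (M k))) ` {k. enat k < enat N}) (tgt i) q"
    using src unfolding chain_play_def by auto
  obtain cs \<xi> u where cs: "length cs = N" and \<xi>0: "\<xi> 0 = Ide Chat (yo (Pl n))"
    and chain: "word_chain n cs X M \<xi> u"
    using ex_word_chain[OF X0 moves] by blast
  interpret word_chain n cs X M \<xi> u by (rule chain)
  have "X k \<in> Ob Chat" if "k \<le> N" for k using Chat.hom_Ob(2)[OF \<xi>_hom] that cs by simp
  then have zigzag: "zigzag_colimit N X M (tgt i) q"
    using is_colimit_zigzag_iff[of N X M] colimit is_cospan_move src_fst src_snd cs by simp
  then have cocone: "zigzag_cocone N X M (tgt i) q" by (simp add: zigzag_colimit_def)
  have "i \<in> hom Chat (yo (Pl n)) (tgt i)"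
    using zigzag_coconeD(2)[of "tgt i" q 0] cocone q0 X0 cs by simp
  then have "origin q = elt i (Pl n)" by (simp add: origin_def q0 \<xi>0 Chat.ide_right)
  then show ?thesis using colimit_iff_universal_thread[of "tgt i" q] cocone zigzag cs by auto
qed

lemma Chat_is_monoI:
  assumes i: "i \<in> hom Chat X Y" and inj: "\<And>c. c \<in> bobjs \<Longrightarrow> inj_on (app i c) (FO X c)"
  shows "is_mono Chat i"
  unfolding is_mono_def
proof (intro conjI allI ballI impI)
  show "i \<in> Arr Chat" using Chat_homD(1)[OF i] .
  fix a f g
  assume "f \<in> hom Chat a (Dom Chat i)" "g \<in> hom Chat a (Dom Chat i)" and eq: "i \<odot> f = i \<odot> g"
  then have f: "f \<in> hom Chat a X" and g: "g \<in> hom Chat a X" using homD[OF i] by auto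
  show "f = g"
  proof (rule Chat_hom_eqI[OF f g])
    fix c x assume c: "c \<in> bobjs" and x: "x \<in> FO a c"
    have "app i c (app f c x) = app i c (app g c x)"
      using Chat_app_Cmp[OF f c x, of i] Chat_app_Cmp[OF g c x, of i] eq by simp
    then show "app f c x = app g c x"
      using inj_onD[OF inj[OF c]] Chat_app_in[OF f c x] Chat_app_in[OF g c x] by blast
  qed
qed

lemma word_view_origin_mono:
  fixes i :: "'u::infinite parr"
  assumes comp: "composable n cs" and i: "i \<in> hom Chat (yo (Pl n)) (word_view n cs)"
    and origin: "elt i (Pl n) = nat_elt 0"
  shows "is_mono Chat i"
proof (rule Chat_is_monoI[OF i])
  fix c assume c: "c \<in> bobjs"
  have "app i Star (chan n k) = nat_elt k" if "k \<in> {1..n}" for k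
    using app_chan[OF i that] origin gen_act_word_view[OF comp edge_d[OF that], of 0, where 'a = 'u]
    by simp
  then have channels: "inj_on (app i Star) (FO (yo (Pl n)) Star)"
    by (auto simp: FO_yo_Pl_Star inj_on_def)
  consider "c = Star" | "c = Pl n" | "c \<noteq> Star" "c \<noteq> Pl n" by blast
  then show "inj_on (app i c) (FO (yo (Pl n)) c)"
    using channels c by cases (simp_all add: FO_yo_Pl FO_yo_Pl_other)
qed

lemma word_chain_basic_cospans:
  assumes comp: "composable n cs"
  shows "word_chain n cs (\<lambda>k. yo (Pl (arity_at n cs k)) :: 'u::infinite psh)
    (\<lambda>k. basic_cospan (cs ! k) (arity_at n cs k) (arity_at n cs (Suc k)))
    (\<lambda>k. Ide Chat (yo (Pl (arity_at n cs k)))) (\<lambda>k. Ide Chat (yo (cs ! k)))"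
proof
  show "composable n cs" by fact
  fix k
  let ?B = "basic_cospan (cs ! k) (arity_at n cs k) (arity_at n cs (Suc k)) :: 'u cospan"
  show "is_iso Chat (Ide Chat (yo (Pl (arity_at n cs k)) :: 'u psh))"
    by (rule Chat.is_iso_Ide[OF yo_in])
  show "Ide Chat (yo (Pl (arity_at n cs k)) :: 'u psh) \<in>
      hom Chat (yo (Pl (arity_at n cs k))) (yo (Pl (arity_at n cs k)))"
    by (rule Chat.ide[OF yo_in])
  assume k: "k < length cs"
  note ends = basic_cospan_ends[OF composable_nth[OF comp k], where 'u = 'u]
  show "src (fst ?B) = yo (Pl (arity_at n cs k))" "src (snd ?B) = yo (Pl (arity_at n cs (Suc k)))"
    by (rule ends)+
  show "cospan_iso_by (Ide Chat (yo (Pl (arity_at n cs k)))) (Ide Chat (yo (cs ! k)))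
      (Ide Chat (yo (Pl (arity_at n cs (Suc k))))) ?B ?B"
    using cospan_iso_by_refl[OF ends(4)] unfolding ends .
qed

lemma ex_view_of_word:
  assumes comp: "composable n cs"
  shows "\<exists>i :: 'u::infinite parr. is_view i \<and> src i = yo (Pl n) \<and>
    (\<exists>e. universal_thread (tgt i) n cs (elt i (Pl n)) e)"
proof -
  let ?W = "word_view n cs :: 'u psh"
  let ?X = "\<lambda>k. yo (Pl (arity_at n cs k)) :: 'u psh"
  let ?M = "\<lambda>k. basic_cospan (cs ! k) (arity_at n cs k) (arity_at n cs (Suc k)) :: 'u cospan"
  interpret word_chain n cs ?X ?M "\<lambda>k. Ide Chat (?X k)" "\<lambda>k. Ide Chat (yo (cs ! k))"
    by (rule word_chain_basic_cospans[OF comp])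
  obtain q where q: "zigzag_cocone N ?X ?M ?W q" "origin q = nat_elt 0"
    "\<And>k. k < N \<Longrightarrow> moves q k = nat_elt k"
    by (rule cocone_of_thread[OF word_view_in[OF comp] thread_word_view[OF comp]]) blast
  have universal: "universal_thread ?W n cs (origin q) (moves q)"
    using universal_thread_cong[of cs "moves q" nat_elt]
      universal_thread_word_view[OF comp, where 'u = 'u]
      q(2,3) by simp
  have i: "q (Inl 0) \<in> hom Chat (yo (Pl n)) ?W" using zigzag_coconeD(2)[OF q(1), of 0] by simp
  have origin: "origin q = elt (q (Inl 0)) (Pl n)" by (simp add: origin_def Chat.ide_right[OF i])
  have "chain_play (extended basic_move) (enat N) (q (Inl 0))"
    unfolding chain_play_def Chat_homD[OF i]
  proof (intro conjI exI)
    show "is_mono Chat (q (Inl 0))" using word_view_origin_mono[OF comp i] origin q(2) by simp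
    show "is_position (yo (Pl n) :: 'u psh)" by (rule position_Pl)
    show "?X 0 = yo (Pl n)" "q (Inl 0) = q (Inl 0)" by simp_all
    show "\<forall>k. enat k < enat N \<longrightarrow> extended basic_move (?M k) \<and>
        src (fst (?M k)) = ?X k \<and> src (snd (?M k)) = ?X (Suc k)"
      using extended_basic_cospan[OF composable_nth[OF comp], where 'u = 'u] src_fst src_snd by simp
    show "is_colimit Chat (Inl ` {k. enat k \<le> enat N} \<union> Inr ` {k. enat k < enat N})
        (case_sum ?X (\<lambda>k. tgt (fst (?M k))))
        ((\<lambda>k. (Inl k, Inr k, fst (?M k))) ` {k. enat k < enat N} \<union>
         (\<lambda>k. (Inl (Suc k), Inr k, snd (?M k))) ` {k. enat k < enat N}) ?W q"
      by (rule iffD2[OF is_colimit_zigzag_iff])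
        (use yo_in is_cospan_move src_fst src_snd colimit_iff_universal_thread[OF q(1)] universal
          in simp_all)
  qed
  then have "is_view (q (Inl 0))" using Chat_homD(2)[OF i] by (auto simp: is_view_def)
  then show ?thesis using Chat_homD(2,3)[OF i] universal origin
    by (intro exI[of _ "q (Inl 0)"] exI[of _ "moves q"] conjI) simp_all
qed

section \<open>The category of views of a player\<close>

lemma is_play_hom: "is_play i \<Longrightarrow> i \<in> hom Chat (src i) (tgt i)"
  by (auto simp: is_play_def chain_play_def is_mono_def intro: Chat_Arr_hom)

lemma Plays_Ob: "(i, p) \<in> Ob (Plays X) \<longleftrightarrow> is_play i \<and> p \<in> hom Chat (src i) X"
  by (simp add: Plays_def)

lemma Plays_hom:
  "f \<in> hom (Plays X) (i, p) (i', p') \<longleftrightarrow> (i, p) \<in> Ob (Plays X) \<and> (i', p') \<in> Ob (Plays X) \<and>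
    (\<exists>h k. f = Arrow (i, p) (h, k) (i', p') \<and>
      h \<in> hom Chat (src i) (src i') \<and> k \<in> hom Chat (tgt i) (tgt i') \<and> k \<odot> i = i' \<odot> h \<and> p' \<odot> h = p)"
  by (auto simp: Plays_def hom_def Let_def)

lemma Plays_simps:
  "Ide (Plays X) (i, p) = Arrow (i, p) (Ide Chat (src i), Ide Chat (tgt i)) (i, p)"
  "Cmp (Plays X) (Arrow b (h', k') c) (Arrow a (h, k) b') = Arrow a (h' \<odot> h, k' \<odot> k) c"
  by (simp_all add: Plays_def Let_def)

lemma Plays_Cmp_hom:
  assumes f: "f \<in> hom (Plays X) (i, p) (i', p')" and g: "g \<in> hom (Plays X) (i', p') (i'', p'')"
  shows "Cmp (Plays X) g f \<in> hom (Plays X) (i, p) (i'', p'')"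
proof -
  obtain h k where hk: "f = Arrow (i, p) (h, k) (i', p')" "h \<in> hom Chat (src i) (src i')"
    "k \<in> hom Chat (tgt i) (tgt i')" "k \<odot> i = i' \<odot> h" "p' \<odot> h = p"
    using f by (auto simp: Plays_hom)
  obtain h' k' where hk': "g = Arrow (i', p') (h', k') (i'', p'')" "h' \<in> hom Chat (src i') (src i'')"
    "k' \<in> hom Chat (tgt i') (tgt i'')" "k' \<odot> i' = i'' \<odot> h'" "p'' \<odot> h' = p'"
    using g by (auto simp: Plays_hom)
  have ob: "(i, p) \<in> Ob (Plays X)" "(i', p') \<in> Ob (Plays X)" "(i'', p'') \<in> Ob (Plays X)"
    using f g by (auto simp: Plays_hom)
  then have plays: "is_play i" "is_play i'" "is_play i''" and p'': "p'' \<in> hom Chat (src i'') X"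
    by (auto simp: Plays_Ob)
  have "i'' \<odot> (h' \<odot> h) = (k' \<odot> k) \<odot> i"
    using plays[THEN is_play_hom] hk(2-4) hk'(2-4) by (intro Chat.square_comp) auto
  moreover have "p'' \<odot> (h' \<odot> h) = p" using Chat.assoc[OF hk(2) hk'(2) p''] hk(5) hk'(5) by simp
  ultimately show ?thesis
    using ob Chat.cmp[OF hk(2) hk'(2)] Chat.cmp[OF hk(3) hk'(3)]
    by (simp add: Plays_hom Plays_simps hk(1) hk'(1))
qed

lemma category_Plays: "category (Plays X)"
proof
  fix f assume "f \<in> Arr (Plays X)"
  then show "Dom (Plays X) f \<in> Ob (Plays X) \<and> Cod (Plays X) f \<in> Ob (Plays X)"
    by (auto simp: Plays_def Let_def)
next
  fix a assume a: "a \<in> Ob (Plays X)"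
  obtain i p where ip: "a = (i, p)" by (cases a)
  then have i: "i \<in> hom Chat (src i) (tgt i)" and p: "p \<in> hom Chat (src i) X"
    using a is_play_hom by (auto simp: Plays_Ob)
  show "Ide (Plays X) a \<in> hom (Plays X) a a"
    using a Chat.ide Chat.hom_Ob[OF i] Chat.ide_left[OF i] Chat.ide_right[OF i] Chat.ide_right[OF p]
    by (auto simp: ip Plays_hom Plays_simps)
next
  fix f a b g c assume "f \<in> hom (Plays X) a b" "g \<in> hom (Plays X) b c"
  then show "Cmp (Plays X) g f \<in> hom (Plays X) a c"
    by (cases a; cases b; cases c) (simp add: Plays_Cmp_hom)
next
  fix f a b assume "f \<in> hom (Plays X) a b"
  then show "Cmp (Plays X) f (Ide (Plays X) a) = f" "Cmp (Plays X) (Ide (Plays X) b) f = f"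
    by (cases a; cases b; auto simp: Plays_hom Plays_simps intro: Chat.ide_right Chat.ide_left)+
next
  fix f a b g c h d assume "f \<in> hom (Plays X) a b" "g \<in> hom (Plays X) b c" "h \<in> hom (Plays X) c d"
  then show "Cmp (Plays X) h (Cmp (Plays X) g f) = Cmp (Plays X) (Cmp (Plays X) h g) f"
    by (cases a; cases b; cases c; cases d) (auto simp: Plays_hom Plays_simps intro: Chat.assoc)
qed

lemma category_Views: "category (Views X)"
  unfolding Views_def by (rule category_full_subcat[OF category_Plays])

lemma view_is_play:
  assumes "is_view i"
  shows "is_play i"
proof -
  have "extended move M" if "extended basic_move M" for M :: "'a cospan"
    using that unfolding extended_def move_def by blast
  then show ?thesis using assms unfolding is_view_def is_play_def chain_play_def by blast
qed

lemma view_hom: "is_view i \<Longrightarrow> i \<in> hom Chat (src i) (tgt i)"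
  by (intro is_play_hom view_is_play)

lemma Views_Ob:
  "(i, p) \<in> Ob (Views (yo (Pl n))) \<longleftrightarrow>
    is_view i \<and> src i = yo (Pl n) \<and> p = Ide Chat (yo (Pl n) :: 'u::infinite psh)"
proof
  assume "(i, p) \<in> Ob (Views (yo (Pl n)))"
  then have view: "is_view i" and p: "p \<in> hom Chat (src i) (yo (Pl n))"
    by (auto simp: Views_def full_subcat_def Plays_Ob)
  then obtain m where "src i = yo (Pl m)" by (auto simp: is_view_def)
  then show "is_view i \<and> src i = yo (Pl n) \<and> p = Ide Chat (yo (Pl n))"
    using view p yo_Pl_hom_unique[of p m n] by auto
next
  assume "is_view i \<and> src i = yo (Pl n) \<and> p = Ide Chat (yo (Pl n) :: 'u psh)"
  then show "(i, p) \<in> Ob (Views (yo (Pl n)))"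
    using view_is_play[of i] Chat.ide[OF yo_in[of "Pl n"]]
    by (auto simp: Views_def full_subcat_def Plays_Ob)
qed

lemma Views_hom:
  fixes a b :: "'u::infinite play_over"
  assumes a: "a \<in> Ob (Views (yo (Pl n)))" and b: "b \<in> Ob (Views (yo (Pl n)))"
  shows "f \<in> hom (Views (yo (Pl n))) a b \<longleftrightarrow>
    (\<exists>k\<in>hom Chat (tgt (fst a)) (tgt (fst b)).
      f = Arrow a (Ide Chat (yo (Pl n)), k) b \<and>
      app k (Pl n) (elt (fst a) (Pl n)) = elt (fst b) (Pl n))"
proof -
  let ?I = "Ide Chat (yo (Pl n) :: 'u psh)"
  obtain i i' where ab: "a = (i, ?I)" "b = (i', ?I)" and views: "is_view i" "is_view i'"
    and src: "src i = yo (Pl n)" "src i' = yo (Pl n)"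
    using a b by (cases a; cases b) (auto simp: Views_Ob)
  have I: "?I \<in> hom Chat (yo (Pl n)) (yo (Pl n))" by (rule Chat.ide[OF yo_in])
  have i: "i \<in> hom Chat (yo (Pl n)) (tgt i)" "i' \<in> hom Chat (yo (Pl n)) (tgt i')"
    using views[THEN view_hom] src by simp_all
  have ob: "(i, ?I) \<in> Ob (Plays (yo (Pl n)))" "(i', ?I) \<in> Ob (Plays (yo (Pl n)))"
    using a b ab by (auto simp: Views_def full_subcat_def)
  have eq_iff: "k \<odot> i = i' \<longleftrightarrow> app k (Pl n) (elt i (Pl n)) = elt i' (Pl n)"
    if "k \<in> hom Chat (tgt i) (tgt i')" for k
    using elt_Cmp[OF i(1), of k] yo_hom_eqI[OF Chat.cmp[OF i(1) that] i(2)] by auto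
  have "f \<in> hom (Views (yo (Pl n))) a b \<longleftrightarrow> f \<in> hom (Plays (yo (Pl n))) a b"
    using views ab by (auto simp: Views_def full_subcat_def hom_def)
  also have "\<dots> \<longleftrightarrow> (\<exists>h k. f = Arrow a (h, k) b \<and> h \<in> hom Chat (yo (Pl n)) (yo (Pl n)) \<and>
      k \<in> hom Chat (tgt i) (tgt i') \<and> k \<odot> i = i' \<odot> h \<and> ?I \<odot> h = ?I)"
    unfolding ab Plays_hom src using ob by simp
  also have "\<dots> \<longleftrightarrow> (\<exists>k\<in>hom Chat (tgt i) (tgt i'). f = Arrow a (?I, k) b \<and> k \<odot> i = i')"
    using yo_Pl_hom_unique(2)[of _ n n, where 'u = 'u] I Chat.ide_right[OF i(2)] Chat.ide_right[OF I] by metis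
  finally show ?thesis using eq_iff ab by auto
qed

definition view_word :: "nat \<Rightarrow> 'u::infinite play_over \<Rightarrow> bobj list" where
  "view_word n V = (SOME cs. \<exists>e. universal_thread (tgt (fst V)) n cs (elt (fst V) (Pl n)) e)"

lemma view_word_universal_thread:
  assumes "V \<in> Ob (Views (yo (Pl n)))"
  obtains e where "universal_thread (tgt (fst V)) n (view_word n V) (elt (fst V) (Pl n)) e"
proof -
  have "\<exists>cs e. universal_thread (tgt (fst V)) n cs (elt (fst V) (Pl n)) e"
    using assms by (cases V) (auto simp: Views_Ob intro: view_universal_thread)
  then have "\<exists>e. universal_thread (tgt (fst V)) n (view_word n V) (elt (fst V) (Pl n)) e"
    unfolding view_word_def by (rule someI_ex)
  then show ?thesis using that by blast
qed

lemma Views_thin: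
  assumes f: "f \<in> hom (Views (yo (Pl n) :: 'u::infinite psh)) a b"
    and g: "g \<in> hom (Views (yo (Pl n))) a b"
  shows "f = g"
proof -
  note ob = category.hom_Ob[OF category_Views f]
  obtain k k' where "f = Arrow a (Ide Chat (yo (Pl n)), k) b" "g = Arrow a (Ide Chat (yo (Pl n)), k') b"
    and k: "k \<in> hom Chat (tgt (fst a)) (tgt (fst b))"
      "app k (Pl n) (elt (fst a) (Pl n)) = elt (fst b) (Pl n)"
    and k': "k' \<in> hom Chat (tgt (fst a)) (tgt (fst b))"
      "app k' (Pl n) (elt (fst a) (Pl n)) = elt (fst b) (Pl n)"
    using f g unfolding Views_hom[OF ob] by blast
  moreover obtain e e' where "universal_thread (tgt (fst a)) n (view_word n a) (elt (fst a) (Pl n)) e"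
    "universal_thread (tgt (fst b)) n (view_word n b) (elt (fst b) (Pl n)) e'"
    using view_word_universal_thread[OF ob(1)] view_word_universal_thread[OF ob(2)] by metis
  ultimately show ?thesis using universal_thread_hom_unique[OF _ _ k k'] by simp
qed

lemma Views_hom_nonempty_iff:
  assumes a: "a \<in> Ob (Views (yo (Pl n) :: 'u::infinite psh))" and b: "b \<in> Ob (Views (yo (Pl n)))"
  shows "hom (Views (yo (Pl n))) a b \<noteq> {} \<longleftrightarrow> prefix (view_word n a) (view_word n b)"
proof -
  obtain e e' where threads: "universal_thread (tgt (fst a)) n (view_word n a) (elt (fst a) (Pl n)) e"
    "universal_thread (tgt (fst b)) n (view_word n b) (elt (fst b) (Pl n)) e'"
    using view_word_universal_thread[OF a] view_word_universal_thread[OF b] by metis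
  have "hom (Views (yo (Pl n))) a b \<noteq> {} \<longleftrightarrow> (\<exists>f. f \<in> hom (Views (yo (Pl n))) a b)" by blast
  then show ?thesis
    using universal_thread_hom_iff_prefix[OF threads] unfolding Views_hom[OF a b] by blast
qed

lemma view_word_surj:
  "view_word n ` Ob (Views (yo (Pl n) :: 'u::infinite psh)) = {cs. composable n cs}"
proof (intro equalityI subsetI)
  fix cs assume "cs \<in> view_word n ` Ob (Views (yo (Pl n) :: 'u psh))"
  then obtain V where V: "V \<in> Ob (Views (yo (Pl n) :: 'u psh))" "cs = view_word n V" by blast
  obtain e where "universal_thread (tgt (fst V)) n cs (elt (fst V) (Pl n)) e"
    using view_word_universal_thread[OF V(1)] V(2) by metis
  then show "cs \<in> {cs. composable n cs}" by (simp add: universal_threadD(2))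
next
  fix cs assume "cs \<in> {cs. composable n cs}"
  then obtain i :: "'u parr" and e where "is_view i" "src i = yo (Pl n)"
    and e: "universal_thread (tgt i) n cs (elt i (Pl n)) e"
    using ex_view_of_word by blast
  then have ob: "(i, Ide Chat (yo (Pl n))) \<in> Ob (Views (yo (Pl n) :: 'u psh))"
    by (simp add: Views_Ob)
  obtain e' where "universal_thread (tgt i) n (view_word n (i, Ide Chat (yo (Pl n)))) (elt i (Pl n)) e'"
    using view_word_universal_thread[OF ob] by auto
  then have "cs = view_word n (i, Ide Chat (yo (Pl n)))" by (rule universal_thread_word_unique[OF e])
  then show "cs \<in> view_word n ` Ob (Views (yo (Pl n) :: 'u psh))" using ob by (rule image_eqI)
qed

section \<open>Classes of basic moves\<close>

abbreviation move_iso :: "nat \<Rightarrow> ('u::infinite cospan \<times> 'u cospan) set" where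
  "move_iso n \<equiv> {(M, N) \<in> basic_moves_from n \<times> basic_moves_from n. \<exists>x u y. cospan_iso_by x u y M N}"

definition letters :: "nat \<Rightarrow> bobj set" where
  "letters n = {c. st_obj c n (tgt_arity c)}"

abbreviation letter_cospan :: "nat \<Rightarrow> bobj \<Rightarrow> 'u::infinite cospan" where
  "letter_cospan n c \<equiv> basic_cospan c n (tgt_arity c)"

lemma lettersD: "c \<in> letters n \<Longrightarrow> st_obj c n (tgt_arity c)"
  by (simp add: letters_def)

lemma basic_move_iso_letter_cospan:
  assumes "M \<in> basic_moves_from n"
  shows "\<exists>c\<in>letters n. \<exists>x u y. cospan_iso_by x u y (letter_cospan n c) (M :: 'u::infinite cospan)"
proof -
  obtain c m n' x u y where st: "st_obj c m n'"
    and iso: "cospan_iso_by x u y (basic_cospan c m n') M"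
    and src: "src (fst M) = yo (Pl n)"
    using assms unfolding basic_moves_from_def basic_move_def by blast
  have "m = n"
    using yo_Pl_hom_unique(1)[of x m n] cospan_iso_by_hom(1)[OF iso] src
      basic_cospan_ends(1)[OF st, where 'u = 'u] by simp
  moreover have "n' = tgt_arity c" using st_obj_arities[OF st] by simp
  ultimately show ?thesis using st iso by (auto simp: letters_def)
qed

lemma letter_cospan_basic_move:
  assumes "c \<in> letters n"
  shows "(letter_cospan n c :: 'u::infinite cospan) \<in> basic_moves_from n"
  unfolding basic_moves_from_def
  using basic_cospan_move[OF lettersD[OF assms], where 'u = 'u]
    basic_cospan_ends(1)[OF lettersD[OF assms], where 'u = 'u] by blast

lemma letter_cospan_iso_imp_eq:
  assumes iso: "cospan_iso_by x u y (letter_cospan n c) (letter_cospan n c' :: 'u::infinite cospan)"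
    and c: "c \<in> letters n" and c': "c' \<in> letters n"
  shows "c = c'"
  using yo_iso_imp_eq[of u c c'] cospan_iso_by_iso(2)[OF iso] cospan_iso_by_hom(2)[OF iso]
    st_obj_bobjs[OF lettersD[OF c]] st_obj_bobjs[OF lettersD[OF c']]
    basic_cospan_ends(2)[OF lettersD[OF c], where 'u = 'u]
    basic_cospan_ends(2)[OF lettersD[OF c'], where 'u = 'u] by simp

lemma equiv_move_iso: "equiv (basic_moves_from n) (move_iso n :: ('u::infinite cospan \<times> 'u cospan) set)"
proof (rule equivI)
  show "refl_on (basic_moves_from n) (move_iso n :: ('u cospan \<times> 'u cospan) set)"
  proof (rule refl_onI)
    fix M :: "'u cospan" assume "M \<in> basic_moves_from n"
    moreover have "is_cospan M"
      using basic_move_iso_letter_cospan[OF calculation] cospan_iso_by_cospan(2) by blast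
    ultimately show "(M, M) \<in> move_iso n" using cospan_iso_by_refl by blast
  qed
  show "sym (move_iso n :: ('u cospan \<times> 'u cospan) set)"
    using cospan_iso_by_sym by (fastforce intro!: symI)
  show "trans (move_iso n :: ('u cospan \<times> 'u cospan) set)"
    using cospan_iso_by_trans by (fastforce intro!: transI)
qed auto

definition move_letter :: "nat \<Rightarrow> 'u::infinite cospan set \<Rightarrow> bobj" where
  "move_letter n \<M> = (SOME c. c \<in> letters n \<and> letter_cospan n c \<in> \<M>)"

lemma
  fixes \<M> :: "'u::infinite cospan set"
  assumes "\<M> \<in> move_classes n"
  shows move_letter_in: "move_letter n \<M> \<in> letters n"
    and move_letter_cospan_in: "letter_cospan n (move_letter n \<M>) \<in> \<M>"
proof -
  obtain M where M: "M \<in> basic_moves_from n" "\<M> = move_iso n `` {M}"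
    using assms unfolding move_classes_def by (rule quotientE)
  obtain c x u y where c: "c \<in> letters n" and "cospan_iso_by x u y (letter_cospan n c) M"
    using basic_move_iso_letter_cospan[OF M(1)] by blast
  from cospan_iso_by_sym[OF this(2)] have "letter_cospan n c \<in> \<M>"
    using letter_cospan_basic_move[OF c] M by auto
  then have "\<exists>c. c \<in> letters n \<and> letter_cospan n c \<in> \<M>" using c by blast
  from someI_ex[OF this]
  show "move_letter n \<M> \<in> letters n" "letter_cospan n (move_letter n \<M>) \<in> \<M>"
    unfolding move_letter_def by auto
qed

lemma move_classes_iso:
  assumes "\<M> \<in> move_classes n" "M \<in> \<M>" "N \<in> \<M>"
  shows "\<exists>x u y. cospan_iso_by x u y M (N :: 'u::infinite cospan)"
  using quotient_eq_iff[OF equiv_move_iso, of \<M> n \<M> M N] assms unfolding move_classes_def by auto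

lemma bij_betw_move_letter:
  "bij_betw (move_letter n) (move_classes n :: 'u::infinite cospan set set) (letters n)"
proof (rule bij_betw_imageI[OF inj_onI])
  fix \<M> \<N> :: "'u cospan set"
  assume classes: "\<M> \<in> move_classes n" "\<N> \<in> move_classes n" and "move_letter n \<M> = move_letter n \<N>"
  then have "\<M> \<inter> \<N> \<noteq> {}" using classes[THEN move_letter_cospan_in] by auto
  then show "\<M> = \<N>" using quotient_disj[OF equiv_move_iso] classes
    unfolding move_classes_def by blast
next
  have "c \<in> move_letter n ` (move_classes n :: 'u cospan set set)" if c: "c \<in> letters n" for c
  proof -
    let ?M = "letter_cospan n c :: 'u cospan"
    let ?\<M> = "move_iso n `` {?M}"
    have in_classes: "?\<M> \<in> move_classes n"
      unfolding move_classes_def by (rule quotientI[OF letter_cospan_basic_move[OF c]])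
    have "?M \<in> ?\<M>" by (rule equiv_class_self[OF equiv_move_iso letter_cospan_basic_move[OF c]])
    then obtain x u y where "cospan_iso_by x u y (letter_cospan n (move_letter n ?\<M>)) ?M"
      using move_classes_iso[OF in_classes move_letter_cospan_in[OF in_classes]] by blast
    from letter_cospan_iso_imp_eq[OF this move_letter_in[OF in_classes] c]
    show ?thesis by (rule image_eqI[OF sym in_classes])
  qed
  then show "move_letter n ` (move_classes n :: 'u cospan set set) = letters n"
    using move_letter_in by blast
qed

lemma cod_pos_eq:
  fixes \<M> :: "'u::infinite cospan set"
  assumes in_classes: "\<M> \<in> move_classes n"
  shows "cod_pos \<M> = (yo (Pl (tgt_arity (move_letter n \<M>))) :: 'u psh)"
proof -
  let ?m = "tgt_arity (move_letter n \<M>)"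
  let ?L = "letter_cospan n (move_letter n \<M>) :: 'u cospan"
  have L: "src (snd ?L) = yo (Pl ?m)"
    by (rule basic_cospan_ends(3)[OF lettersD[OF move_letter_in[OF in_classes]]])
  have "(THE n'. \<exists>M\<in>\<M>. src (snd M) = yo (Pl n')) = ?m"
  proof (rule the_equality)
    show "\<exists>M\<in>\<M>. src (snd M) = yo (Pl ?m)" using move_letter_cospan_in[OF in_classes] L by blast
    fix m assume "\<exists>M\<in>\<M>. src (snd M) = yo (Pl m)"
    then obtain M where M: "M \<in> \<M>" "src (snd M) = yo (Pl m)" by blast
    obtain x u y where "cospan_iso_by x u y ?L M"
      using move_classes_iso[OF in_classes move_letter_cospan_in[OF in_classes] M(1)] by blast
    from cospan_iso_by_hom(3)[OF this] have "y \<in> hom Chat (yo (Pl ?m)) (yo (Pl m))"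
      using L M(2) by simp
    from yo_Pl_hom_unique(1)[OF this] show "m = ?m" by simp
  qed
  then show ?thesis by (simp add: cod_pos_def)
qed

section \<open>Innocent strategies\<close>

definition words :: "nat \<Rightarrow> bobj list set" where
  "words n = {cs. composable n cs}"

lemma branch_words: "c \<in> letters n \<Longrightarrow> branch (words n) c = words (tgt_arity c)"
  by (auto simp: words_def letters_def)

lemma Views_equivalent_words:
  "equivalent_categories (Views (yo (Pl n) :: 'u::infinite psh)) (prefix_cat (words n))"
proof (rule is_equivalence_imp_equivalent)
  show "is_equivalence (Views (yo (Pl n) :: 'u psh)) (prefix_cat (words n))
      \<lparr>FO = view_word n, FA = (\<lambda>f. (view_word n (Dom (Views (yo (Pl n))) f),
        view_word n (Cod (Views (yo (Pl n))) f)))\<rparr>"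
    unfolding words_def
    by (rule is_equivalence_prefix_cat[OF category_Views Views_thin Views_hom_nonempty_iff view_word_surj])
qed (rule category_Views, rule prefix_cat.category_axioms)

lemma Strat_equivalent_PSh_words:
  "equivalent_categories (Strat (yo (Pl n)) :: ('u::infinite strategy, _) cat)
    (PSh (prefix_cat (words n)) :: ((_, 'u) word_psh, _) cat)"
  unfolding Strat_def by (rule equivalent_PSh[OF Views_equivalent_words])

lemma rooted_words_words: "rooted_words (words n) (letters n)"
  by unfold_locales (auto simp: words_def letters_def)

lemma PSh_branch_equivalent_Strat:
  fixes \<M> :: "'u::infinite cospan set"
  assumes in_classes: "\<M> \<in> move_classes n"
  shows "equivalent_categories
    (PSh (prefix_cat (branch (words n) (move_letter n \<M>))) :: ((_, 'u) word_psh, _) cat)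
    (Strat (cod_pos \<M>))"
  unfolding branch_words[OF move_letter_in[OF in_classes]] cod_pos_eq[OF in_classes]
  by (rule equivalent_categories_sym[OF Strat_equivalent_PSh_words])

theorem mainTheorem4:
  fixes n :: nat
  shows "equivalent_categories
    (Strat (yo (Pl n)) :: ('u::infinite strategy, 'u strategy_arr) cat)
    (Fam (product_cat (move_classes n) (\<lambda>M :: 'u cospan set. Strat (cod_pos M)))
      :: (('u, 'u cospan set \<Rightarrow> 'u strategy) fam, _) cat)"
proof -
  let ?PSh = "\<lambda>L. PSh (prefix_cat L) :: ((bobj, 'u) word_psh, _) cat"
  have "equivalent_categories (Strat (yo (Pl n)) :: ('u strategy, 'u strategy_arr) cat) (?PSh (words n))"
    by (rule Strat_equivalent_PSh_words)
  also have "equivalent_categories (?PSh (words n))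
      (Fam (product_cat (letters n) (\<lambda>c. ?PSh (branch (words n) c))) :: (('u, _) fam, _) cat)"
    by (rule rooted_words.PSh_equivalent_Fam[OF rooted_words_words])
  also have "equivalent_categories \<dots>
      (Fam (product_cat (move_classes n) (\<lambda>M :: 'u cospan set.
        ?PSh (branch (words n) (move_letter n M))))
        :: (('u, _) fam, _) cat)"
    by (intro equivalent_Fam equivalent_product_cat_reindex bij_betw_move_letter prefix_cat.category_PSh)
  also have "equivalent_categories \<dots>
      (Fam (product_cat (move_classes n) (\<lambda>M :: 'u cospan set. Strat (cod_pos M)))
        :: (('u, _) fam, _) cat)"
    by (intro equivalent_Fam equivalent_product_cat PSh_branch_equivalent_Strat)
  finally show ?thesis .
qed

end
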